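(* Let $k$ be a division ring, let $n\ge 1$, and let $R\in\mathbf{RSPS}^n(k)$. Then the classical Krull dimension of $R$ (the supremum of lengths $t$ of chains $P_0\subsetneq P_1\subsetneq\dots\subsetneq P_t$ of prime ideals of $R$) equals $n$.
   Context: A ring $R$ is local if it has a unique maximal two-sided ideal $\mathfrak{m}$ and $R/\mathfrak{m}$ is simple artinian; a complete local ring is a local ring complete and separated in the $\mathfrak{m}$-adic topology (a division ring is one, with $\mathfrak{m}=0$). A skew derivation $(\sigma,\delta)$ of $R$ consists of a ring automorphism $\sigma$ and an additive map $\delta$ with $\delta(ab)=\delta(a)b+\sigma(a)\delta(b)$; it is local if $\sigma(\mathfrak{m})\subseteq\mathfrak{m}$, $\delta(R)\subseteq\mathfrak{m}$, $\delta(\mathfrak{m})\subseteq\mathfrak{m}^2$. For local $(\sigma,\delta)$, $R[[x;\sigma,\delta]]$ denotes the ring of formal series $\sum_{i\ge0}r_ix^i$ ($r_i\in R$) with multiplication extending that of $R$, $x^ix^j=x^{i+j}$, and $xa=\sigma(a)x+\delta(a)$ ($a\in R$); it is a complete local ring. $\mathbf{SPS}(R)$ is the class of such rings, and $\mathbf{SPS}^n(R)$ the class of $n$-fold iterates. For a complete local ring $R_0$ and $R\in\mathbf{SPS}^n(R_0)$, $R$ is called rigid, written $R\in\mathbf{RSPS}^n(R_0)$, if there is a chain $R_0\subsetneq R_1\subsetneq\dots\subsetneq R_n=R$ with $R_i=R_{i-1}[[x_i;\sigma_i,\delta_i]]\in\mathbf{SPS}(R_{i-1})$ for each $i$, which is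 stable: for all $0\le i<j\le n$, the maximal ideal $\mathfrak{m}_i$ of $R_i$ satisfies $\sigma_j(\mathfrak{m}_i)\subseteq\mathfrak{m}_i$ and $\delta_j(\mathfrak{m}_i)\subseteq\mathfrak{m}_i$. *)

theory Defs
  imports "HOL-Algebra.Algebra" "HOL-Library.Extended_Nat"
begin

definition division_ring :: "('a, 'b) ring_scheme \<Rightarrow> bool" where
  "division_ring K \<longleftrightarrow> ring K \<and> \<zero>\<^bsub>K\<^esub> \<noteq> \<one>\<^bsub>K\<^esub> \<and>
     (\<forall>a \<in> carrier K - {\<zero>\<^bsub>K\<^esub>}. a \<in> Units K)"

definition left_ideal :: "'a set \<Rightarrow> ('a, 'b) ring_scheme \<Rightarrow> bool" where
  "left_ideal I R \<longleftrightarrow> additive_subgroup I R \<and>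
     (\<forall>a \<in> carrier R. \<forall>y \<in> I. a \<otimes>\<^bsub>R\<^esub> y \<in> I)"

text \<open>Artinian = descending chain condition on left ideals (for simple rings left and right
  artinian coincide).\<close>
definition left_artinian :: "('a, 'b) ring_scheme \<Rightarrow> bool" where
  "left_artinian R \<longleftrightarrow> ring R \<and>
     \<not> (\<exists>I :: nat \<Rightarrow> 'a set. (\<forall>k. left_ideal (I k) R) \<and> (\<forall>k. I (Suc k) \<subset> I k))"

definition simple_ring :: "('a, 'b) ring_scheme \<Rightarrow> bool" where
  "simple_ring R \<longleftrightarrow> ring R \<and> carrier R \<noteq> {\<zero>\<^bsub>R\<^esub>} \<and>
     (\<forall>I. ideal I R \<longrightarrow> I = {\<zero>\<^bsub>R\<^esub>} \<or> I = carrier R)"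

definition max_ideal :: "('a, 'b) ring_scheme \<Rightarrow> 'a set" where
  "max_ideal R = (THE m. maximalideal m R)"

definition local_ring :: "('a, 'b) ring_scheme \<Rightarrow> bool" where
  "local_ring R \<longleftrightarrow> ring R \<and> (\<exists>!m. maximalideal m R) \<and>
     simple_ring (R Quot max_ideal R) \<and> left_artinian (R Quot max_ideal R)"

primrec ideal_pow :: "('a, 'b) ring_scheme \<Rightarrow> 'a set \<Rightarrow> nat \<Rightarrow> 'a set" where
  "ideal_pow R I 0 = carrier R"
| "ideal_pow R I (Suc k) = I \<cdot>\<^bsub>R\<^esub> ideal_pow R I k"

definition adic_conv :: "('a, 'b) ring_scheme \<Rightarrow> 'a set \<Rightarrow> (nat \<Rightarrow> 'a) \<Rightarrow> 'a \<Rightarrow> bool" where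
  "adic_conv R I f l \<longleftrightarrow> l \<in> carrier R \<and>
     (\<forall>N. \<exists>M. \<forall>p \<ge> M. f p \<ominus>\<^bsub>R\<^esub> l \<in> ideal_pow R I N)"

definition adic_cauchy :: "('a, 'b) ring_scheme \<Rightarrow> 'a set \<Rightarrow> (nat \<Rightarrow> 'a) \<Rightarrow> bool" where
  "adic_cauchy R I f \<longleftrightarrow> (\<forall>N. \<exists>M. \<forall>p \<ge> M. \<forall>q \<ge> M. f p \<ominus>\<^bsub>R\<^esub> f q \<in> ideal_pow R I N)"

definition adic_lim :: "('a, 'b) ring_scheme \<Rightarrow> 'a set \<Rightarrow> (nat \<Rightarrow> 'a) \<Rightarrow> 'a" where
  "adic_lim R I f = (THE l. adic_conv R I f l)"

definition complete_local :: "('a, 'b) ring_scheme \<Rightarrow> bool" where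
  "complete_local R \<longleftrightarrow> local_ring R \<and>
     (\<Inter>N. ideal_pow R (max_ideal R) N) = {\<zero>\<^bsub>R\<^esub>} \<and>
     (\<forall>f. range f \<subseteq> carrier R \<longrightarrow> adic_cauchy R (max_ideal R) f \<longrightarrow>
          (\<exists>l. adic_conv R (max_ideal R) f l))"

definition skew_derivation :: "('a, 'b) ring_scheme \<Rightarrow> ('a \<Rightarrow> 'a) \<Rightarrow> ('a \<Rightarrow> 'a) \<Rightarrow> bool" where
  "skew_derivation R \<sigma> \<delta> \<longleftrightarrow> \<sigma> \<in> ring_iso R R \<and>
     (\<forall>a \<in> carrier R. \<delta> a \<in> carrier R) \<and>
     (\<forall>a \<in> carrier R. \<forall>b \<in> carrier R.
        \<delta> (a \<oplus>\<^bsub>R\<^esub> b) = \<delta> a \<oplus>\<^bsub>R\<^esub> \<delta> b \<and>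
        \<delta> (a \<otimes>\<^bsub>R\<^esub> b) = \<delta> a \<otimes>\<^bsub>R\<^esub> b \<oplus>\<^bsub>R\<^esub> \<sigma> a \<otimes>\<^bsub>R\<^esub> \<delta> b)"

definition local_skew_derivation :: "('a, 'b) ring_scheme \<Rightarrow> ('a \<Rightarrow> 'a) \<Rightarrow> ('a \<Rightarrow> 'a) \<Rightarrow> bool" where
  "local_skew_derivation R \<sigma> \<delta> \<longleftrightarrow> skew_derivation R \<sigma> \<delta> \<and>
     \<sigma> ` max_ideal R \<subseteq> max_ideal R \<and>
     \<delta> ` carrier R \<subseteq> max_ideal R \<and>
     \<delta> ` max_ideal R \<subseteq> ideal_pow R (max_ideal R) 2"

text \<open>\<open>sd_word R \<sigma> \<delta> i l b\<close> is the coefficient of \<open>x^l\<close> in \<open>x^i b\<close>, computed from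
  \<open>x a = \<sigma>(a) x + \<delta>(a)\<close>: it is the sum of all words in \<open>\<sigma>, \<delta>\<close> of length \<open>i\<close> with
  exactly \<open>l\<close> letters \<open>\<sigma>\<close>, applied to \<open>b\<close>.\<close>
fun sd_word :: "('a, 'b) ring_scheme \<Rightarrow> ('a \<Rightarrow> 'a) \<Rightarrow> ('a \<Rightarrow> 'a) \<Rightarrow> nat \<Rightarrow> nat \<Rightarrow> 'a \<Rightarrow> 'a" where
  "sd_word R \<sigma> \<delta> 0 l b = (if l = 0 then b else \<zero>\<^bsub>R\<^esub>)"
| "sd_word R \<sigma> \<delta> (Suc i) l b =
     (if l = 0 then \<delta> (sd_word R \<sigma> \<delta> i 0 b)
      else \<sigma> (sd_word R \<sigma> \<delta> i (l - 1) b) \<oplus>\<^bsub>R\<^esub> \<delta> (sd_word R \<sigma> \<delta> i l b))"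

text \<open>The ring \<open>R[[x;\<sigma>,\<delta>]]\<close>: a series \<open>\<Sum> r_i x^i\<close> is its coefficient sequence.
  The product has \<open>k\<close>-th coefficient \<open>\<Sum>_i \<Sum>_{j\<le>k} a_i \<cdot> sd_word i (k-j) (b_j)\<close>, the sum over
  \<open>i\<close> being taken as a limit in the \<open>\<mm>\<close>-adic topology of \<open>R\<close>.\<close>
definition skew_ps_ring :: "('a, 'b) ring_scheme \<Rightarrow> ('a \<Rightarrow> 'a) \<Rightarrow> ('a \<Rightarrow> 'a) \<Rightarrow> (nat \<Rightarrow> 'a) ring" where
  "skew_ps_ring R \<sigma> \<delta> =
     \<lparr> carrier = {f. \<forall>i. f i \<in> carrier R},
       monoid.mult = (\<lambda>a b k. adic_lim R (max_ideal R)
                 (\<lambda>N. finsum R (\<lambda>i. finsum R (\<lambda>j. a i \<otimes>\<^bsub>R\<^esub> sd_word R \<sigma> \<delta> i (k - j) (b j)) {..k}) {..<N})),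
       monoid.one = (\<lambda>k. if k = 0 then \<one>\<^bsub>R\<^esub> else \<zero>\<^bsub>R\<^esub>),
       ring.zero = (\<lambda>k. \<zero>\<^bsub>R\<^esub>),
       ring.add = (\<lambda>a b k. a k \<oplus>\<^bsub>R\<^esub> b k) \<rparr>"

definition ps_const :: "('a, 'b) ring_scheme \<Rightarrow> 'a \<Rightarrow> nat \<Rightarrow> 'a" where
  "ps_const R a = (\<lambda>k. if k = 0 then a else \<zero>\<^bsub>R\<^esub>)"

definition ps_var :: "('a, 'b) ring_scheme \<Rightarrow> nat \<Rightarrow> 'a" where
  "ps_var R = (\<lambda>k. if k = 1 then \<one>\<^bsub>R\<^esub> else \<zero>\<^bsub>R\<^esub>)"

definition is_skew_ps_ext ::
  "('a, 'b) ring_scheme \<Rightarrow> ('a, 'c) ring_scheme \<Rightarrow> ('a \<Rightarrow> 'a) \<Rightarrow> ('a \<Rightarrow> 'a) \<Rightarrow> 'a \<Rightarrow> bool" where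
  "is_skew_ps_ext A S \<sigma> \<delta> x \<longleftrightarrow> complete_local A \<and> local_skew_derivation A \<sigma> \<delta> \<and>
     (\<exists>\<phi>. \<phi> \<in> ring_iso (skew_ps_ring A \<sigma> \<delta>) S \<and>
          (\<forall>a \<in> carrier A. \<phi> (ps_const A a) = a) \<and> \<phi> (ps_var A) = x)"

definition RSPS :: "nat \<Rightarrow> 'a set \<Rightarrow> ('a, 'b) ring_scheme \<Rightarrow> bool" where
  "RSPS n R0 R \<longleftrightarrow>
     (\<exists>(C :: nat \<Rightarrow> 'a set) (x :: nat \<Rightarrow> 'a) (\<sigma> :: nat \<Rightarrow> 'a \<Rightarrow> 'a) (\<delta> :: nat \<Rightarrow> 'a \<Rightarrow> 'a).
        C 0 = R0 \<and> C n = carrier R \<and>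
        (\<forall>i \<le> n. subring (C i) R) \<and>
        (\<forall>i. 1 \<le> i \<and> i \<le> n \<longrightarrow> C (i - 1) \<subset> C i \<and>
             is_skew_ps_ext (R\<lparr>carrier := C (i - 1)\<rparr>) (R\<lparr>carrier := C i\<rparr>) (\<sigma> i) (\<delta> i) (x i)) \<and>
        (\<forall>i j. i < j \<and> j \<le> n \<longrightarrow>
             \<sigma> j ` max_ideal (R\<lparr>carrier := C i\<rparr>) \<subseteq> max_ideal (R\<lparr>carrier := C i\<rparr>) \<and>
             \<delta> j ` max_ideal (R\<lparr>carrier := C i\<rparr>) \<subseteq> max_ideal (R\<lparr>carrier := C i\<rparr>)))"

definition prime_ideal :: "'a set \<Rightarrow> ('a, 'b) ring_scheme \<Rightarrow> bool" where
  "prime_ideal P R \<longleftrightarrow> ideal P R \<and> P \<noteq> carrier R \<and>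
     (\<forall>I J. ideal I R \<longrightarrow> ideal J R \<longrightarrow> I \<cdot>\<^bsub>R\<^esub> J \<subseteq> P \<longrightarrow> I \<subseteq> P \<or> J \<subseteq> P)"

definition krull_dim :: "('a, 'b) ring_scheme \<Rightarrow> enat" where
  "krull_dim R = Sup {enat t | t. \<exists>P :: nat \<Rightarrow> 'a set.
       (\<forall>i \<le> t. prime_ideal (P i) R) \<and> (\<forall>i < t. P i \<subset> P (Suc i))}"

end

theory Submission
  imports Defs "HOL-Computational_Algebra.Polynomial"
begin

text \<open>Both bounds rest on the leading exponents of iterated skew power series. A valuation \<open>v\<close> on \<open>A\<close>
  extends to \<open>A[[x;\<sigma>,\<delta>]]\<close> by \<open>w (\<Sum> a\<^sub>s x^s) = min\<^sub>s (v a\<^sub>s + s e)\<close>. Exponents are compared by total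
  degree, and ties are broken in favour of the larger exponent of the latest variable; since \<open>\<delta>\<close> raises
  the degree, the terms it produces never reach the leading one, and \<open>w\<close> is multiplicative as soon as
  \<open>v\<close> is preserved by \<open>\<sigma>\<close>. This is where rigidity enters: \<open>\<sigma>\<close> maps \<open>x\<^sub>i\<close> into \<open>\<mm>\<^sub>i\<close>, hence
  \<open>v (\<sigma> x\<^sub>i) \<ge> v x\<^sub>i\<close>, hence \<open>v \<circ> \<sigma> \<ge> v\<close>, and equality follows because every graded piece is
  one-dimensional.

  Starting the construction at \<open>R\<^sub>i\<close> with the valuation that is infinite on \<open>\<mm>\<^sub>i\<close> and zero elsewhere
  gives \<open>R\<close> a pseudo-valuation whose support is completely prime; for \<open>i = 0, \<dots>, n\<close> these supports
  increase strictly.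

  For the upper bound, Dickson's lemma and completeness provide finite standard bases of left ideals,
  so that \<open>R\<close> is left noetherian and satisfies an Artin--Rees bound. Let \<open>h\<^sub>P m\<close> be the number of
  exponents of degree at most \<open>m\<close> that are not leading exponents of \<open>P\<close>. If \<open>P \<subset> Q\<close> are prime, then
  by Goldie \<open>Q\<close> contains an element that is regular modulo \<open>P\<close>, and multiplication by it yields
  \<open>h\<^sub>Q (m + s) + h\<^sub>P m \<le> h\<^sub>P (m + s)\<close>. Along a chain of length \<open>t\<close> this forces growth like
  \<open>m choose t\<close>, whereas \<open>h\<^sub>P m \<le> (m + 1)^n\<close>.\<close>

section \<open>Exponents and values\<close>

text \<open>The relation \<open>x a = \<sigma>(a) x + \<delta>(a)\<close> dictates the order.
  Multiplication by \<open>x\<close> raises the degree by one, and \<open>\<delta>\<close> is only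
  known to raise it by at least one; degree alone cannot separate \<open>\<sigma>(a) x\<close> from
  \<open>\<delta>(a)\<close>, so a tie must be decided for the term with more factors
  \<open>x\<close>. The same reversal makes the latest variable the smallest positive value, which
  turns membership of \<open>\<sigma> x\<^sub>i\<close> in a maximal ideal into a sharp bound on its
  value.

  The obstacle is that products are limits in the adic topology of the coefficient ring, while all
  estimates concern degrees. The two topologies are matched level by level, in the same induction
  that builds the valuations. For a valuation with nonzero support only one of the two comparisons
  survives; it suffices, because the coefficient functions do not depend on the valuation.

  In the upper bound the counting function takes the place of the dimension theory of a graded ring:
  only sets of leading exponents are compared, and neither graded rings nor rings of fractions are
  formed.\<close>

datatype val = Val "int poly" | Infty

instantiation val :: linorder
begin

definition less_eq_val :: "val \<Rightarrow> val \<Rightarrow> bool" where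
  "a \<le> b \<longleftrightarrow> (case b of Infty \<Rightarrow> True | Val q \<Rightarrow> (case a of Infty \<Rightarrow> False | Val p \<Rightarrow> p \<le> q))"

definition less_val :: "val \<Rightarrow> val \<Rightarrow> bool" where
  "a < b \<longleftrightarrow> (case a of Infty \<Rightarrow> False | Val p \<Rightarrow> (case b of Infty \<Rightarrow> True | Val q \<Rightarrow> p < q))"

instance
  by standard (auto simp: less_eq_val_def less_val_def split: val.splits)

end

instantiation val :: comm_monoid_add
begin

definition zero_val :: val where "0 = Val 0"

definition plus_val :: "val \<Rightarrow> val \<Rightarrow> val" where
  "a + b = (case a of Infty \<Rightarrow> Infty | Val p \<Rightarrow> (case b of Infty \<Rightarrow> Infty | Val q \<Rightarrow> Val (p + q)))"

instance
  by standard (auto simp: zero_val_def plus_val_def split: val.splits)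

end

lemma val_simps [simp]:
  "Val p \<le> Val q \<longleftrightarrow> p \<le> q" "a \<le> Infty" "Infty \<le> Val p \<longleftrightarrow> False"
  "Val p < Val q \<longleftrightarrow> p < q" "Val p < Infty" "\<not> Infty < a"
  "Val p + Val q = Val (p + q)" "Infty + a = Infty" "a + Infty = Infty"
  by (auto simp: less_eq_val_def less_val_def plus_val_def split: val.splits)

lemma zero_val_neq_Infty [simp]: "0 \<noteq> Infty" "Infty \<noteq> 0"
  by (simp_all add: zero_val_def)

lemma Infty_le_iff [simp]: "Infty \<le> a \<longleftrightarrow> a = Infty"
  by (cases a) auto

lemma less_Infty_iff: "a < Infty \<longleftrightarrow> a \<noteq> Infty"
  by (cases a) auto

lemma val_add_mono: "a \<le> b \<Longrightarrow> c \<le> d \<Longrightarrow> a + c \<le> b + (d::val)"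
  by (cases a; cases b; cases c; cases d) auto

lemma val_add_less_le_mono: "a < b \<Longrightarrow> c \<le> d \<Longrightarrow> c \<noteq> Infty \<Longrightarrow> a + c < b + (d::val)"
  by (cases a; cases b; cases c; cases d) auto

lemma val_add_Val_0 [simp]: "a + Val 0 = a"
  by (cases a) auto

lemma val_add_cancel_le [simp]: "a + Val p \<le> b + Val p \<longleftrightarrow> a \<le> b"
  by (cases a; cases b) auto

lemma val_add_cancel_less [simp]: "a + Val p < b + Val p \<longleftrightarrow> a < b"
  by (cases a; cases b) auto

lemma val_add_cancel_eq [simp]: "a + Val p = b + Val p \<longleftrightarrow> a = b"
  by (cases a; cases b) auto

lemma val_add_eq_Infty [simp]: "a + b = Infty \<longleftrightarrow> a = Infty \<or> b = Infty"
  by (cases a; cases b) auto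

section \<open>Monomial exponents and their order\<close>

abbreviation "pcoeff \<equiv> Polynomial.coeff"
abbreviation "pmonom \<equiv> Polynomial.monom"

lemma int_poly_lessI:
  fixes p q :: "int poly"
  assumes "pcoeff p m < pcoeff q m" "\<And>k. k > m \<Longrightarrow> pcoeff p k = pcoeff q k"
  shows "p < q"
proof -
  have "degree (q - p) = m"
  proof (rule antisym)
    show "degree (q - p) \<le> m" using assms(2) by (intro degree_le) auto
    show "m \<le> degree (q - p)" using assms(1) by (intro le_degree) auto
  qed
  then show ?thesis using assms(1) by (simp add: less_poly_def pos_poly_def)
qed

text \<open>Total degree, infinite on the support. Truncation by \<open>nat\<close> loses nothing on
  the values of monomials, whose coefficient at \<open>N\<close> is nonnegative.\<close>

definition vdeg :: "nat \<Rightarrow> val \<Rightarrow> enat" where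
  "vdeg N a = (case a of Infty \<Rightarrow> \<infinity> | Val p \<Rightarrow> enat (nat (pcoeff p N)))"

lemma vdeg_simps [simp]: "vdeg N Infty = \<infinity>" "vdeg N (Val p) = enat (nat (pcoeff p N))"
  by (auto simp: vdeg_def)

text \<open>Exponents of monomials are encoded as integer polynomials: the variable \<open>x\<^sub>l\<close> has the value
  \<open>X^N - X^l\<close>, where \<open>N\<close> exceeds the number of variables. Since integer polynomials are ordered by
  their leading coefficient, values are compared first by total degree (the coefficient at \<open>N\<close>) and
  then, reversed, by the exponents of the variables, the latest one first.\<close>

definition evec :: "nat \<Rightarrow> nat \<Rightarrow> int poly" where
  "evec N l = pmonom 1 N - pmonom 1 l"

text \<open>For \<open>j < N\<close> this is the free commutative monoid on \<open>evec N 1\<close>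
  up to \<open>evec N j\<close>: minus the coefficient at \<open>l\<close> is the exponent of the
  \<open>l\<close>-th variable. In terms of coefficients, divisibility of monomials is membership of
  a difference.\<close>

definition Gam :: "nat \<Rightarrow> nat \<Rightarrow> int poly set" where
  "Gam N j = {p. (\<forall>l. l \<notin> insert N {1..j} \<longrightarrow> pcoeff p l = 0) \<and> (\<forall>l\<in>{1..j}. pcoeff p l \<le> 0) \<and>
     pcoeff p N = - (\<Sum>l\<in>{1..j}. pcoeff p l)}"

definition Vals :: "nat \<Rightarrow> nat \<Rightarrow> val set" where
  "Vals N j = insert Infty (Val ` Gam N j)"

lemma Infty_Vals [simp]: "Infty \<in> Vals N j"
  by (simp add: Vals_def)

lemma Val_Vals [simp]: "Val p \<in> Vals N j \<longleftrightarrow> p \<in> Gam N j"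
  by (auto simp: Vals_def)

lemma Gam_zero [simp]: "0 \<in> Gam N j"
  by (simp add: Gam_def)

lemma zero_Vals [simp]: "0 \<in> Vals N j"
  by (simp add: zero_val_def)

lemma Gam_add: "p \<in> Gam N j \<Longrightarrow> q \<in> Gam N j \<Longrightarrow> p + q \<in> Gam N j"
  by (auto simp: Gam_def sum.distrib intro: add_nonpos_nonpos)

lemma Vals_add: "a \<in> Vals N j \<Longrightarrow> b \<in> Vals N j \<Longrightarrow> a + b \<in> Vals N j"
  by (cases a; cases b) (auto intro: Gam_add)

lemma Gam_mono:
  assumes "i \<le> j" "j < N" shows "Gam N i \<subseteq> Gam N j"
proof
  fix p assume p: "p \<in> Gam N i"
  have "(\<Sum>l\<in>{1..j}. pcoeff p l) = (\<Sum>l\<in>{1..i}. pcoeff p l)"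
    using assms p by (intro sum.mono_neutral_right) (auto simp: Gam_def)
  moreover have "pcoeff p l \<le> 0" if "l \<in> {1..j}" for l
    using p that assms by (cases "l \<in> {1..i}") (auto simp: Gam_def)
  ultimately show "p \<in> Gam N j" using p assms by (auto simp: Gam_def)
qed

lemma Vals_mono: "i \<le> j \<Longrightarrow> j < N \<Longrightarrow> a \<in> Vals N i \<Longrightarrow> a \<in> Vals N j"
  using Gam_mono[of i j N] by (cases a) auto

lemma evec_coeff: "pcoeff (evec N l) k = (if k = N then 1 else 0) - (if k = l then 1 else 0)"
  by (simp add: evec_def)

lemma evec_Gam:
  assumes "1 \<le> l" "l \<le> j" "j < N" shows "evec N l \<in> Gam N j"
proof -
  have "(\<Sum>k\<in>{1..j}. pcoeff (evec N l) k) = (\<Sum>k\<in>{1..j}. if k = l then -1 else 0)"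
    using assms by (intro sum.cong) (auto simp: evec_coeff)
  also have "\<dots> = -1" using assms by simp
  finally show ?thesis using assms by (auto simp: Gam_def evec_coeff)
qed

lemma Gam_N_nonneg: "p \<in> Gam N j \<Longrightarrow> 0 \<le> pcoeff p N"
  by (auto simp: Gam_def intro!: sum_nonpos)

lemma Gam_above: "p \<in> Gam N j \<Longrightarrow> j < N \<Longrightarrow> k > N \<Longrightarrow> pcoeff p k = 0"
  by (auto simp: Gam_def)

lemma Gam_lessI:
  assumes "p \<in> Gam N j" "q \<in> Gam N j" "j < N" "pcoeff p N < pcoeff q N"
  shows "p < q"
  using assms by (intro int_poly_lessI[of _ N]) (auto simp: Gam_above)

lemma Gam_deg_mono:
  assumes "p \<in> Gam N j" "q \<in> Gam N j" "j < N" "p \<le> q"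
  shows "pcoeff p N \<le> pcoeff q N"
  using Gam_lessI[of q N j p] assms by force

text \<open>Below \<open>N\<close> the highest index in use is \<open>j\<close>, and its coefficient
  is minus an exponent: at equal degree, fewer factors of the latest variable mean a larger
  value.\<close>

lemma Gam_less_top:
  assumes "p \<in> Gam N j" "q \<in> Gam N j" "j < N" "pcoeff p N = pcoeff q N" "pcoeff p j < pcoeff q j"
  shows "p < q"
proof (rule int_poly_lessI)
  show "pcoeff p j < pcoeff q j" by fact
  fix k assume "k > j"
  then show "pcoeff p k = pcoeff q k"
    using assms by (cases "k = N") (auto simp: Gam_def)
qed

lemma Gam_deg_0:
  assumes "p \<in> Gam N j" "j < N" "pcoeff p N = 0" shows "p = 0"
proof -
  have "pcoeff p k = 0" for k
  proof (cases "k \<in> {1..j}")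
    case True
    have "(\<Sum>l\<in>{1..j}. - pcoeff p l) = 0" using assms by (simp add: Gam_def sum_negf)
    then have "\<forall>l\<in>{1..j}. - pcoeff p l = 0"
      using assms by (subst (asm) sum_nonneg_eq_0_iff) (auto simp: Gam_def)
    then show ?thesis using True by auto
  next
    case False
    then show ?thesis using assms by (cases "k = N") (auto simp: Gam_def)
  qed
  then show ?thesis by (auto intro: poly_eqI)
qed

lemma Gam_nonneg: assumes "p \<in> Gam N j" "j < N" shows "0 \<le> p"
proof (cases "pcoeff p N = 0")
  case True
  then show ?thesis using Gam_deg_0 assms by blast
next
  case False
  then show ?thesis using Gam_lessI[of 0 N j p] Gam_N_nonneg[OF assms(1)] assms by force
qed

lemma Vals_nonneg: "a \<in> Vals N j \<Longrightarrow> j < N \<Longrightarrow> 0 \<le> a"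
  by (cases a) (auto simp: zero_val_def intro: Gam_nonneg)

lemma Gam_pos_deg:
  assumes "p \<in> Gam N j" "j < N" "0 < p" shows "1 \<le> pcoeff p N"
  using Gam_deg_0[OF assms(1,2)] Gam_N_nonneg[OF assms(1)] assms(3) by force

text \<open>A positive exponent has degree at least one, and among the exponents of degree one the
  reversed tie-break puts the latest variable first. Thus mere positivity of a value gives an
  explicit lower bound.\<close>

lemma evec_least:
  assumes p: "p \<in> Gam N j" and j: "1 \<le> j" "j < N" and "0 < p"
  shows "evec N j \<le> p"
proof -
  have d: "1 \<le> pcoeff p N" using Gam_pos_deg assms by blast
  have e: "evec N j \<in> Gam N j" using evec_Gam j by auto
  have eN: "pcoeff (evec N j) N = 1" using j by (simp add: evec_coeff)
  have le: "pcoeff p l \<le> 0" if "l \<in> {1..j}" for l using p that by (auto simp: Gam_def)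
  show ?thesis
  proof (cases "pcoeff p N = 1")
    case False
    then show ?thesis using Gam_lessI[OF e p] d eN j by simp
  next
    case True
    then have s: "(\<Sum>l\<in>{1..j}. pcoeff p l) = -1" using p by (simp add: Gam_def)
    have sp: "(\<Sum>l\<in>{1..j}. pcoeff p l) = pcoeff p j + (\<Sum>l\<in>{1..j} - {j}. pcoeff p l)"
      using j by (intro sum.remove) auto
    have rest: "(\<Sum>l\<in>{1..j} - {j}. pcoeff p l) \<le> 0" using le by (intro sum_nonpos) auto
    have ge: "pcoeff p j \<ge> -1" using s sp rest by linarith
    show ?thesis
    proof (cases "pcoeff p j = -1")
      case False
      then have "pcoeff (evec N j) j < pcoeff p j" using ge j by (simp add: evec_coeff)
      then show ?thesis using Gam_less_top[OF e p] True eN j by simp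
    next
      case jj: True
      have "(\<Sum>l\<in>{1..j} - {j}. - pcoeff p l) = 0" using s sp jj by (simp add: sum_negf)
      then have z: "\<forall>l\<in>{1..j} - {j}. - pcoeff p l = 0"
        using le by (subst (asm) sum_nonneg_eq_0_iff) auto
      have "p = evec N j"
      proof (rule poly_eqI)
        fix k
        consider "k = N" | "k = j" | "k \<in> {1..j} - {j}" | "k \<notin> insert N {1..j}" using j by auto
        then show "pcoeff p k = pcoeff (evec N j) k"
        proof cases
          case 4
          then show ?thesis using p j by (auto simp: Gam_def evec_coeff)
        qed (use True jj z j in \<open>auto simp: evec_coeff\<close>)
      qed
      then show ?thesis by simp
    qed
  qed
qed

definition Gam_le :: "nat \<Rightarrow> nat \<Rightarrow> nat \<Rightarrow> int poly set" where
  "Gam_le N j m = {p \<in> Gam N j. pcoeff p N \<le> int m}"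

text \<open>The \<open>j\<close> coefficients at the variables determine \<open>p\<close>, and each
  takes at most \<open>m + 1\<close> values. The exponent \<open>j\<close> of this bound is what
  finally limits the length of chains of primes.\<close>

lemma Gam_le_bound:
  assumes "j < N"
  shows "finite (Gam_le N j m) \<and> card (Gam_le N j m) \<le> (m + 1) ^ j"
proof -
  define F where "F = (\<lambda>p. restrict (\<lambda>l. nat (- pcoeff p l)) {1..j})"
  have sub: "F ` Gam_le N j m \<subseteq> ({1..j} \<rightarrow>\<^sub>E {0..m})"
  proof (rule image_subsetI)
    fix p assume p: "p \<in> Gam_le N j m"
    show "F p \<in> {1..j} \<rightarrow>\<^sub>E {0..m}"
    proof (rule PiE_I)
      fix l assume l: "l \<in> {1..j}"
      have "- pcoeff p l \<le> (\<Sum>l\<in>{1..j}. - pcoeff p l)"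
        using l p by (intro member_le_sum) (auto simp: Gam_le_def Gam_def)
      also have "\<dots> \<le> int m" using p by (auto simp: Gam_le_def Gam_def sum_negf)
      finally show "F p l \<in> {0..m}" using l by (simp add: F_def)
    qed (auto simp: F_def)
  qed
  have inj: "inj_on F (Gam_le N j m)"
  proof (rule inj_onI)
    fix p q assume p: "p \<in> Gam_le N j m" and q: "q \<in> Gam_le N j m" and "F p = F q"
    then have "nat (- pcoeff p l) = nat (- pcoeff q l)" if "l \<in> {1..j}" for l
      using that by (auto simp: F_def dest: fun_cong[of _ _ l])
    moreover have "pcoeff p l \<le> 0" "pcoeff q l \<le> 0" if "l \<in> {1..j}" for l
      using that p q by (auto simp: Gam_le_def Gam_def)
    ultimately have eq: "pcoeff p l = pcoeff q l" if "l \<in> {1..j}" for l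
      using that by (metis eq_nat_nat_iff neg_0_le_iff_le neg_equal_iff_equal)
    show "p = q"
    proof (rule poly_eqI)
      fix k
      have "pcoeff p N = pcoeff q N" using p q eq by (simp add: Gam_le_def Gam_def)
      then show "pcoeff p k = pcoeff q k" using p q eq
        by (cases "k = N"; cases "k \<in> {1..j}") (auto simp: Gam_le_def Gam_def)
    qed
  qed
  have fin: "finite ({1..j} \<rightarrow>\<^sub>E {0..m})" by (intro finite_PiE) auto
  show ?thesis
  proof
    show "finite (Gam_le N j m)" using finite_imageD[OF finite_subset[OF sub fin] inj] .
    have "card (Gam_le N j m) = card (F ` Gam_le N j m)" using inj by (simp add: card_image)
    also have "\<dots> \<le> card ({1..j} \<rightarrow>\<^sub>E {0..m})" using sub fin by (intro card_mono)
    also have "\<dots> = (m + 1) ^ j" by (simp add: card_funcsetE)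
    finally show "card (Gam_le N j m) \<le> (m + 1) ^ j" .
  qed
qed

text \<open>Degree comes first in the order and only finitely many exponents have bounded degree, so
  the search is confined to a finite set.\<close>

lemma Gam_has_least:
  assumes "S \<subseteq> Gam N j" "j < N" "S \<noteq> {}"
  shows "\<exists>m\<in>S. \<forall>p\<in>S. m \<le> p"
proof -
  obtain p0 where p0: "p0 \<in> S" using assms by blast
  define F where "F = {p \<in> S. pcoeff p N \<le> pcoeff p0 N}"
  have "0 \<le> pcoeff p0 N" using p0 assms Gam_N_nonneg by blast
  then have "F \<subseteq> Gam_le N j (nat (pcoeff p0 N))" using assms by (auto simp: F_def Gam_le_def)
  then have fin: "finite F" using Gam_le_bound[OF assms(2)] finite_subset by blast
  have "F \<noteq> {}" using p0 by (auto simp: F_def)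
  then have "Min F \<in> S" using Min_in[OF fin] by (auto simp: F_def)
  moreover have "Min F \<le> p" if "p \<in> S" for p
  proof (cases "p \<in> F")
    case True
    then show ?thesis using fin by simp
  next
    case False
    then have "pcoeff p0 N < pcoeff p N" using that by (auto simp: F_def)
    then have "p0 < p" using Gam_lessI[of p0 N j p] p0 that assms by blast
    moreover have "Min F \<le> p0" using fin p0 by (auto simp: F_def)
    ultimately show ?thesis by simp
  qed
  ultimately show ?thesis by blast
qed

lemma Vals_has_least:
  assumes "S \<subseteq> Vals N j" "j < N" "S \<noteq> {}"
  shows "\<exists>m\<in>S. \<forall>p\<in>S. m \<le> p"
proof (cases "S \<subseteq> {Infty}")
  case True
  then show ?thesis using assms by blast
next
  case False
  define S' where "S' = {p. Val p \<in> S}"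
  obtain a where "a \<in> S" "a \<noteq> Infty" using False by blast
  then have "S' \<noteq> {}" by (cases a) (auto simp: S'_def)
  moreover have "S' \<subseteq> Gam N j" using assms(1) by (auto simp: S'_def)
  ultimately obtain m where m: "m \<in> S'" "\<forall>p\<in>S'. m \<le> p" using Gam_has_least assms(2) by metis
  have "Val m \<le> x" if "x \<in> S" for x using that m by (cases x) (auto simp: S'_def)
  then show ?thesis using m(1) by (auto simp: S'_def)
qed

lemma vdeg_mono:
  assumes "a \<in> Vals N j" "b \<in> Vals N j" "j < N" "a \<le> b" shows "vdeg N a \<le> vdeg N b"
  using assms by (cases a; cases b) (auto intro!: nat_mono Gam_deg_mono)

lemma vdeg_add:
  assumes "a \<in> Vals N j" "b \<in> Vals N j" shows "vdeg N (a + b) = vdeg N a + vdeg N b"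
  using assms by (cases a; cases b) (auto simp: nat_add_distrib Gam_N_nonneg)

lemma vdeg_lessI:
  assumes "a \<in> Vals N j" "b \<in> Vals N j" "j < N" "vdeg N a < vdeg N b" shows "a < b"
  using vdeg_mono[OF assms(2,1,3)] assms(4) by (meson leD linorder_not_less)

lemma vdeg_zero [simp]: "vdeg N 0 = 0"
  by (simp add: zero_val_def zero_enat_def)

lemma vdeg_eq_0:
  assumes "a \<in> Vals N j" "j < N" "vdeg N a = 0" shows "a = 0"
proof (cases a)
  case (Val p)
  then have "pcoeff p N \<le> 0" "p \<in> Gam N j" using assms by (auto simp: zero_enat_def)
  then have "p = 0" using Gam_deg_0 Gam_N_nonneg assms(2) by fastforce
  then show ?thesis using Val by (simp add: zero_val_def)
qed (use assms in auto)

lemma evec_mult_Gam: "1 \<le> l \<Longrightarrow> l \<le> j \<Longrightarrow> j < N \<Longrightarrow> of_nat s * evec N l \<in> Gam N j"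
  by (induction s) (auto simp: distrib_right intro!: Gam_add evec_Gam)

lemma of_nat_mult_evec_coeff:
  "pcoeff (of_nat s * evec N l) k = (if k = N then int s else 0) - (if k = l then int s else 0)"
  by (simp add: evec_coeff of_nat_poly)

section \<open>Dickson's lemma\<close>

lemma incseq_subseq_nat:
  fixes f :: "nat \<Rightarrow> nat"
  shows "\<exists>\<phi>. strict_mono \<phi> \<and> incseq (f \<circ> \<phi>)"
proof -
  obtain \<phi> where \<phi>: "strict_mono \<phi>" "monoseq (\<lambda>n. f (\<phi> n))" using seq_monosub by blast
  from \<phi>(2) show ?thesis unfolding monoseq_iff
  proof
    assume "incseq (\<lambda>n. f (\<phi> n))"
    then show ?thesis using \<phi>(1) by (auto simp: o_def)
  next
    assume dec: "decseq (\<lambda>n. f (\<phi> n))"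
    \<comment> \<open>A decreasing sequence of natural numbers is constant once it attains its least
      value, and a constant tail is increasing.\<close>
    define v where "v = (LEAST v. v \<in> range (\<lambda>n. f (\<phi> n)))"
    have "v \<in> range (\<lambda>n. f (\<phi> n))" unfolding v_def by (rule LeastI) blast
    then obtain m0 where m0: "f (\<phi> m0) = v" by auto
    have "f (\<phi> (m + m0)) = v" for m
    proof (rule antisym)
      show "f (\<phi> (m + m0)) \<le> v" using decseqD[OF dec, of m0 "m + m0"] m0 by simp
      show "v \<le> f (\<phi> (m + m0))" unfolding v_def by (rule Least_le) blast
    qed
    then have "incseq (f \<circ> (\<lambda>m. \<phi> (m + m0)))" by (simp add: incseq_def)
    moreover have "strict_mono (\<lambda>m. \<phi> (m + m0))" using \<phi>(1) by (simp add: strict_mono_def)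
    ultimately show ?thesis by blast
  qed
qed

lemma incseq_subseq_finite:
  fixes f :: "'i \<Rightarrow> nat \<Rightarrow> nat"
  assumes "finite I"
  shows "\<exists>\<phi>. strict_mono \<phi> \<and> (\<forall>i\<in>I. incseq (f i \<circ> \<phi>))"
  using assms
proof (induction I)
  case empty
  show ?case by (intro exI[of _ id]) (auto simp: strict_mono_def)
next
  case (insert i I)
  then obtain \<phi> where \<phi>: "strict_mono \<phi>" "\<forall>i\<in>I. incseq (f i \<circ> \<phi>)" by blast
  obtain \<psi> where \<psi>: "strict_mono \<psi>" "incseq ((f i \<circ> \<phi>) \<circ> \<psi>)" using incseq_subseq_nat by blast
  have "incseq (f k \<circ> (\<phi> \<circ> \<psi>))" if "k \<in> I" for k
    using \<phi>(2) that \<psi>(1) by (force simp: incseq_def strict_mono_less_eq)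
  moreover have "incseq (f i \<circ> (\<phi> \<circ> \<psi>))" using \<psi>(2) by (simp only: o_assoc)
  moreover have "strict_mono (\<phi> \<circ> \<psi>)" using \<phi>(1) \<psi>(1) by (simp add: strict_mono_def)
  ultimately show ?case by blast
qed

lemma Gam_diff:
  assumes "p \<in> Gam N j" "q \<in> Gam N j" "\<And>l. l \<in> {1..j} \<Longrightarrow> pcoeff p l \<le> pcoeff q l"
  shows "p - q \<in> Gam N j"
  using assms by (auto simp: Gam_def sum_subtractf)

text \<open>\<open>G\<close> collects the minimal elements for divisibility. If it were infinite, a
  subsequence along which every exponent increases would contain two comparable, hence equal,
  members.\<close>

lemma Dickson:
  assumes S: "S \<subseteq> Gam N j" and j: "j < N"
  shows "\<exists>G. finite G \<and> G \<subseteq> S \<and> (\<forall>p\<in>S. \<exists>g\<in>G. p - g \<in> Gam N j)"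
proof -
  define G where "G = {g \<in> S. \<forall>h\<in>S. g - h \<in> Gam N j \<longrightarrow> h = g}"
  have dom: "\<exists>g\<in>G. p - g \<in> Gam N j" if "p \<in> S" for p
    using that
  proof (induction "nat (pcoeff p N)" arbitrary: p rule: less_induct)
    case less
    show ?case
    proof (cases "p \<in> G")
      case True
      then show ?thesis by force
    next
      case False
      then obtain h where h: "h \<in> S" "p - h \<in> Gam N j" "h \<noteq> p" using less.prems by (auto simp: G_def)
      have "p - h \<noteq> 0" using h by simp
      then have "pcoeff (p - h) N > 0" using Gam_deg_0[OF h(2) j] Gam_N_nonneg[OF h(2)] by force
      then have "pcoeff h N < pcoeff p N" by simp
      then have "nat (pcoeff h N) < nat (pcoeff p N)" using Gam_N_nonneg h(1) S by fastforce
      then obtain g where g: "g \<in> G" "h - g \<in> Gam N j" using less.hyps h(1) by blast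
      have "p - g = (p - h) + (h - g)" by simp
      then have "p - g \<in> Gam N j" using Gam_add[OF h(2) g(2)] by simp
      then show ?thesis using g(1) by blast
    qed
  qed
  have "finite G"
  proof (rule ccontr)
    assume "infinite G"
    then obtain g :: "nat \<Rightarrow> int poly" where g: "inj g" "range g \<subseteq> G"
      using infinite_countable_subset by blast
    obtain \<phi> where \<phi>: "strict_mono \<phi>" "\<forall>l\<in>{1..j}. incseq ((\<lambda>m. nat (- pcoeff (g m) l)) \<circ> \<phi>)"
      using incseq_subseq_finite[of "{1..j}" "\<lambda>l m. nat (- pcoeff (g m) l)"] by auto
    have gS: "g m \<in> S" for m using g(2) by (auto simp: G_def)
    have "g (\<phi> 1) - g (\<phi> 0) \<in> Gam N j"
    proof (rule Gam_diff)
      fix l assume l: "l \<in> {1..j}"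
      have "nat (- pcoeff (g (\<phi> 0)) l) \<le> nat (- pcoeff (g (\<phi> 1)) l)"
        using \<phi>(2) l by (auto simp: incseq_def)
      moreover have "pcoeff (g m) l \<le> 0" for m using gS[of m] S l by (auto simp: Gam_def)
      ultimately show "pcoeff (g (\<phi> 1)) l \<le> pcoeff (g (\<phi> 0)) l"
        by (metis int_nat_eq neg_0_le_iff_le neg_le_iff_le of_nat_le_iff)
    qed (use gS S in auto)
    then have "g (\<phi> 0) = g (\<phi> 1)" using g(2) gS by (auto simp: G_def)
    then have "\<phi> 0 = \<phi> 1" using g(1) by (simp add: inj_eq)
    then show False using \<phi>(1) by (simp add: strict_mono_eq)
  qed
  then show ?thesis using dom by (intro exI[of _ G]) (auto simp: G_def)
qed

lemma Gam_pred:
  assumes p: "p \<in> Gam N j" and j: "j < N" and "p \<noteq> 0"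
  shows "\<exists>l. 1 \<le> l \<and> l \<le> j \<and> p - evec N l \<in> Gam N j"
proof -
  have "pcoeff p N \<noteq> 0" using Gam_deg_0 assms by blast
  then have "(\<Sum>l\<in>{1..j}. pcoeff p l) \<noteq> 0" using p by (simp add: Gam_def)
  then obtain l where l: "l \<in> {1..j}" "pcoeff p l \<noteq> 0" by (metis sum.neutral)
  have "pcoeff p l \<le> 0" using p l(1) by (auto simp: Gam_def)
  then have "p - evec N l \<in> Gam N j"
    using l p j by (intro Gam_diff evec_Gam) (auto simp: evec_coeff Gam_def)
  then show ?thesis using l by auto
qed

section \<open>Pseudo-valuations\<close>

text \<open>The axiom \<open>v_unit\<close> expresses that each quotient of
  \<open>{v \<ge> \<beta>}\<close> by \<open>{v > \<beta>}\<close> is zero or a simple left module: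
  any nonzero class generates it. Nonzero elements may have value \<open>Infty\<close>, so the
  support can be a nonzero ideal.\<close>

locale pval = ring R for R (structure) +
  fixes N j :: nat and v :: "'a \<Rightarrow> val"
  assumes level: "j < N"
    and v_Vals: "a \<in> carrier R \<Longrightarrow> v a \<in> Vals N j"
    and v_zero: "v \<zero> = Infty"
    and v_one: "v \<one> = 0"
    and v_add: "a \<in> carrier R \<Longrightarrow> b \<in> carrier R \<Longrightarrow> min (v a) (v b) \<le> v (a \<oplus> b)"
    and v_mult: "a \<in> carrier R \<Longrightarrow> b \<in> carrier R \<Longrightarrow> v (a \<otimes> b) = v a + v b"
    and v_unit: "a \<in> carrier R \<Longrightarrow> b \<in> carrier R \<Longrightarrow> v a = v b \<Longrightarrow> v b \<noteq> Infty \<Longrightarrow>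
      \<exists>u\<in>carrier R. v b < v (a \<ominus> u \<otimes> b)"
begin

lemma v_nonneg: "a \<in> carrier R \<Longrightarrow> 0 \<le> v a"
  using v_Vals Vals_nonneg level by blast

text \<open>Since the square of \<open>\<ominus> \<one>\<close> is \<open>\<one>\<close>, twice its
  value is zero, and integer polynomials have no torsion.\<close>

lemma v_uminus: assumes "a \<in> carrier R" shows "v (\<ominus> a) = v a"
proof -
  have "v (\<ominus> \<one>) + v (\<ominus> \<one>) = 0"
    using v_mult[of "\<ominus> \<one>" "\<ominus> \<one>"] v_one by (simp add: l_minus)
  then have "v (\<ominus> \<one>) = 0" by (cases "v (\<ominus> \<one>)") (auto simp: zero_val_def)
  then show ?thesis using v_mult[of "\<ominus> \<one>" a] assms by (simp add: l_minus)
qed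

lemma v_minus: "a \<in> carrier R \<Longrightarrow> b \<in> carrier R \<Longrightarrow> min (v a) (v b) \<le> v (a \<ominus> b)"
  using v_add[of a "\<ominus> b"] by (simp add: a_minus_def v_uminus)

lemma v_add_ge: "a \<in> carrier R \<Longrightarrow> b \<in> carrier R \<Longrightarrow> \<beta> \<le> v a \<Longrightarrow> \<beta> \<le> v b \<Longrightarrow> \<beta> \<le> v (a \<oplus> b)"
  using v_add[of a b] by (meson min.boundedI order_trans)

lemma v_add_gt: "a \<in> carrier R \<Longrightarrow> b \<in> carrier R \<Longrightarrow> \<beta> < v a \<Longrightarrow> \<beta> < v b \<Longrightarrow> \<beta> < v (a \<oplus> b)"
  using v_add[of a b] by (meson min_less_iff_conj order_less_le_trans)

lemma minus_add_cancel [simp]: "a \<in> carrier R \<Longrightarrow> b \<in> carrier R \<Longrightarrow> (a \<ominus> b) \<oplus> b = a"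
  by (simp add: a_minus_def a_assoc l_neg)

lemma v_add_eq:
  assumes "a \<in> carrier R" "b \<in> carrier R" "v a < v b" shows "v (a \<oplus> b) = v a"
proof (rule antisym)
  show "v a \<le> v (a \<oplus> b)" using v_add_ge[OF assms(1,2), of "v a"] assms(3) by simp
  have "a = (a \<oplus> b) \<ominus> b" using assms(1,2) by (simp add: a_minus_def a_assoc r_neg)
  then have "min (v (a \<oplus> b)) (v b) \<le> v a" using v_minus[of "a \<oplus> b" b] assms(1,2) by simp
  then show "v (a \<oplus> b) \<le> v a" using assms(3) by (auto simp: min_def split: if_splits)
qed

lemma v_finsum_ge:
  assumes "finite I" "\<And>i. i \<in> I \<Longrightarrow> f i \<in> carrier R" "\<And>i. i \<in> I \<Longrightarrow> \<beta> \<le> v (f i)"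
  shows "\<beta> \<le> v (finsum R f I)"
  using assms
proof (induction I)
  case empty
  then show ?case by (simp add: v_zero)
next
  case (insert i I)
  have "finsum R f (insert i I) = f i \<oplus> finsum R f I"
    using insert by (intro finsum_insert) auto
  moreover have "finsum R f I \<in> carrier R" using insert by (intro finsum_closed) auto
  ultimately show ?case using insert by (simp add: v_add_ge)
qed

lemma v_finsum_gt:
  assumes "finite I" "\<And>i. i \<in> I \<Longrightarrow> f i \<in> carrier R" "\<And>i. i \<in> I \<Longrightarrow> \<beta> < v (f i)" "\<beta> \<noteq> Infty"
  shows "\<beta> < v (finsum R f I)"
  using assms
proof (induction I)
  case empty
  then show ?case by (simp add: v_zero less_Infty_iff)
next
  case (insert i I)
  have "finsum R f (insert i I) = f i \<oplus> finsum R f I"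
    using insert by (intro finsum_insert) auto
  moreover have "finsum R f I \<in> carrier R" using insert by (intro finsum_closed) auto
  ultimately show ?case using insert by (simp add: v_add_gt)
qed

lemma v_finsum_unique:
  assumes "finite I" "i0 \<in> I" "\<And>i. i \<in> I \<Longrightarrow> f i \<in> carrier R"
    "v (f i0) = \<beta>" "\<And>i. i \<in> I \<Longrightarrow> i \<noteq> i0 \<Longrightarrow> \<beta> < v (f i)" "\<beta> \<noteq> Infty"
  shows "v (finsum R f I) = \<beta>"
proof -
  have "finsum R f (insert i0 (I - {i0})) = f i0 \<oplus> finsum R f (I - {i0})"
    using assms by (intro finsum_insert) auto
  then have "finsum R f I = f i0 \<oplus> finsum R f (I - {i0})"
    using assms(2) by (simp add: insert_absorb)
  moreover have "\<beta> < v (finsum R f (I - {i0}))" using assms by (intro v_finsum_gt) auto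
  moreover have "finsum R f (I - {i0}) \<in> carrier R" using assms by (intro finsum_closed) auto
  ultimately show ?thesis using v_add_eq[of "f i0" "finsum R f (I - {i0})"] assms by simp
qed

definition dg :: "'a \<Rightarrow> enat" where "dg a = vdeg N (v a)"

lemma dg_mult: "a \<in> carrier R \<Longrightarrow> b \<in> carrier R \<Longrightarrow> dg (a \<otimes> b) = dg a + dg b"
  unfolding dg_def by (simp add: v_mult vdeg_add[OF v_Vals v_Vals])

lemma dg_add_ge:
  assumes "a \<in> carrier R" "b \<in> carrier R" "m \<le> dg a" "m \<le> dg b"
  shows "m \<le> dg (a \<oplus> b)"
proof -
  have "min (v a) (v b) \<le> v (a \<oplus> b)" using assms v_add by blast
  then have "v a \<le> v (a \<oplus> b) \<or> v b \<le> v (a \<oplus> b)" by (auto simp: min_def split: if_splits)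
  then have "dg a \<le> dg (a \<oplus> b) \<or> dg b \<le> dg (a \<oplus> b)"
    unfolding dg_def using vdeg_mono[OF v_Vals v_Vals level] assms(1,2) by blast
  then show ?thesis using assms(3,4) order_trans by blast
qed

lemma dg_uminus: "a \<in> carrier R \<Longrightarrow> dg (\<ominus> a) = dg a"
  by (simp add: dg_def v_uminus)

lemma dg_minus_ge:
  "a \<in> carrier R \<Longrightarrow> b \<in> carrier R \<Longrightarrow> m \<le> dg a \<Longrightarrow> m \<le> dg b \<Longrightarrow> m \<le> dg (a \<ominus> b)"
  using dg_add_ge[of a "\<ominus> b" m] by (simp add: a_minus_def dg_uminus)

lemma dg_zero [simp]: "dg \<zero> = \<infinity>"
  by (simp add: dg_def v_zero)

lemma dg_infinite: "dg a = \<infinity> \<longleftrightarrow> v a = Infty"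
  by (cases "v a") (auto simp: dg_def)

lemma dg_all_imp_Infty: "(\<And>m. enat m \<le> dg a) \<Longrightarrow> v a = Infty"
  using dg_infinite by (metis Suc_ile_eq enat.exhaust enat_ord_simps(2) less_irrefl_nat order_refl)

lemma v_pos_iff: assumes "a \<in> carrier R" shows "0 < v a \<longleftrightarrow> 1 \<le> dg a"
proof
  assume "0 < v a"
  then have "dg a \<noteq> 0" using vdeg_eq_0[OF v_Vals[OF assms] level] by (auto simp: dg_def)
  then show "1 \<le> dg a" by (simp add: one_eSuc ileI1 zero_less_iff_neq_zero)
next
  assume "1 \<le> dg a"
  then have "v a \<noteq> 0" by (auto simp: dg_def)
  then show "0 < v a" using v_nonneg[OF assms] by simp
qed

lemma ideal_up:
  assumes "\<And>x y. x \<in> U \<Longrightarrow> x \<le> y \<Longrightarrow> y \<in> U" "Infty \<in> U"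
  shows "ideal {a \<in> carrier R. v a \<in> U} R"
proof (rule idealI)
  show "ring R" by (rule ring_axioms)
  show "subgroup {a \<in> carrier R. v a \<in> U} (add_monoid R)"
  proof
    show "\<one>\<^bsub>add_monoid R\<^esub> \<in> {a \<in> carrier R. v a \<in> U}" using assms(2) by (simp add: v_zero)
  next
    fix x y assume "x \<in> {a \<in> carrier R. v a \<in> U}" "y \<in> {a \<in> carrier R. v a \<in> U}"
    then show "x \<otimes>\<^bsub>add_monoid R\<^esub> y \<in> {a \<in> carrier R. v a \<in> U}"
      using v_add[of x y] assms(1)[of "min (v x) (v y)" "v (x \<oplus> y)"] by (auto simp: min_def)
  next
    fix x assume x: "x \<in> {a \<in> carrier R. v a \<in> U}"
    then show "inv\<^bsub>add_monoid R\<^esub> x \<in> {a \<in> carrier R. v a \<in> U}"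
      using v_uminus[of x] a_inv_closed[of x] by (simp add: a_inv_def)
  qed auto
next
  fix a x assume a: "a \<in> {a \<in> carrier R. v a \<in> U}" and x: "x \<in> carrier R"
  have "0 \<le> v x" using v_nonneg x by blast
  then have "v a \<le> v x + v a" "v a \<le> v a + v x"
    using val_add_mono[of 0 "v x" "v a" "v a"] by (simp_all add: add.commute)
  then show "x \<otimes> a \<in> {a \<in> carrier R. v a \<in> U}" "a \<otimes> x \<in> {a \<in> carrier R. v a \<in> U}"
    using a x assms(1)[of "v a"] by (simp_all add: v_mult)
qed

lemma ideal_pos: "ideal {a \<in> carrier R. 0 < v a} R"
  using ideal_up[of "{x. 0 < x}"] by (auto simp: less_Infty_iff zero_val_def)

lemma ideal_Infty: "ideal {a \<in> carrier R. v a = Infty} R"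
  using ideal_up[of "{Infty}"] by auto

lemma ideal_dg: "ideal {a \<in> carrier R. m \<le> dg a} R"
proof (rule idealI)
  show "ring R" by (rule ring_axioms)
  show "subgroup {a \<in> carrier R. m \<le> dg a} (add_monoid R)"
  proof
    fix x assume x: "x \<in> {a \<in> carrier R. m \<le> dg a}"
    then show "inv\<^bsub>add_monoid R\<^esub> x \<in> {a \<in> carrier R. m \<le> dg a}"
      using dg_uminus[of x] a_inv_closed[of x] by (simp add: a_inv_def)
  qed (auto simp: dg_add_ge)
next
  fix a x assume "a \<in> {a \<in> carrier R. m \<le> dg a}" "x \<in> carrier R"
  then show "x \<otimes> a \<in> {a \<in> carrier R. m \<le> dg a}" "a \<otimes> x \<in> {a \<in> carrier R. m \<le> dg a}"
    by (auto simp: dg_mult add_increasing add_increasing2)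
qed

text \<open>An element outside has value zero, the value of \<open>\<one>\<close>, so by
  \<open>v_unit\<close> it is left invertible modulo the elements of positive value.\<close>

lemma maximalideal_pos: "maximalideal {a \<in> carrier R. 0 < v a} R"
proof (rule maximalidealI)
  show "ideal {a \<in> carrier R. 0 < v a} R" by (rule ideal_pos)
  show "carrier R \<noteq> {a \<in> carrier R. 0 < v a}" using v_one one_closed by force
  fix J assume J: "ideal J R" "{a \<in> carrier R. 0 < v a} \<subseteq> J" "J \<subseteq> carrier R"
  interpret J: ideal J R by fact
  show "J = {a \<in> carrier R. 0 < v a} \<or> J = carrier R"
  proof (rule ccontr)
    assume neg: "\<not> ?thesis"
    then obtain b where b: "b \<in> J" "\<not> 0 < v b" using J by blast
    have bc: "b \<in> carrier R" using b J by blast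
    then have "v b = 0" using b v_nonneg[of b] by simp
    then obtain u where u: "u \<in> carrier R" "v b < v (\<one> \<ominus> u \<otimes> b)"
      using v_unit[of \<one> b] bc by (auto simp: v_one zero_val_def)
    then have "\<one> \<ominus> u \<otimes> b \<in> J" using J(2) \<open>v b = 0\<close> bc by auto
    moreover have "u \<otimes> b \<in> J" using u b J.I_l_closed by blast
    ultimately have "\<one> \<in> J" using J.a_closed minus_add_cancel[of \<one> "u \<otimes> b"] u bc by fastforce
    then show False using neg J.one_imp_carrier by blast
  qed
qed

lemma prime_ideal_completely:
  assumes "ideal P R" "\<one> \<notin> P"
    "\<And>a b. a \<in> carrier R \<Longrightarrow> b \<in> carrier R \<Longrightarrow> a \<otimes> b \<in> P \<Longrightarrow> a \<in> P \<or> b \<in> P"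
  shows "prime_ideal P R"
  unfolding prime_ideal_def
proof (intro conjI allI impI)
  show "P \<noteq> carrier R" using assms(2) one_closed by blast
  fix I J assume I: "ideal I R" and J: "ideal J R" and IJ: "I \<cdot> J \<subseteq> P"
  show "I \<subseteq> P \<or> J \<subseteq> P"
  proof (rule ccontr)
    assume "\<not> ?thesis"
    then obtain a b where ab: "a \<in> I" "a \<notin> P" "b \<in> J" "b \<notin> P" by blast
    then have "a \<otimes> b \<in> P" using IJ ideal_prod.prod[of a I b J R] by blast
    then show False using assms(3) ab I J ideal.Icarr by metis
  qed
qed (rule assms(1))

lemma prime_ideal_Infty: "prime_ideal {a \<in> carrier R. v a = Infty} R"
  by (rule prime_ideal_completely) (auto simp: ideal_Infty v_one v_mult zero_val_def)

lemma prime_ideal_pos: "prime_ideal {a \<in> carrier R. 0 < v a} R"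
proof (rule prime_ideal_completely)
  fix a b assume ab: "a \<in> carrier R" "b \<in> carrier R" "a \<otimes> b \<in> {a \<in> carrier R. 0 < v a}"
  then have "0 < v a + v b" by (simp add: v_mult)
  then have "0 < v a \<or> 0 < v b" using v_nonneg[of a] v_nonneg[of b] ab by force
  then show "a \<in> {a \<in> carrier R. 0 < v a} \<or> b \<in> {a \<in> carrier R. 0 < v a}" using ab by blast
qed (auto simp: ideal_pos v_one)

text \<open>Degrees add up in products. The reverse inclusion fails when the support is too large;
  it is established later for the valuations \<open>vv 0 j\<close> only.\<close>

lemma ideal_pow_dg:
  assumes "I \<subseteq> {a \<in> carrier R. 1 \<le> dg a}"
  shows "ideal_pow R I m \<subseteq> {a \<in> carrier R. enat m \<le> dg a}"
proof (induction m)
  case 0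
  then show ?case by (auto simp: zero_enat_def[symmetric])
next
  case (Suc m)
  have "a \<in> carrier R \<and> enat (Suc m) \<le> dg a" if "a \<in> I \<cdot> ideal_pow R I m" for a
    using that
  proof (induction a rule: ideal_prod.induct)
    case (prod x y)
    then have "x \<in> carrier R" "1 \<le> dg x" "y \<in> carrier R" "enat m \<le> dg y" using assms Suc by auto
    moreover have "enat (Suc m) = 1 + enat m" by (simp add: one_enat_def)
    ultimately show ?case using add_mono by (simp add: dg_mult)
  qed (auto intro: dg_add_ge)
  then show ?case by auto
qed

text \<open>Each quotient \<open>{v \<ge> \<beta>} / {v > \<beta>}\<close> is a simple left module, so a surjective endomorphism
  cannot increase any value once it preserves all smaller ones.\<close>

lemma v_surj_endo:
  assumes s: "s ` carrier R = carrier R"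
    and s_add: "\<And>a b. a \<in> carrier R \<Longrightarrow> b \<in> carrier R \<Longrightarrow> s (a \<oplus> b) = s a \<oplus> s b"
    and s_mult: "\<And>a b. a \<in> carrier R \<Longrightarrow> b \<in> carrier R \<Longrightarrow> s (a \<otimes> b) = s a \<otimes> s b"
    and le: "\<And>a. a \<in> carrier R \<Longrightarrow> v a \<le> v (s a)"
    and a: "a \<in> carrier R"
  shows "v (s a) = v a"
proof (rule ccontr)
  assume "v (s a) \<noteq> v a"
  \<comment> \<open>The least value that \<open>s\<close> strictly increases is examined; below it,
    \<open>s\<close> preserves values.\<close>
  define B where "B = {v b | b. b \<in> carrier R \<and> v b < v (s b)}"
  have "v a \<in> B" using a \<open>v (s a) \<noteq> v a\<close> le[OF a] by (auto simp: B_def)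
  moreover have "B \<subseteq> Vals N j" using v_Vals by (auto simp: B_def)
  ultimately obtain \<beta> where "\<beta> \<in> B" and min: "\<forall>p\<in>B. \<beta> \<le> p"
    using Vals_has_least[of B N j] level by blast
  then obtain g where g: "g \<in> carrier R" "v g < v (s g)" "\<beta> = v g" by (auto simp: B_def)
  have sc: "s b \<in> carrier R" if "b \<in> carrier R" for b using s that by blast
  obtain h where h: "h \<in> carrier R" "s h = g" using s g(1) by (metis imageE)
  have "v h \<le> v g" using le[OF h(1)] h(2) by simp
  moreover have "\<not> v h < v g"
  proof
    assume hg: "v h < v g"
    then have "v h \<in> B" using h by (auto simp: B_def)
    then show False using min g(3) hg by force
  qed
  ultimately have vh: "v h = v g" by simp
  have "v g \<noteq> Infty" using g(2) by auto
  then obtain u where u: "u \<in> carrier R" "v g < v (h \<ominus> u \<otimes> g)"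
    using v_unit[OF h(1) g(1) vh] by blast
  define r where "r = h \<ominus> u \<otimes> g"
  have rc: "r \<in> carrier R" using h u g by (simp add: r_def)
  \<comment> \<open>Here \<open>g = s h\<close>, and applying \<open>s\<close> to this decomposition
    expresses \<open>g\<close> by two elements of value above \<open>v g\<close>.\<close>
  have "h = r \<oplus> u \<otimes> g" using h u g by (simp add: r_def)
  then have "s h = s r \<oplus> s u \<otimes> s g" using s_add s_mult rc u g by simp
  then have gs: "v g = v (s r \<oplus> s u \<otimes> s g)" using h(2) by simp
  have "v g < v (s r)" using le[OF rc] u(2) by (simp add: r_def)
  moreover have "v g < v (s u \<otimes> s g)"
    using g(2) v_mult[of "s u" "s g"] sc u(1) g(1) v_nonneg[of "s u"]
      val_add_less_le_mono[of "v g" "v (s g)" 0 "v (s u)"] by (simp add: add.commute)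
  ultimately have "v g < v (s r \<oplus> s u \<otimes> s g)"
    using v_add_gt[of "s r" "s u \<otimes> s g" "v g"] sc rc u(1) g(1) by blast
  then show False using gs by simp
qed

end

text \<open>The Gauss extension, \<open>c\<close> being the coefficient function of the larger ring.
  The minimum over the infinitely many terms exists because the values are well-ordered.\<close>

definition extv :: "nat \<Rightarrow> nat \<Rightarrow> ('a \<Rightarrow> val) \<Rightarrow> ('a \<Rightarrow> nat \<Rightarrow> 'a) \<Rightarrow> 'a \<Rightarrow> val" where
  "extv N l v c a = (LEAST y. \<exists>s. y = v (c a s) + Val (of_nat s * evec N l))"

lemma extv_attained:
  assumes "\<And>s. v (c a s) \<in> Vals N j" "Suc j < N"
  shows "\<exists>s. extv N (Suc j) v c a = v (c a s) + Val (of_nat s * evec N (Suc j))"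
    and "extv N (Suc j) v c a \<le> v (c a s) + Val (of_nat s * evec N (Suc j))"
    and "extv N (Suc j) v c a \<in> Vals N (Suc j)"
proof -
  define Y where "Y = {y. \<exists>s. y = v (c a s) + Val (of_nat s * evec N (Suc j))}"
  have Y: "Y \<subseteq> Vals N (Suc j)"
  proof
    fix y assume "y \<in> Y"
    then obtain s where "y = v (c a s) + Val (of_nat s * evec N (Suc j))" by (auto simp: Y_def)
    moreover have "v (c a s) \<in> Vals N (Suc j)" using Vals_mono[of j "Suc j" N] assms by simp
    ultimately show "y \<in> Vals N (Suc j)"
      using assms by (auto intro!: Vals_add evec_mult_Gam)
  qed
  then obtain m where m: "m \<in> Y" "\<forall>p\<in>Y. m \<le> p"
    using Vals_has_least[of Y N "Suc j"] assms by (auto simp: Y_def)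
  have "(LEAST y. y \<in> Y) = m" by (rule Least_equality) (use m in auto)
  then have eq: "extv N (Suc j) v c a = m" by (simp add: extv_def Y_def)
  show "\<exists>s. extv N (Suc j) v c a = v (c a s) + Val (of_nat s * evec N (Suc j))"
    using m eq by (auto simp: Y_def)
  show "extv N (Suc j) v c a \<le> v (c a s) + Val (of_nat s * evec N (Suc j))"
    using m eq by (auto simp: Y_def)
  show "extv N (Suc j) v c a \<in> Vals N (Suc j)" using m eq Y by auto
qed

text \<open>The truncation whose limit for growing \<open>M\<close> is the \<open>k\<close>-th
  coefficient of a product of skew power series.\<close>

definition partial_prod ::
  "('a, 'b) ring_scheme \<Rightarrow> ('a \<Rightarrow> 'a) \<Rightarrow> ('a \<Rightarrow> 'a) \<Rightarrow> (nat \<Rightarrow> 'a) \<Rightarrow> (nat \<Rightarrow> 'a) \<Rightarrow> nat \<Rightarrow> nat \<Rightarrow> 'a" where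
  "partial_prod A \<sigma> \<delta> f g k M =
     finsum A (\<lambda>i. finsum A (\<lambda>q. f i \<otimes>\<^bsub>A\<^esub> sd_word A \<sigma> \<delta> i (k - q) (g q)) {..k}) {..<M}"

text \<open>\<open>\<sigma>\<close> has to preserve values exactly, whereas \<open>\<delta>\<close>
  only has to raise the degree: the leading exponent of \<open>\<delta> a\<close> is otherwise
  uncontrolled.\<close>

locale pval_skew = pval A N j v for A :: "('a, 'b) ring_scheme" (structure) and N j v +
  fixes \<sigma> \<delta> :: "'a \<Rightarrow> 'a"
  assumes \<sigma>_closed: "a \<in> carrier A \<Longrightarrow> \<sigma> a \<in> carrier A"
    and \<delta>_closed: "a \<in> carrier A \<Longrightarrow> \<delta> a \<in> carrier A"
    and \<sigma>_add: "a \<in> carrier A \<Longrightarrow> b \<in> carrier A \<Longrightarrow> \<sigma> (a \<oplus> b) = \<sigma> a \<oplus> \<sigma> b"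
    and \<delta>_add: "a \<in> carrier A \<Longrightarrow> b \<in> carrier A \<Longrightarrow> \<delta> (a \<oplus> b) = \<delta> a \<oplus> \<delta> b"
    and v_\<sigma>: "a \<in> carrier A \<Longrightarrow> v (\<sigma> a) = v a"
    and dg_\<delta>: "a \<in> carrier A \<Longrightarrow> vdeg N (v a) + 1 \<le> vdeg N (v (\<delta> a))"
begin

lemma \<sigma>_zero: "\<sigma> \<zero> = \<zero>"
  using \<sigma>_add[of \<zero> \<zero>] \<sigma>_closed[of \<zero>] by (metis add.l_cancel_one zero_closed r_zero)

lemma \<delta>_zero: "\<delta> \<zero> = \<zero>"
  using \<delta>_add[of \<zero> \<zero>] \<delta>_closed[of \<zero>] by (metis add.l_cancel_one zero_closed r_zero)

lemma sd_word_closed: "b \<in> carrier A \<Longrightarrow> sd_word A \<sigma> \<delta> i l b \<in> carrier A"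
  by (induction i arbitrary: l) (auto simp: \<sigma>_closed \<delta>_closed)

lemma sd_word_gt: "b \<in> carrier A \<Longrightarrow> i < l \<Longrightarrow> sd_word A \<sigma> \<delta> i l b = \<zero>"
  by (induction i arbitrary: l) (auto simp: \<sigma>_zero \<delta>_zero)

lemma sd_word_diag: "b \<in> carrier A \<Longrightarrow> v (sd_word A \<sigma> \<delta> i i b) = v b"
  by (induction i) (auto simp: sd_word_gt \<delta>_zero v_\<sigma> \<sigma>_closed sd_word_closed)

text \<open>Each word has \<open>i - l\<close> letters \<open>\<delta>\<close>, every one of which
  costs a degree, while \<open>\<sigma>\<close> costs nothing. For \<open>l > i\<close> the
  truncated difference is zero and the coefficient vanishes.\<close>

lemma sd_word_dg: "b \<in> carrier A \<Longrightarrow> dg b + enat (i - l) \<le> dg (sd_word A \<sigma> \<delta> i l b)"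
proof (induction i arbitrary: l)
  case 0
  then show ?case by (auto simp: zero_enat_def[symmetric])
next
  case (Suc i)
  have d: "dg (sd_word A \<sigma> \<delta> i m b) + 1 \<le> dg (\<delta> (sd_word A \<sigma> \<delta> i m b))" for m
    using dg_\<delta>[OF sd_word_closed] Suc.prems by (simp add: dg_def)
  have d': "dg b + enat (i - m) + 1 \<le> dg (\<delta> (sd_word A \<sigma> \<delta> i m b))" for m
    using order_trans[OF add_right_mono[OF Suc.IH[OF Suc.prems]] d] .
  show ?case
  proof (cases l)
    case 0
    then show ?thesis using d'[of 0] by (simp add: one_enat_def add.assoc)
  next
    case (Suc l')
    have "dg b + enat (i - l') \<le> dg (\<sigma> (sd_word A \<sigma> \<delta> i l' b))"
      using Suc.IH[of l'] Suc.prems by (simp add: dg_def v_\<sigma> sd_word_closed)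
    moreover have "dg b + enat (i - l') \<le> dg (\<delta> (sd_word A \<sigma> \<delta> i (Suc l') b))"
    proof (cases "Suc l' \<le> i")
      case True
      then have "enat (i - Suc l') + 1 = enat (i - l')" by (simp add: one_enat_def)
      then show ?thesis using d'[of "Suc l'"] by (simp add: add.assoc)
    next
      case False
      then show ?thesis using Suc.prems by (simp add: sd_word_gt \<delta>_zero)
    qed
    ultimately show ?thesis
      using Suc Suc.prems by (simp add: dg_add_ge \<sigma>_closed \<delta>_closed sd_word_closed)
  qed
qed

end

text \<open>Elements of \<open>Gam N j\<close> vanish at index \<open>Suc j\<close>, so there the
  coefficient of the sum is minus the exponent of the new variable. At equal degree the order
  therefore reverses the comparison of these exponents.\<close>

lemma tail_compare:
  assumes p: "p \<in> Gam N j" "p' \<in> Gam N j" and j: "Suc j < N"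
    and le: "p' + of_nat s' * evec N (Suc j) \<le> p + of_nat s * evec N (Suc j)"
  shows "pcoeff p' N + int s' \<le> pcoeff p N + int s"
    and "pcoeff p' N + int s' = pcoeff p N + int s \<Longrightarrow> s \<le> s'"
    and "p' + of_nat s' * evec N (Suc j) = p + of_nat s * evec N (Suc j) \<Longrightarrow> s = s'"
proof -
  have G: "r + of_nat t * evec N (Suc j) \<in> Gam N (Suc j)" if "r \<in> Gam N j" for r t
    using Gam_mono[of j "Suc j" N] that j by (intro Gam_add evec_mult_Gam) auto
  have cN: "pcoeff (r + of_nat t * evec N (Suc j)) N = pcoeff r N + int t" for r t
    using j by (simp add: of_nat_mult_evec_coeff)
  have cj: "pcoeff (r + of_nat t * evec N (Suc j)) (Suc j) = - int t" if "r \<in> Gam N j" for r t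
    using j that by (auto simp: of_nat_mult_evec_coeff Gam_def)
  show "pcoeff p' N + int s' \<le> pcoeff p N + int s"
    using Gam_deg_mono[OF G[OF p(2)] G[OF p(1)] j le] by (simp only: cN)
  show "s \<le> s'" if "pcoeff p' N + int s' = pcoeff p N + int s"
  proof (rule ccontr)
    assume "\<not> s \<le> s'"
    then have "pcoeff (p + of_nat s * evec N (Suc j)) (Suc j) < pcoeff (p' + of_nat s' * evec N (Suc j)) (Suc j)"
      unfolding cj[OF p(1)] cj[OF p(2)] by simp
    moreover have "pcoeff (p + of_nat s * evec N (Suc j)) N = pcoeff (p' + of_nat s' * evec N (Suc j)) N"
      unfolding cN that by simp
    ultimately have "p + of_nat s * evec N (Suc j) < p' + of_nat s' * evec N (Suc j)"
      using Gam_less_top[OF G[OF p(1)] G[OF p(2)] j] by blast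
    then show False using le by simp
  qed
  show "s = s'" if "p' + of_nat s' * evec N (Suc j) = p + of_nat s * evec N (Suc j)"
    using arg_cong[OF that, of "\<lambda>q. pcoeff q (Suc j)"] p by (simp only: cj)
qed

section \<open>Extension to skew power series\<close>

text \<open>\<open>S\<close> enters only through a coefficient function. \<open>c_mult\<close>
  states convergence in the degree of \<open>v\<close>, which may be infinite on nonzero elements,
  and provides arbitrarily late truncations, so that the index of a leading term can be
  included.\<close>

locale skew_ext = pval_skew A N j v \<sigma> \<delta> + S: ring S
  for A :: "('a, 'b) ring_scheme" (structure) and N j v \<sigma> \<delta> and S :: "('a, 'c) ring_scheme" +
  fixes c :: "'a \<Rightarrow> nat \<Rightarrow> 'a"
  assumes SjN: "Suc j < N"
    and c_closed: "a \<in> carrier S \<Longrightarrow> c a s \<in> carrier A"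
    and c_zero: "c \<zero>\<^bsub>S\<^esub> s = \<zero>"
    and c_one: "c \<one>\<^bsub>S\<^esub> s = (if s = 0 then \<one> else \<zero>)"
    and c_add: "a \<in> carrier S \<Longrightarrow> b \<in> carrier S \<Longrightarrow> c (a \<oplus>\<^bsub>S\<^esub> b) s = c a s \<oplus> c b s"
    and const_closed: "carrier A \<subseteq> carrier S"
    and c_const_mult: "u \<in> carrier A \<Longrightarrow> b \<in> carrier S \<Longrightarrow> c (u \<otimes>\<^bsub>S\<^esub> b) s = u \<otimes> c b s"
    and c_mult: "a \<in> carrier S \<Longrightarrow> b \<in> carrier S \<Longrightarrow>
      \<exists>M\<ge>M0. enat K \<le> vdeg N (v (c (a \<otimes>\<^bsub>S\<^esub> b) k \<ominus> partial_prod A \<sigma> \<delta> (c a) (c b) k M))"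
begin

abbreviation tv :: "val \<Rightarrow> nat \<Rightarrow> val" where
  "tv x s \<equiv> x + Val (of_nat s * evec N (Suc j))"

abbreviation pp :: "'a \<Rightarrow> 'a \<Rightarrow> nat \<Rightarrow> nat \<Rightarrow> 'a" where
  "pp a b \<equiv> partial_prod A \<sigma> \<delta> (c a) (c b)"

abbreviation w :: "'a \<Rightarrow> val" where
  "w \<equiv> extv N (Suc j) v c"

lemma tv_add: "tv (x + y) (s + t) = tv x s + tv y t"
  by (cases x; cases y) (auto simp: distrib_right)

lemma w_attained: "a \<in> carrier S \<Longrightarrow> \<exists>s. w a = tv (v (c a s)) s"
  using extv_attained(1)[of v c a N j] v_Vals c_closed SjN by blast

lemma w_le: "a \<in> carrier S \<Longrightarrow> w a \<le> tv (v (c a s)) s"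
  using extv_attained(2)[of v c a N j] v_Vals c_closed SjN by blast

lemma w_Vals: "a \<in> carrier S \<Longrightarrow> w a \<in> Vals N (Suc j)"
  using extv_attained(3)[of v c a N j] v_Vals c_closed SjN by blast

lemma w_geI: "a \<in> carrier S \<Longrightarrow> (\<And>s. \<beta> \<le> tv (v (c a s)) s) \<Longrightarrow> \<beta> \<le> w a"
  using w_attained by metis

lemma w_gtI: "a \<in> carrier S \<Longrightarrow> (\<And>s. \<beta> < tv (v (c a s)) s) \<Longrightarrow> \<beta> < w a"
  using w_attained by metis

lemma c_minus:
  assumes "a \<in> carrier S" "b \<in> carrier S" shows "c (a \<ominus>\<^bsub>S\<^esub> b) s = c a s \<ominus> c b s"
proof -
  have "c ((a \<ominus>\<^bsub>S\<^esub> b) \<oplus>\<^bsub>S\<^esub> b) s = c a s"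
    using assms by (simp add: S.minus_eq S.a_assoc S.l_neg)
  then have "c (a \<ominus>\<^bsub>S\<^esub> b) s \<oplus> c b s = c a s" using c_add[of "a \<ominus>\<^bsub>S\<^esub> b" b s] assms by simp
  moreover have "c a s \<in> carrier A" "c b s \<in> carrier A" "c (a \<ominus>\<^bsub>S\<^esub> b) s \<in> carrier A"
    using assms c_closed by auto
  ultimately show ?thesis by (metis a_minus_def add.m_assoc r_neg r_zero a_inv_closed)
qed

lemma tv_inj:
  assumes "x \<in> Vals N j" "y \<in> Vals N j" "tv x s = tv y t" "tv x s \<noteq> Infty"
  shows "s = t"
proof -
  obtain p q where "x = Val p" "y = Val q" using assms by (cases x; cases y) auto
  then show ?thesis using tail_compare(3)[of q N j p s t] assms SjN by auto
qed

text \<open>Terms with different powers of the new variable have different values, so the minimum is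
  attained exactly once. This uniqueness is what makes \<open>w\<close> multiplicative.\<close>

lemma tv_strict:
  assumes "a \<in> carrier S" "w a = tv (v (c a s0)) s0" "w a \<noteq> Infty" "s \<noteq> s0"
  shows "w a < tv (v (c a s)) s"
  using tv_inj[of "v (c a s0)" "v (c a s)" s0 s] w_le[OF assms(1), of s] assms v_Vals c_closed
  by (metis order_le_less)

definition T :: "'a \<Rightarrow> 'a \<Rightarrow> nat \<Rightarrow> nat \<Rightarrow> nat \<Rightarrow> 'a" where
  "T a b k i q = c a i \<otimes> sd_word A \<sigma> \<delta> i (k - q) (c b q)"

lemma T_closed: "a \<in> carrier S \<Longrightarrow> b \<in> carrier S \<Longrightarrow> T a b k i q \<in> carrier A"
  by (simp add: T_def c_closed sd_word_closed)

lemma v_T_diag: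
  "a \<in> carrier S \<Longrightarrow> b \<in> carrier S \<Longrightarrow> v (T a b (i + q) i q) = v (c a i) + v (c b q)"
  by (simp add: T_def v_mult sd_word_diag c_closed sd_word_closed)

lemma dg_T_ge: "a \<in> carrier S \<Longrightarrow> b \<in> carrier S \<Longrightarrow>
    dg (c a i) + dg (c b q) + enat (i - (k - q)) \<le> dg (T a b k i q)"
  using sd_word_dg[of "c b q" i "k - q"]
  by (simp add: T_def dg_mult c_closed sd_word_closed add.assoc add_left_mono)

text \<open>A term in which \<open>\<delta>\<close> acts exceeds the leading term in degree or, at equal degree, has a smaller
  exponent of the new variable and hence a larger value.\<close>

lemma T_strict:
  assumes a: "a \<in> carrier S" and b: "b \<in> carrier S" and q: "q \<le> k"
    and i0: "w a = tv (v (c a i0)) i0" and q0: "w b = tv (v (c b q0)) q0"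
    and fin: "w a \<noteq> Infty" "w b \<noteq> Infty"
    and ne: "(i, q) \<noteq> (i0, q0) \<or> k \<noteq> i0 + q0"
  shows "w a + w b < tv (v (T a b k i q)) k"
proof -
  \<comment> \<open>The number \<open>k - q\<close> of letters \<open>\<sigma>\<close> is compared
    with the word length \<open>i\<close>: no \<open>\<delta>\<close> acts, no such word exists, or
    at least one \<open>\<delta>\<close> acts.\<close>
  consider "k - q = i" | "k - q > i" | "k - q < i" by linarith
  then show ?thesis
  proof cases
    case 1
    then have k: "k = i + q" using q by simp
    have eq: "tv (v (T a b k i q)) k = tv (v (c a i)) i + tv (v (c b q)) q"
      unfolding k v_T_diag[OF a b] tv_add ..
    have "i \<noteq> i0 \<or> q \<noteq> q0" using ne k by auto
    then show ?thesis
    proof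
      assume "i \<noteq> i0"
      then show ?thesis unfolding eq
        using tv_strict[OF a i0 fin(1)] w_le[OF b] fin(2) by (intro val_add_less_le_mono) auto
    next
      assume "q \<noteq> q0"
      then show ?thesis unfolding eq
        using tv_strict[OF b q0 fin(2)] w_le[OF a] fin(1)
        by (subst (1 2) add.commute, intro val_add_less_le_mono) auto
    qed
  next
    case 2
    then have "T a b k i q = \<zero>" using a b by (simp add: T_def sd_word_gt c_closed)
    then show ?thesis using fin by (simp add: v_zero less_Infty_iff)
  next
    case 3
    show ?thesis
    proof (cases "v (T a b k i q)")
      case Infty
      then show ?thesis using fin by (simp add: less_Infty_iff)
    next
      case t: (Val t)
      have "dg (T a b k i q) \<noteq> \<infinity>" unfolding dg_infinite t by simp
      then have "dg (c a i) + dg (c b q) + enat (i - (k - q)) \<noteq> \<infinity>"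
        using dg_T_ge[OF a b, of i q k] by (metis enat_ord_simps(5))
      then have "v (c a i) \<noteq> Infty" "v (c b q) \<noteq> Infty"
        unfolding dg_infinite[symmetric] by (metis plus_enat_simps(2,3))+
      then obtain p r where p: "v (c a i) = Val p" and r: "v (c b q) = Val r"
        by (meson val.exhaust)
      obtain p0 r0 where p0: "v (c a i0) = Val p0" and r0: "v (c b q0) = Val r0"
        using fin i0 q0 by (cases "v (c a i0)"; cases "v (c b q0)") auto
      have G: "p \<in> Gam N j" "r \<in> Gam N j" "p0 \<in> Gam N j" "r0 \<in> Gam N j" "t \<in> Gam N j"
        using v_Vals[OF c_closed[OF a]] v_Vals[OF c_closed[OF b]] v_Vals[OF T_closed[OF a b]] p r p0 r0 t
        by (metis Val_Vals)+
      have nn: "0 \<le> pcoeff p N" "0 \<le> pcoeff r N" "0 \<le> pcoeff t N" using G Gam_N_nonneg by auto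
      have "nat (pcoeff p N) + nat (pcoeff r N) + (i - (k - q)) \<le> nat (pcoeff t N)"
        using dg_T_ge[OF a b, of i q k] t p r by (simp add: dg_def)
      then have dt: "pcoeff p N + int i + (pcoeff r N + int q) \<le> pcoeff t N + int k"
        using nn 3 q by linarith
      have la: "p0 + of_nat i0 * evec N (Suc j) \<le> p + of_nat i * evec N (Suc j)"
        using w_le[OF a, of i] i0 p p0 by simp
      have lb: "r0 + of_nat q0 * evec N (Suc j) \<le> r + of_nat q * evec N (Suc j)"
        using w_le[OF b, of q] q0 r r0 by simp
      note ca = tail_compare[OF G(1,3) SjN la]
      note cb = tail_compare[OF G(2,4) SjN lb]
      define W where "W = (p0 + r0) + of_nat (i0 + q0) * evec N (Suc j)"
      have W: "w a + w b = Val W" unfolding i0 q0 p0 r0 by (simp add: W_def algebra_simps)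
      have emb: "x + of_nat m * evec N (Suc j) \<in> Gam N (Suc j)" if "x \<in> Gam N j" for x m
        using Gam_mono[of j "Suc j" N] that SjN by (intro Gam_add evec_mult_Gam) auto
      have cN: "pcoeff (x + of_nat m * evec N (Suc j)) N = pcoeff x N + int m" for x m
        using SjN by (simp add: of_nat_mult_evec_coeff)
      have cj: "pcoeff (x + of_nat m * evec N (Suc j)) (Suc j) = - int m" if "x \<in> Gam N j" for x m
        using SjN that by (auto simp: of_nat_mult_evec_coeff Gam_def)
      have WG: "W \<in> Gam N (Suc j)" unfolding W_def by (rule emb[OF Gam_add[OF G(3,4)]])
      have WN: "pcoeff W N = pcoeff p0 N + pcoeff r0 N + int (i0 + q0)"
        unfolding W_def cN by simp
      have Wj: "pcoeff W (Suc j) = - int (i0 + q0)"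
        unfolding W_def by (rule cj[OF Gam_add[OF G(3,4)]])
      define V where "V = t + of_nat k * evec N (Suc j)"
      have VG: "V \<in> Gam N (Suc j)" unfolding V_def by (rule emb[OF G(5)])
      have VN: "pcoeff V N = pcoeff t N + int k" unfolding V_def by (rule cN)
      have Vj: "pcoeff V (Suc j) = - int k" unfolding V_def by (rule cj[OF G(5)])
      have "W < V"
      proof (cases "pcoeff W N < pcoeff V N")
        case True
        then show ?thesis using Gam_lessI[OF WG VG SjN] by simp
      next
        case False
        \<comment> \<open>At equal total degree both factors already have the minimal degree, so
          \<open>i \<le> i0\<close> and \<open>q \<le> q0\<close>. Each \<open>\<delta>\<close> has
          consumed one power of the variable, which leaves \<open>k < i + q \<le> i0 + q0\<close>
          and hence a larger value.\<close>
        then have "pcoeff p0 N + int i0 = pcoeff p N + int i" "pcoeff r0 N + int q0 = pcoeff r N + int q"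
          and eqN: "pcoeff W N = pcoeff V N"
          using dt ca(1) cb(1) WN VN by linarith+
        then have "i \<le> i0" "q \<le> q0" using ca(2) cb(2) by auto
        then have "k < i0 + q0" using 3 by linarith
        then show ?thesis using Gam_less_top[OF WG VG SjN eqN] Wj Vj by simp
      qed
      then show ?thesis using W t by (simp add: V_def)
    qed
  qed
qed

lemma partial_prod_T: "pp a b k M =
    finsum A (\<lambda>i. finsum A (T a b k i) {..k}) {..<M}"
  by (simp only: partial_prod_def T_def[symmetric])

text \<open>The shifted polynomial need not be the exponent of a monomial. It serves as a threshold
  for coefficients, so that estimates on finite sums in \<open>A\<close> can be used before shifting
  back.\<close>

lemma tv_le_iff: "\<beta> \<noteq> Infty \<Longrightarrow> \<exists>\<gamma>. \<gamma> \<noteq> Infty \<and> \<beta> = tv \<gamma> k"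
proof (cases \<beta>)
  case (Val p)
  then show ?thesis by (intro exI[of _ "Val (p - of_nat k * evec N (Suc j))"]) simp
qed simp

text \<open>By \<open>T_strict\<close> only the pair \<open>(i0, q0)\<close> can attain the sum of
  the two values. It contributes to the coefficient \<open>i0 + q0\<close>, provided the truncation
  runs past \<open>i0\<close>.\<close>

lemma v_partial:
  assumes a: "a \<in> carrier S" and b: "b \<in> carrier S"
    and i0: "w a = tv (v (c a i0)) i0" and q0: "w b = tv (v (c b q0)) q0"
    and fin: "w a \<noteq> Infty" "w b \<noteq> Infty"
  shows "k \<noteq> i0 + q0 \<Longrightarrow> w a + w b < tv (v (pp a b k M)) k"
    and "k = i0 + q0 \<Longrightarrow> i0 < M \<Longrightarrow> w a + w b = tv (v (pp a b k M)) k"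
proof -
  have "w a + w b \<noteq> Infty" using fin by simp
  then obtain \<gamma> where \<gamma>: "\<gamma> \<noteq> Infty" "w a + w b = tv \<gamma> k" using tv_le_iff by blast
  have inner_closed: "finsum A (T a b k i) {..k} \<in> carrier A" for i
    using T_closed[OF a b] by (intro finsum_closed) auto
  have strict: "\<gamma> < v (T a b k i q)" if "q \<le> k" "(i, q) \<noteq> (i0, q0) \<or> k \<noteq> i0 + q0" for i q
    using T_strict[OF a b that(1) i0 q0 fin that(2)] \<gamma>(2) by simp
  show "w a + w b < tv (v (pp a b k M)) k" if "k \<noteq> i0 + q0"
  proof -
    have "\<gamma> < v (finsum A (T a b k i) {..k})" for i
      using strict that T_closed[OF a b] \<gamma>(1) by (intro v_finsum_gt) auto
    then have "\<gamma> < v (pp a b k M)"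
      unfolding partial_prod_T using inner_closed \<gamma>(1) by (rule_tac v_finsum_gt) auto
    then show ?thesis using \<gamma>(2) by simp
  qed
  show "w a + w b = tv (v (pp a b k M)) k" if k: "k = i0 + q0" and M: "i0 < M"
  proof -
    have "tv \<gamma> k = tv (v (c a i0) + v (c b q0)) (i0 + q0)" using \<gamma>(2) i0 q0 by (simp only: tv_add)
    then have g: "v (T a b k i0 q0) = \<gamma>" using k v_T_diag[OF a b, of i0 q0] by simp
    have inner: "v (finsum A (T a b k i0) {..k}) = \<gamma>"
    proof (rule v_finsum_unique[of _ q0])
      fix q assume "q \<in> {..k}" "q \<noteq> q0"
      then show "\<gamma> < v (T a b k i0 q)" using strict[of q i0] by simp
    qed (use T_closed[OF a b] \<gamma>(1) g k in simp_all)
    have outer: "\<gamma> < v (finsum A (T a b k i) {..k})" if "i \<noteq> i0" for i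
      using strict that T_closed[OF a b] \<gamma>(1) by (intro v_finsum_gt) auto
    have "v (pp a b k M) = \<gamma>"
      unfolding partial_prod_T by (rule v_finsum_unique[of _ i0]) (use inner_closed \<gamma>(1) M inner outer in simp_all)
    then show ?thesis using \<gamma>(2) by simp
  qed
qed

lemma partial_prod_closed:
  "a \<in> carrier S \<Longrightarrow> b \<in> carrier S \<Longrightarrow> pp a b k M \<in> carrier A"
  unfolding partial_prod_T by (intro finsum_closed) (auto intro!: finsum_closed T_closed)

text \<open>There is no leading term to follow. Instead every summand, hence every truncation, has
  infinite degree, and the coefficients of the product are approximated by truncations to any
  degree.\<close>

lemma w_mult_Infty:
  assumes a: "a \<in> carrier S" and b: "b \<in> carrier S" and inf: "w a = Infty \<or> w b = Infty"
  shows "w (a \<otimes>\<^bsub>S\<^esub> b) = Infty"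
proof -
  have "v (c a i) = Infty \<or> v (c b q) = Infty" for i q
    using inf w_le[OF a, of i] w_le[OF b, of q] by (auto simp: less_eq_val_def plus_val_def split: val.splits)
  then have "dg (c a i) = \<infinity> \<or> dg (c b q) = \<infinity>" for i q by (simp add: dg_infinite)
  then have "dg (T a b k i q) = \<infinity>" for k i q
    using dg_T_ge[OF a b, of i q k] by (metis enat_ord_simps(5) plus_enat_simps(2,3))
  then have T: "Infty \<le> v (T a b k i q)" for k i q by (simp add: dg_infinite)
  have "Infty \<le> v (finsum A (T a b k i) {..k})" for k i
    using T T_closed[OF a b] by (intro v_finsum_ge) auto
  then have "Infty \<le> v (pp a b k M)" for k M
    unfolding partial_prod_T using T_closed[OF a b] by (rule_tac v_finsum_ge) (auto intro!: finsum_closed)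
  then have P: "dg (pp a b k M) = \<infinity>" for k M
    using dg_infinite by simp
  have "v (c (a \<otimes>\<^bsub>S\<^esub> b) k) = Infty" for k
  proof (rule dg_all_imp_Infty)
    fix m
    obtain M where "enat m \<le> dg (c (a \<otimes>\<^bsub>S\<^esub> b) k \<ominus> pp a b k M)"
      using c_mult[OF a b, of 0 m k] by (auto simp: dg_def)
    then have "enat m \<le> dg ((c (a \<otimes>\<^bsub>S\<^esub> b) k \<ominus> pp a b k M)
        \<oplus> pp a b k M)"
      using P c_closed[of "a \<otimes>\<^bsub>S\<^esub> b" k] partial_prod_closed[OF a b, of k M] a b by (intro dg_add_ge) auto
    then show "enat m \<le> dg (c (a \<otimes>\<^bsub>S\<^esub> b) k)"
      using c_closed[of "a \<otimes>\<^bsub>S\<^esub> b" k] partial_prod_closed[OF a b, of k M] a b by simp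
  qed
  then show ?thesis using w_attained[of "a \<otimes>\<^bsub>S\<^esub> b"] a b by auto
qed

lemma w_mult:
  assumes a: "a \<in> carrier S" and b: "b \<in> carrier S"
  shows "w (a \<otimes>\<^bsub>S\<^esub> b) = w a + w b"
proof (cases "w a = Infty \<or> w b = Infty")
  case True
  then show ?thesis using w_mult_Infty[OF a b] by auto
next
  case False
  then have fin: "w a \<noteq> Infty" "w b \<noteq> Infty" by auto
  obtain i0 where i0: "w a = tv (v (c a i0)) i0" using w_attained[OF a] by blast
  obtain q0 where q0: "w b = tv (v (c b q0)) q0" using w_attained[OF b] by blast
  let ?ab = "a \<otimes>\<^bsub>S\<^esub> b"
  have ab: "?ab \<in> carrier S" using a b by simp
  obtain W where W: "w a + w b = Val W" using fin by (cases "w a"; cases "w b") auto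
  have approx: "\<exists>M d. i0 < M \<and> d \<in> carrier A \<and> w a + w b < tv (v d) k \<and>
      c ?ab k = pp a b k M \<oplus> d" for k
  proof -
    \<comment> \<open>One more than the degree of \<open>w a + w b\<close>, so the truncation error
      \<open>d\<close> stays beyond the leading term; the bound \<open>Suc i0\<close> keeps the
      leading index inside the truncation.\<close>
    define K where "K = nat (pcoeff W N) + 1"
    obtain M where M: "Suc i0 \<le> M" "enat K \<le> dg (c ?ab k \<ominus> pp a b k M)"
      using c_mult[OF a b, of "Suc i0" K k] by (auto simp: dg_def)
    define d where "d = c ?ab k \<ominus> pp a b k M"
    have cl: "c ?ab k \<in> carrier A" "pp a b k M \<in> carrier A"
      using c_closed[OF ab] partial_prod_closed[OF a b] by auto
    then have dc: "d \<in> carrier A" by (simp add: d_def)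
    have "vdeg N (w a + w b) < vdeg N (v d)"
    proof -
      have "vdeg N (w a + w b) < enat K" by (simp add: W K_def)
      also have "\<dots> \<le> vdeg N (v d)" using M(2) by (simp add: d_def dg_def)
      finally show ?thesis .
    qed
    also have "\<dots> \<le> vdeg N (tv (v d) k)"
      by (cases "v d") (use SjN in \<open>auto simp: of_nat_mult_evec_coeff intro: nat_mono\<close>)
    finally have "w a + w b < tv (v d) k"
      using w_Vals a b SjN Vals_mono[of j "Suc j" N "v d"] v_Vals[OF dc]
      by (intro vdeg_lessI[of _ N "Suc j"]) (auto intro!: Vals_add evec_mult_Gam)
    moreover have "c ?ab k = pp a b k M \<oplus> d"
      using a_comm[OF dc cl(2)] minus_add_cancel[OF cl] by (simp add: d_def)
    ultimately show ?thesis using M(1) dc by (intro exI[of _ M] exI[of _ d]) auto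
  qed
  have ge: "w a + w b < tv (v (c ?ab k)) k" if k: "k \<noteq> i0 + q0" for k
  proof -
    obtain M d where M: "d \<in> carrier A" "w a + w b < tv (v d) k"
      "c ?ab k = pp a b k M \<oplus> d" using approx by blast
    obtain \<gamma> where \<gamma>: "w a + w b = tv \<gamma> k" using tv_le_iff[of "w a + w b" k] fin by auto
    have "\<gamma> < v (pp a b k M)"
      using v_partial(1)[OF a b i0 q0 fin k, of M] \<gamma> by simp
    moreover have "\<gamma> < v d" using M \<gamma> by simp
    ultimately have "\<gamma> < v (c ?ab k)" unfolding M(3)
      using M(1) partial_prod_closed[OF a b] by (intro v_add_gt) auto
    then show ?thesis using \<gamma> by simp
  qed
  have eq: "w a + w b = tv (v (c ?ab k)) k" if k: "k = i0 + q0" for k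
  proof -
    obtain M d where M: "i0 < M" "d \<in> carrier A" "w a + w b < tv (v d) k"
      "c ?ab k = pp a b k M \<oplus> d" using approx by blast
    have e: "w a + w b = tv (v (pp a b k M)) k"
      using v_partial(2)[OF a b i0 q0 fin k M(1)] .
    then have "v (pp a b k M) < v d" using M(3) by simp
    then have "v (c ?ab k) = v (pp a b k M)" unfolding M(4)
      using M(2) partial_prod_closed[OF a b] by (intro v_add_eq) auto
    then show ?thesis using e by simp
  qed
  show ?thesis
  proof (rule antisym)
    show "w ?ab \<le> w a + w b" using w_le[OF ab, of "i0 + q0"] unfolding eq[OF refl] .
    show "w a + w b \<le> w ?ab"
    proof (rule w_geI[OF ab])
      fix k
      show "w a + w b \<le> tv (v (c ?ab k)) k"
      proof (cases "k = i0 + q0")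
        case True
        then show ?thesis using eq by (metis order_refl)
      next
        case False
        then show ?thesis using ge[of k] by simp
      qed
    qed
  qed
qed

lemma w_add:
  assumes a: "a \<in> carrier S" and b: "b \<in> carrier S"
  shows "min (w a) (w b) \<le> w (a \<oplus>\<^bsub>S\<^esub> b)"
proof (rule w_geI)
  fix s
  have "w a \<le> tv (v (c a s)) s" "w b \<le> tv (v (c b s)) s" using w_le a b by auto
  moreover have "min (v (c a s)) (v (c b s)) \<le> v (c (a \<oplus>\<^bsub>S\<^esub> b) s)"
    using v_add c_closed a b c_add by simp
  ultimately show "min (w a) (w b) \<le> tv (v (c (a \<oplus>\<^bsub>S\<^esub> b) s)) s"
    by (smt (verit) min.coboundedI1 min.coboundedI2 min_def order_trans val_add_cancel_le)
qed (use a b in auto)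

text \<open>Constants act from the left on each coefficient separately. A constant that cancels the
  leading coefficient of \<open>a\<close> against that of \<open>b\<close> leaves every other term
  above the common value.\<close>

lemma w_unit:
  assumes a: "a \<in> carrier S" and b: "b \<in> carrier S" and eq: "w a = w b" and fin: "w b \<noteq> Infty"
  shows "\<exists>u\<in>carrier S. w b < w (a \<ominus>\<^bsub>S\<^esub> u \<otimes>\<^bsub>S\<^esub> b)"
proof -
  obtain i0 where i0: "w a = tv (v (c a i0)) i0" using w_attained[OF a] by blast
  obtain q0 where q0: "w b = tv (v (c b q0)) q0" using w_attained[OF b] by blast
  have "tv (v (c a i0)) i0 = tv (v (c b q0)) q0" "tv (v (c a i0)) i0 \<noteq> Infty"
    using i0[symmetric] q0[symmetric] eq fin by (metis, metis)
  then have "i0 = q0" using tv_inj[OF v_Vals v_Vals] c_closed a b by blast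
  then have va: "v (c a q0) = v (c b q0)" using i0 q0 eq by simp
  have "v (c b q0) \<noteq> Infty" using fin q0 by auto
  then obtain u where u: "u \<in> carrier A" "v (c b q0) < v (c a q0 \<ominus> u \<otimes> c b q0)"
    using v_unit[OF _ _ va] c_closed a b by blast
  have uS: "u \<in> carrier S" using u const_closed by blast
  have "w b < w (a \<ominus>\<^bsub>S\<^esub> u \<otimes>\<^bsub>S\<^esub> b)"
  proof (rule w_gtI)
    fix s
    have cs: "c (a \<ominus>\<^bsub>S\<^esub> u \<otimes>\<^bsub>S\<^esub> b) s = c a s \<ominus> u \<otimes> c b s"
      using c_minus a b uS u by (simp add: c_const_mult)
    show "w b < tv (v (c (a \<ominus>\<^bsub>S\<^esub> u \<otimes>\<^bsub>S\<^esub> b) s)) s"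
    proof (cases "s = q0")
      case True
      then show ?thesis using u(2) q0 cs by simp
    next
      case False
      obtain \<gamma> where \<gamma>: "w b = tv \<gamma> s" using tv_le_iff[OF fin] by blast
      have "w b < tv (v (c a s)) s" using tv_strict[OF a, of q0 s] False i0 \<open>i0 = q0\<close> eq fin by simp
      then have 1: "\<gamma> < v (c a s)" using \<gamma> by simp
      have "w b < tv (v (c b s)) s" using tv_strict[OF b q0 fin False] .
      then have "\<gamma> < v (c b s)" using \<gamma> by simp
      moreover have "v (c b s) \<le> v (u \<otimes> c b s)"
        using u b c_closed v_nonneg[of u] val_add_mono[of 0 "v u" "v (c b s)" "v (c b s)"] by (simp add: v_mult)
      ultimately have 2: "\<gamma> < v (u \<otimes> c b s)" by simp
      have "min (v (c a s)) (v (u \<otimes> c b s)) \<le> v (c a s \<ominus> u \<otimes> c b s)"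
        using v_minus a b u c_closed by simp
      then have "\<gamma> < v (c a s \<ominus> u \<otimes> c b s)" using 1 2 by (meson min_less_iff_conj order_less_le_trans)
      then show ?thesis using \<gamma> cs by simp
    qed
  qed (use a b uS in auto)
  then show ?thesis using uS by blast
qed

lemma w_zero: "w \<zero>\<^bsub>S\<^esub> = Infty"
  using w_attained[of "\<zero>\<^bsub>S\<^esub>"] by (auto simp: c_zero v_zero)

lemma w_one: "w \<one>\<^bsub>S\<^esub> = 0"
proof (rule antisym)
  show "w \<one>\<^bsub>S\<^esub> \<le> 0" using w_le[of "\<one>\<^bsub>S\<^esub>" 0] by (simp add: c_one v_one zero_val_def)
  show "0 \<le> w \<one>\<^bsub>S\<^esub>"
    by (rule w_geI) (auto simp: c_one v_one v_zero zero_val_def)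
qed

lemma pval_ext: "pval S N (Suc j) w"
  by unfold_locales (rule SjN w_Vals w_zero w_one w_add w_mult w_unit; assumption)+

end

section \<open>Adic limits and coefficient functions\<close>

lemma (in ring) minus_minus_cancel_right:
  assumes "a \<in> carrier R" "b \<in> carrier R" "z \<in> carrier R"
  shows "(a \<ominus> z) \<ominus> (b \<ominus> z) = a \<ominus> b"
proof -
  have "a \<ominus> z = (a \<ominus> b) \<oplus> (b \<ominus> z)" using assms by (simp add: a_minus_def a_assoc r_neg1)
  then show ?thesis using assms by (simp add: minus_eq[of _ "b \<ominus> z"] a_assoc r_neg)
qed

lemma (in ring) minus_minus_cancel_left:
  assumes "a \<in> carrier R" "b \<in> carrier R" "z \<in> carrier R"
  shows "(z \<ominus> b) \<ominus> (z \<ominus> a) = a \<ominus> b"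
proof -
  have neg: "z \<ominus> y = \<ominus> (y \<ominus> z)" if "y \<in> carrier R" for y
    using assms(3) that by (simp add: a_minus_def minus_add a_comm)
  have "(z \<ominus> b) \<ominus> (z \<ominus> a) = \<ominus> (b \<ominus> z) \<oplus> (a \<ominus> z)"
    unfolding neg[OF assms(1)] neg[OF assms(2)] using assms
    by (simp only: minus_eq[of "\<ominus> (b \<ominus> z)"] minus_minus minus_closed)
  also have "\<dots> = (a \<ominus> z) \<ominus> (b \<ominus> z)"
    using assms by (simp add: minus_eq[of _ "b \<ominus> z"] a_comm)
  finally show ?thesis using minus_minus_cancel_right[OF assms] by simp
qed

lemma (in ring) finsum_eq_single:
  assumes "finite I" "i \<in> I" "f i \<in> carrier R" "\<And>j. j \<in> I \<Longrightarrow> j \<noteq> i \<Longrightarrow> f j = \<zero>"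
  shows "finsum R f I = f i"
proof -
  have "finsum R f (insert i (I - {i})) = f i \<oplus> finsum R f (I - {i})"
    using assms by (intro finsum_insert) auto
  moreover have "finsum R f (I - {i}) = finsum R (\<lambda>_. \<zero>) (I - {i})"
    using assms(4) by (intro finsum_cong') auto
  ultimately show ?thesis using assms(2,3) by (simp add: insert_absorb)
qed

lemma (in pval) dg_finsum_ge:
  assumes "finite I" "\<And>i. i \<in> I \<Longrightarrow> f i \<in> carrier R" "\<And>i. i \<in> I \<Longrightarrow> m \<le> dg (f i)"
  shows "m \<le> dg (finsum R f I)"
  using assms
proof (induction I)
  case (insert i I)
  have "finsum R f (insert i I) = f i \<oplus> finsum R f I"
    using insert by (intro finsum_insert) auto
  moreover have "finsum R f I \<in> carrier R" using insert by (intro finsum_closed) auto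
  ultimately show ?case using insert by (simp add: dg_add_ge)
qed simp

text \<open>By \<open>pow\<close> the adic topology of \<open>A\<close> is the degree topology of
  \<open>v\<close>, so the limits that define products can be computed with
  \<open>dg\<close>.\<close>

locale skew_ps = pval_skew A N j v \<sigma> \<delta> for A :: "('a, 'b) ring_scheme" (structure) and N j v \<sigma> \<delta> +
  assumes complete: "complete_local A"
    and pow: "\<And>m. ideal_pow A (max_ideal A) m = {a \<in> carrier A. enat m \<le> dg a}"
    and sder: "skew_derivation A \<sigma> \<delta>"
begin

lemma adic_conv_iff: "adic_conv A (max_ideal A) f l \<longleftrightarrow>
    l \<in> carrier A \<and> (\<forall>m. \<exists>M. \<forall>p\<ge>M. f p \<ominus> l \<in> carrier A \<and> enat m \<le> dg (f p \<ominus> l))"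
  by (simp add: adic_conv_def pow)

lemma adic_lim_unique:
  assumes "adic_conv A (max_ideal A) f l" "\<And>p. f p \<in> carrier A"
  shows "adic_lim A (max_ideal A) f = l"
  unfolding adic_lim_def
proof (rule the_equality, rule assms(1))
  fix l' assume l': "adic_conv A (max_ideal A) f l'"
  have c: "l \<in> carrier A" "l' \<in> carrier A" using assms(1) l' by (auto simp: adic_conv_iff)
  have "l' \<ominus> l \<in> ideal_pow A (max_ideal A) m" for m
  proof -
    obtain M M' where M: "\<forall>p\<ge>M. enat m \<le> dg (f p \<ominus> l)" "\<forall>p\<ge>M'. enat m \<le> dg (f p \<ominus> l')"
      using assms(1) l' unfolding adic_conv_iff by meson
    define p where "p = max M M'"
    have "l' \<ominus> l = (f p \<ominus> l) \<ominus> (f p \<ominus> l')"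
      using minus_minus_cancel_left[OF c(2,1) assms(2)[of p]] by simp
    moreover have "enat m \<le> dg ((f p \<ominus> l) \<ominus> (f p \<ominus> l'))"
      using M c assms(2)[of p] by (rule_tac dg_minus_ge) (auto simp: p_def)
    ultimately have "enat m \<le> dg (l' \<ominus> l)" by metis
    then show ?thesis using c by (simp add: pow)
  qed
  then have "l' \<ominus> l \<in> (\<Inter>m. ideal_pow A (max_ideal A) m)" by blast
  then have "l' \<ominus> l = \<zero>" using complete unfolding complete_local_def by blast
  then show "l' = l" using c r_right_minus_eq by blast
qed

lemma adic_lim_eventually_const:
  assumes "\<And>p. p \<ge> M \<Longrightarrow> f p = l" "\<And>p. f p \<in> carrier A" "l \<in> carrier A"
  shows "adic_lim A (max_ideal A) f = l"
proof (rule adic_lim_unique)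
  show "adic_conv A (max_ideal A) f l"
    unfolding adic_conv_iff
  proof (intro conjI allI)
    fix m
    show "\<exists>M. \<forall>p\<ge>M. f p \<ominus> l \<in> carrier A \<and> enat m \<le> dg (f p \<ominus> l)"
      using assms by (intro exI[of _ M]) (auto simp: r_right_minus_eq[THEN iffD2])
  qed (rule assms(3))
qed (rule assms(2))

lemma partial_closed:
  assumes "\<And>i. f i \<in> carrier A" "\<And>i. g i \<in> carrier A"
  shows "partial_prod A \<sigma> \<delta> f g k M \<in> carrier A"
  unfolding partial_prod_def using assms by (auto intro!: finsum_closed sd_word_closed)

lemma partial_Suc:
  assumes "\<And>i. f i \<in> carrier A" "\<And>i. g i \<in> carrier A"
  shows "partial_prod A \<sigma> \<delta> f g k (Suc M) =
    finsum A (\<lambda>q. f M \<otimes> sd_word A \<sigma> \<delta> M (k - q) (g q)) {..k} \<oplus> partial_prod A \<sigma> \<delta> f g k M"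
  unfolding partial_prod_def lessThan_Suc
  using assms by (intro finsum_insert) (auto intro!: finsum_closed sd_word_closed)

text \<open>In a summand with index at least \<open>m + k\<close>, each word with at most
  \<open>k\<close> letters \<open>\<sigma>\<close> contains at least \<open>m\<close> letters
  \<open>\<delta>\<close>. This makes the truncations Cauchy.\<close>

lemma partial_diff:
  assumes f: "\<And>i. f i \<in> carrier A" and g: "\<And>i. g i \<in> carrier A" and M: "m + k \<le> M"
  shows "enat m \<le> dg (partial_prod A \<sigma> \<delta> f g k (M + d) \<ominus> partial_prod A \<sigma> \<delta> f g k M)"
proof (induction d)
  case 0
  then show ?case using partial_closed[of f g, OF f g] by (simp add: r_right_minus_eq[THEN iffD2])
next
  case (Suc d)
  define t where "t = finsum A (\<lambda>q. f (M + d) \<otimes> sd_word A \<sigma> \<delta> (M + d) (k - q) (g q)) {..k}"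
  have tc: "t \<in> carrier A" unfolding t_def using f g by (auto intro!: finsum_closed sd_word_closed)
  have "enat m \<le> dg t"
    unfolding t_def
  proof (rule dg_finsum_ge)
    fix q assume "q \<in> {..k}"
    have "enat m \<le> enat (M + d - (k - q))" using M by simp
    also have "\<dots> \<le> dg (g q) + enat (M + d - (k - q))" by (simp add: add_increasing)
    also have "\<dots> \<le> dg (sd_word A \<sigma> \<delta> (M + d) (k - q) (g q))" by (rule sd_word_dg[OF g])
    also have "\<dots> \<le> dg (f (M + d) \<otimes> sd_word A \<sigma> \<delta> (M + d) (k - q) (g q))"
      using f g by (simp add: dg_mult sd_word_closed add_increasing)
    finally show "enat m \<le> dg (f (M + d) \<otimes> sd_word A \<sigma> \<delta> (M + d) (k - q) (g q))" .
  qed (use f g in \<open>auto intro!: sd_word_closed\<close>)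
  moreover have "partial_prod A \<sigma> \<delta> f g k (M + Suc d) \<ominus> partial_prod A \<sigma> \<delta> f g k M
      = t \<oplus> (partial_prod A \<sigma> \<delta> f g k (M + d) \<ominus> partial_prod A \<sigma> \<delta> f g k M)"
    using partial_Suc[of f g k "M + d", OF f g] tc partial_closed[of f g, OF f g]
    by (simp add: t_def a_minus_def a_assoc)
  ultimately show ?case using Suc tc partial_closed[of f g, OF f g] by (simp add: dg_add_ge)
qed

lemma adic_cauchyI:
  assumes f: "\<And>p. f p \<in> carrier A" and d: "\<And>m. \<exists>M. \<forall>p\<ge>M. enat m \<le> dg (f p \<ominus> f M)"
  shows "adic_conv A (max_ideal A) f (adic_lim A (max_ideal A) f)"
proof -
  have "adic_cauchy A (max_ideal A) f"
    unfolding adic_cauchy_def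
  proof
    fix m
    obtain M where M: "\<forall>p\<ge>M. enat m \<le> dg (f p \<ominus> f M)" using d by blast
    have "f p \<ominus> f q \<in> ideal_pow A (max_ideal A) m" if "p \<ge> M" "q \<ge> M" for p q
    proof -
      have "f p \<ominus> f q = (f p \<ominus> f M) \<ominus> (f q \<ominus> f M)"
        using minus_minus_cancel_right[OF f f f] by simp
      then have "enat m \<le> dg (f p \<ominus> f q)"
        using dg_minus_ge[of "f p \<ominus> f M" "f q \<ominus> f M" "enat m"] M that f by simp
      then show ?thesis using f by (simp add: pow)
    qed
    then show "\<exists>M. \<forall>p\<ge>M. \<forall>q\<ge>M. f p \<ominus> f q \<in> ideal_pow A (max_ideal A) m" by blast
  qed
  then obtain l where l: "adic_conv A (max_ideal A) f l"
    using complete f unfolding complete_local_def by blast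
  then show ?thesis using adic_lim_unique[OF l f] by simp
qed

lemma partial_conv:
  assumes f: "\<And>i. f i \<in> carrier A" and g: "\<And>i. g i \<in> carrier A"
  shows "adic_conv A (max_ideal A) (partial_prod A \<sigma> \<delta> f g k)
    (adic_lim A (max_ideal A) (partial_prod A \<sigma> \<delta> f g k))"
proof (rule adic_cauchyI)
  fix m
  show "\<exists>M. \<forall>p\<ge>M. enat m \<le> dg (partial_prod A \<sigma> \<delta> f g k p \<ominus> partial_prod A \<sigma> \<delta> f g k M)"
    using partial_diff[of f g m k "m + k", OF f g] by (metis le_iff_add order_refl)
qed (rule partial_closed[of f g, OF f g])

lemma ps_mult: "(f \<otimes>\<^bsub>skew_ps_ring A \<sigma> \<delta>\<^esub> g) k = adic_lim A (max_ideal A) (partial_prod A \<sigma> \<delta> f g k)"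
  by (simp add: skew_ps_ring_def partial_prod_def[abs_def])

lemma ps_carrier: "f \<in> carrier (skew_ps_ring A \<sigma> \<delta>) \<longleftrightarrow> (\<forall>i. f i \<in> carrier A)"
  by (simp add: skew_ps_ring_def)

lemma ps_mult_closed:
  assumes f: "\<And>i. f i \<in> carrier A" and g: "\<And>i. g i \<in> carrier A"
  shows "(f \<otimes>\<^bsub>skew_ps_ring A \<sigma> \<delta>\<^esub> g) k \<in> carrier A"
  using partial_conv[of f g k, OF f g] by (simp add: ps_mult adic_conv_def)

lemma \<sigma>_one: "\<sigma> \<one> = \<one>"
  using sder by (simp add: skew_derivation_def ring_iso_def ring_hom_def)

lemma \<delta>_one: "\<delta> \<one> = \<zero>"
proof -
  have "\<delta> (\<one> \<otimes> \<one>) = \<delta> \<one> \<otimes> \<one> \<oplus> \<sigma> \<one> \<otimes> \<delta> \<one>"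
    using sder one_closed unfolding skew_derivation_def by blast
  then have "\<delta> \<one> = \<delta> \<one> \<oplus> \<delta> \<one>" using \<delta>_closed by (simp add: \<sigma>_one)
  then show ?thesis using \<delta>_closed[of \<one>] by (metis add.l_cancel_one one_closed)
qed

lemma sd_word_zero: "sd_word A \<sigma> \<delta> i l \<zero> = \<zero>"
  by (induction i arbitrary: l) (auto simp: \<sigma>_zero \<delta>_zero)

lemma sd_word_one: "sd_word A \<sigma> \<delta> i l \<one> = (if l = i then \<one> else \<zero>)"
  by (induction i arbitrary: l) (auto simp: \<sigma>_zero \<delta>_zero \<sigma>_one \<delta>_one)

text \<open>With the variable on the right only words applied to \<open>\<zero>\<close> or
  \<open>\<one>\<close> occur, and \<open>\<sigma> \<one> = \<one>\<close>,
  \<open>\<delta> \<one> = \<zero>\<close> leave a pure shift of the coefficients.\<close>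

lemma ps_mult_var:
  assumes f: "\<And>i. f i \<in> carrier A"
  shows "(f \<otimes>\<^bsub>skew_ps_ring A \<sigma> \<delta>\<^esub> ps_var A) k = (if k = 0 then \<zero> else f (k - 1))"
  unfolding ps_mult
proof (rule adic_lim_eventually_const)
  fix p assume p: "k \<le> p"
  let ?t = "\<lambda>i q. f i \<otimes> sd_word A \<sigma> \<delta> i (k - q) (ps_var A q)"
  have t: "?t i q = (if q = 1 \<and> k - 1 = i then f i else \<zero>)" for i q
    using f by (auto simp: ps_var_def sd_word_zero sd_word_one)
  have inner: "finsum A (?t i) {..k} = (if 1 \<le> k \<and> k - 1 = i then f i else \<zero>)" for i
  proof (cases "1 \<le> k")
    case True
    then have "finsum A (?t i) {..k} = ?t i 1"
      unfolding t using f by (intro finsum_eq_single) auto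
    then show ?thesis using True t[of i 1] by auto
  next
    case False
    then have "finsum A (?t i) {..k} = ?t i 0" unfolding t by (intro finsum_eq_single) auto
    then show ?thesis using False t[of i 0] by simp
  qed
  show "partial_prod A \<sigma> \<delta> f (ps_var A) k p = (if k = 0 then \<zero> else f (k - 1))"
  proof (cases "k = 0")
    case True
    then show ?thesis unfolding partial_prod_def inner by simp
  next
    case False
    then have "finsum A (\<lambda>i. if 1 \<le> k \<and> k - 1 = i then f i else \<zero>) {..<p} =
      (if 1 \<le> k \<and> k - 1 = k - 1 then f (k - 1) else \<zero>)"
      using p f by (intro finsum_eq_single) auto
    then show ?thesis unfolding partial_prod_def inner using False by simp
  qed
qed (use f in \<open>auto intro!: partial_closed simp: ps_var_def\<close>)

lemma ps_const_mult:
  assumes u: "u \<in> carrier A" and g: "\<And>i. g i \<in> carrier A"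
  shows "(ps_const A u \<otimes>\<^bsub>skew_ps_ring A \<sigma> \<delta>\<^esub> g) k = u \<otimes> g k"
  unfolding ps_mult
proof (rule adic_lim_eventually_const)
  fix p :: nat assume p: "1 \<le> p"
  let ?t = "\<lambda>i q. ps_const A u i \<otimes> sd_word A \<sigma> \<delta> i (k - q) (g q)"
  have t: "?t i q = (if i = 0 \<and> k - q = 0 then u \<otimes> g q else \<zero>)" for i q
    using u g by (auto simp: ps_const_def sd_word_closed)
  have inner: "finsum A (?t i) {..k} = (if i = 0 then u \<otimes> g k else \<zero>)" for i
  proof -
    have "finsum A (?t i) {..k} = ?t i k" unfolding t using u g by (intro finsum_eq_single) auto
    then show ?thesis using t[of i k] by simp
  qed
  have "finsum A (\<lambda>i. if i = 0 then u \<otimes> g k else \<zero>) {..<p} = (if 0 = (0::nat) then u \<otimes> g k else \<zero>)"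
    using p u g by (intro finsum_eq_single) auto
  then show "partial_prod A \<sigma> \<delta> (ps_const A u) g k p = u \<otimes> g k"
    unfolding partial_prod_def inner by simp
qed (use u g in \<open>auto intro!: partial_closed simp: ps_const_def\<close>)

end

section \<open>Coefficients in a ring isomorphic to a skew power series ring\<close>

locale skew_ps_iso = skew_ps A N j v \<sigma> \<delta> + S: ring S
  for A :: "('a, 'b) ring_scheme" (structure) and N j v \<sigma> \<delta> and S :: "('a, 'c) ring_scheme" +
  fixes \<phi> :: "(nat \<Rightarrow> 'a) \<Rightarrow> 'a" and x :: 'a
  assumes SjN: "Suc j < N"
    and iso: "\<phi> \<in> ring_iso (skew_ps_ring A \<sigma> \<delta>) S"
    and \<phi>_const: "a \<in> carrier A \<Longrightarrow> \<phi> (ps_const A a) = a"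
    and \<phi>_var: "\<phi> (ps_var A) = x"
begin

abbreviation "P \<equiv> skew_ps_ring A \<sigma> \<delta>"

definition c :: "'a \<Rightarrow> nat \<Rightarrow> 'a" where
  "c = inv_into (carrier P) \<phi>"

lemma bij: "bij_betw \<phi> (carrier P) (carrier S)"
  and hom: "\<phi> \<in> ring_hom P S"
  using iso by (auto simp: ring_iso_def)

lemma c_carrier: "a \<in> carrier S \<Longrightarrow> c a \<in> carrier P"
  unfolding c_def using bij by (metis bij_betw_imp_surj_on inv_into_into)

lemma c_closed: "a \<in> carrier S \<Longrightarrow> c a s \<in> carrier A"
  using c_carrier ps_carrier by blast

lemma \<phi>_c: "a \<in> carrier S \<Longrightarrow> \<phi> (c a) = a"
  unfolding c_def using bij by (metis bij_betw_imp_surj_on f_inv_into_f)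

lemma c_\<phi>: "f \<in> carrier P \<Longrightarrow> c (\<phi> f) = f"
  unfolding c_def using bij by (metis bij_betw_inv_into_left)

lemma \<phi>_closed: "f \<in> carrier P \<Longrightarrow> \<phi> f \<in> carrier S"
  using bij by (auto simp: bij_betw_def)

lemma const_carrier: "a \<in> carrier A \<Longrightarrow> ps_const A a \<in> carrier P"
  by (auto simp: ps_carrier ps_const_def)

lemma var_carrier: "ps_var A \<in> carrier P"
  by (auto simp: ps_carrier ps_var_def)

lemma const_closed: "carrier A \<subseteq> carrier S"
  using \<phi>_const const_carrier \<phi>_closed by (metis subsetI)

lemma x_closed: "x \<in> carrier S"
  using \<phi>_var var_carrier \<phi>_closed by metis

lemma c_const: "a \<in> carrier A \<Longrightarrow> c a = ps_const A a"
  using c_\<phi>[OF const_carrier] \<phi>_const by metis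

lemma c_var: "c x = ps_var A"
  using c_\<phi>[OF var_carrier] \<phi>_var by metis

lemma c_add: assumes "a \<in> carrier S" "b \<in> carrier S"
  shows "c (a \<oplus>\<^bsub>S\<^esub> b) s = c a s \<oplus> c b s"
proof -
  have f: "c a \<oplus>\<^bsub>P\<^esub> c b \<in> carrier P"
    using c_closed assms by (auto simp: skew_ps_ring_def)
  have "\<phi> (c a \<oplus>\<^bsub>P\<^esub> c b) = a \<oplus>\<^bsub>S\<^esub> b"
    using ring_hom_add[OF hom c_carrier c_carrier] assms \<phi>_c by simp
  then have "c (a \<oplus>\<^bsub>S\<^esub> b) = c a \<oplus>\<^bsub>P\<^esub> c b" using c_\<phi>[OF f] by simp
  then show ?thesis by (simp add: skew_ps_ring_def)
qed

lemma c_mult: assumes "a \<in> carrier S" "b \<in> carrier S"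
  shows "c (a \<otimes>\<^bsub>S\<^esub> b) = c a \<otimes>\<^bsub>P\<^esub> c b"
proof -
  have f: "c a \<otimes>\<^bsub>P\<^esub> c b \<in> carrier P"
    unfolding ps_carrier using c_closed assms by (auto intro: ps_mult_closed)
  have "\<phi> (c a \<otimes>\<^bsub>P\<^esub> c b) = a \<otimes>\<^bsub>S\<^esub> b"
    using ring_hom_mult[OF hom c_carrier c_carrier] assms \<phi>_c by simp
  then show ?thesis using c_\<phi>[OF f] by simp
qed

lemma c_one: "c \<one>\<^bsub>S\<^esub> s = (if s = 0 then \<one> else \<zero>)"
proof -
  have f: "\<one>\<^bsub>P\<^esub> \<in> carrier P" unfolding ps_carrier by (simp add: skew_ps_ring_def)
  have "c \<one>\<^bsub>S\<^esub> = \<one>\<^bsub>P\<^esub>" using c_\<phi>[OF f] ring_hom_one[OF hom] by simp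
  then show ?thesis by (simp add: skew_ps_ring_def)
qed

lemma c_zero: "c \<zero>\<^bsub>S\<^esub> s = \<zero>"
proof -
  have "c (\<zero>\<^bsub>S\<^esub> \<oplus>\<^bsub>S\<^esub> \<zero>\<^bsub>S\<^esub>) s = c \<zero>\<^bsub>S\<^esub> s \<oplus> c \<zero>\<^bsub>S\<^esub> s" by (rule c_add) auto
  then show ?thesis using c_closed[of "\<zero>\<^bsub>S\<^esub>" s] by (metis S.zero_closed S.r_zero add.l_cancel_one)
qed

lemma c_inj: "a \<in> carrier S \<Longrightarrow> b \<in> carrier S \<Longrightarrow> c a = c b \<Longrightarrow> a = b"
  using \<phi>_c by metis

text \<open>Limits are taken in the adic topology, described by \<open>v\<close>; convergence there
  implies convergence for any \<open>v'\<close> whose degree is at least the adic order. Hence one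
  coefficient function extends many pseudo-valuations.\<close>

lemma skew_extI:
  assumes "pval_skew A N j v' \<sigma> \<delta>"
    and sub: "\<And>m. ideal_pow A (max_ideal A) m \<subseteq> {a \<in> carrier A. enat m \<le> vdeg N (v' a)}"
  shows "skew_ext A N j v' \<sigma> \<delta> S c"
proof -
  interpret v': pval_skew A N j v' \<sigma> \<delta> by fact
  show ?thesis
  proof (intro skew_ext.intro skew_ext_axioms.intro)
    show "pval_skew A N j v' \<sigma> \<delta>" "ring S" by (fact assms(1), fact S.ring_axioms)
  next
    fix u b s assume "u \<in> carrier A" "b \<in> carrier S"
    then show "c (u \<otimes>\<^bsub>S\<^esub> b) s = u \<otimes> c b s"
      using const_closed c_mult[of u b] c_const[of u] ps_const_mult[of u "c b" s] c_closed[of b] by auto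
  next
    fix a b M0 K k assume ab: "a \<in> carrier S" "b \<in> carrier S"
    have "adic_conv A (max_ideal A) (partial_prod A \<sigma> \<delta> (c a) (c b) k) (c (a \<otimes>\<^bsub>S\<^esub> b) k)"
      using partial_conv[of "c a" "c b" k] c_closed ab by (simp add: c_mult ps_mult)
    then obtain M where M: "\<forall>p\<ge>M. partial_prod A \<sigma> \<delta> (c a) (c b) k p \<ominus> c (a \<otimes>\<^bsub>S\<^esub> b) k
        \<in> ideal_pow A (max_ideal A) K" unfolding adic_conv_def by blast
    define p where "p = max M M0"
    have pc: "partial_prod A \<sigma> \<delta> (c a) (c b) k p \<in> carrier A" using partial_closed c_closed ab by blast
    have cc: "c (a \<otimes>\<^bsub>S\<^esub> b) k \<in> carrier A" using c_closed ab by blast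
    have "enat K \<le> v'.dg (partial_prod A \<sigma> \<delta> (c a) (c b) k p \<ominus> c (a \<otimes>\<^bsub>S\<^esub> b) k)"
      using subsetD[OF sub[of K], OF M[rule_format, of p]] unfolding v'.dg_def p_def by simp
    also have "\<dots> = v'.dg (\<ominus> (partial_prod A \<sigma> \<delta> (c a) (c b) k p \<ominus> c (a \<otimes>\<^bsub>S\<^esub> b) k))"
      using pc cc by (simp add: v'.dg_uminus)
    also have "\<ominus> (partial_prod A \<sigma> \<delta> (c a) (c b) k p \<ominus> c (a \<otimes>\<^bsub>S\<^esub> b) k) =
        c (a \<otimes>\<^bsub>S\<^esub> b) k \<ominus> partial_prod A \<sigma> \<delta> (c a) (c b) k p"
      using pc cc by (simp add: a_minus_def minus_add a_comm)
    finally show "\<exists>M\<ge>M0. enat K \<le> vdeg N (v' (c (a \<otimes>\<^bsub>S\<^esub> b) k \<ominus> partial_prod A \<sigma> \<delta> (c a) (c b) k M))"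
      by (intro exI[of _ p]) (auto simp: p_def v'.dg_def)
  qed (use SjN c_closed c_zero c_one c_add const_closed in auto)
qed

text \<open>Collecting \<open>x\<close> on the right leaves neither \<open>\<sigma>\<close> nor
  \<open>\<delta>\<close> in the quotient. This one-step expansion replaces infinite series in the
  later estimates.\<close>

lemma split_off_constant:
  assumes a: "a \<in> carrier S"
  shows "\<exists>a'\<in>carrier S. a = c a 0 \<oplus>\<^bsub>S\<^esub> a' \<otimes>\<^bsub>S\<^esub> x \<and> (\<forall>s. c a' s = c a (Suc s))"
proof -
  define f where "f = (\<lambda>s. c a (Suc s))"
  have f: "f \<in> carrier P" using c_closed a by (auto simp: ps_carrier f_def)
  define a' where "a' = \<phi> f"
  have a': "a' \<in> carrier S" "c a' = f" using f \<phi>_closed c_\<phi> by (auto simp: a'_def)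
  have a0: "c a 0 \<in> carrier S" using c_closed a const_closed by blast
  have "c a = c (c a 0 \<oplus>\<^bsub>S\<^esub> a' \<otimes>\<^bsub>S\<^esub> x)"
  proof (rule sym, rule ext)
    fix s
    have 1: "c (c a 0 \<oplus>\<^bsub>S\<^esub> a' \<otimes>\<^bsub>S\<^esub> x) s = c (c a 0) s \<oplus> c (a' \<otimes>\<^bsub>S\<^esub> x) s"
      using a0 a' x_closed by (simp add: c_add)
    have "c (a' \<otimes>\<^bsub>S\<^esub> x) s = (f \<otimes>\<^bsub>P\<^esub> ps_var A) s"
      using a' x_closed by (simp add: c_mult c_var)
    also have "\<dots> = (if s = 0 then \<zero> else f (s - 1))"
      using f by (intro ps_mult_var) (simp add: ps_carrier)
    finally have 2: "c (a' \<otimes>\<^bsub>S\<^esub> x) s = (if s = 0 then \<zero> else c a s)" by (simp add: f_def)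
    have 3: "c (c a 0) s = (if s = 0 then c a 0 else \<zero>)"
      using c_const[OF c_closed[OF a]] by (simp add: ps_const_def)
    show "c (c a 0 \<oplus>\<^bsub>S\<^esub> a' \<otimes>\<^bsub>S\<^esub> x) s = c a s"
      unfolding 1 2 3 using c_closed[OF a] by (cases "s = 0") simp_all
  qed
  moreover have "c a 0 \<oplus>\<^bsub>S\<^esub> a' \<otimes>\<^bsub>S\<^esub> x \<in> carrier S" using a0 a'(1) x_closed by simp
  ultimately have "a = c a 0 \<oplus>\<^bsub>S\<^esub> a' \<otimes>\<^bsub>S\<^esub> x" using c_inj[OF a] by metis
  moreover have "\<forall>s. c a' s = c a (Suc s)" using a'(2) by (simp add: f_def)
  ultimately show ?thesis using a'(1) by blast
qed

end

section \<open>Stable towers\<close>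

locale tower = ring R for R :: "('a, 'b) ring_scheme" (structure) +
  fixes n :: nat and C :: "nat \<Rightarrow> 'a set" and x :: "nat \<Rightarrow> 'a" and \<sigma> \<delta> :: "nat \<Rightarrow> 'a \<Rightarrow> 'a"
  assumes n_pos: "1 \<le> n"
    and C_n: "C n = carrier R"
    and C_subring: "i \<le> n \<Longrightarrow> subring (C i) R"
    and C_division: "division_ring (R\<lparr>carrier := C 0\<rparr>)"
    and C_ext: "i < n \<Longrightarrow> is_skew_ps_ext (R\<lparr>carrier := C i\<rparr>) (R\<lparr>carrier := C (Suc i)\<rparr>) (\<sigma> (Suc i)) (\<delta> (Suc i)) (x (Suc i))"
    and stable_\<sigma>: "i < j \<Longrightarrow> j \<le> n \<Longrightarrow> \<sigma> j ` max_ideal (R\<lparr>carrier := C i\<rparr>) \<subseteq> max_ideal (R\<lparr>carrier := C i\<rparr>)"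
    and stable_\<delta>: "i < j \<Longrightarrow> j \<le> n \<Longrightarrow> \<delta> j ` max_ideal (R\<lparr>carrier := C i\<rparr>) \<subseteq> max_ideal (R\<lparr>carrier := C i\<rparr>)"
begin

abbreviation N :: nat where "N \<equiv> Suc n"

abbreviation K :: "nat \<Rightarrow> ('a, 'b) ring_scheme" where "K i \<equiv> R\<lparr>carrier := C i\<rparr>"

lemma ring_K: "i \<le> n \<Longrightarrow> ring (K i)"
  using C_subring subring_is_ring by blast

lemma K_n: "K n = R"
  by (simp add: C_n)

text \<open>One isomorphism per level is fixed, so that the valuations \<open>vv i\<close> for all
  \<open>i\<close> share the same coefficient function \<open>cf l\<close>.\<close>

definition phi :: "nat \<Rightarrow> (nat \<Rightarrow> 'a) \<Rightarrow> 'a" where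
  "phi l = (SOME \<phi>. \<phi> \<in> ring_iso (skew_ps_ring (K l) (\<sigma> (Suc l)) (\<delta> (Suc l))) (K (Suc l)) \<and>
     (\<forall>a \<in> carrier (K l). \<phi> (ps_const (K l) a) = a) \<and> \<phi> (ps_var (K l)) = x (Suc l))"

definition cf :: "nat \<Rightarrow> 'a \<Rightarrow> nat \<Rightarrow> 'a" where
  "cf l = inv_into (carrier (skew_ps_ring (K l) (\<sigma> (Suc l)) (\<delta> (Suc l)))) (phi l)"

lemma phi:
  assumes "l < n"
  shows "phi l \<in> ring_iso (skew_ps_ring (K l) (\<sigma> (Suc l)) (\<delta> (Suc l))) (K (Suc l))"
    "\<And>a. a \<in> C l \<Longrightarrow> phi l (ps_const (K l) a) = a" "phi l (ps_var (K l)) = x (Suc l)"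
proof -
  have "\<exists>\<phi>. \<phi> \<in> ring_iso (skew_ps_ring (K l) (\<sigma> (Suc l)) (\<delta> (Suc l))) (K (Suc l)) \<and>
     (\<forall>a \<in> carrier (K l). \<phi> (ps_const (K l) a) = a) \<and> \<phi> (ps_var (K l)) = x (Suc l)"
    using C_ext[OF assms] by (simp add: is_skew_ps_ext_def)
  from someI_ex[OF this] show "phi l \<in> ring_iso (skew_ps_ring (K l) (\<sigma> (Suc l)) (\<delta> (Suc l))) (K (Suc l))"
    "\<And>a. a \<in> C l \<Longrightarrow> phi l (ps_const (K l) a) = a" "phi l (ps_var (K l)) = x (Suc l)"
    unfolding phi_def[symmetric] by auto
qed

lemma complete_K: "l < n \<Longrightarrow> complete_local (K l)"
  using C_ext by (auto simp: is_skew_ps_ext_def)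

lemma local_K: "l < n \<Longrightarrow> local_skew_derivation (K l) (\<sigma> (Suc l)) (\<delta> (Suc l))"
  using C_ext by (auto simp: is_skew_ps_ext_def)

lemma skew_K: "l < n \<Longrightarrow> skew_derivation (K l) (\<sigma> (Suc l)) (\<delta> (Suc l))"
  using local_K by (auto simp: local_skew_derivation_def)

lemma \<sigma>_facts:
  assumes "l < n"
  shows "\<sigma> (Suc l) ` C l = C l"
    "a \<in> C l \<Longrightarrow> \<sigma> (Suc l) a \<in> C l"
    "a \<in> C l \<Longrightarrow> b \<in> C l \<Longrightarrow> \<sigma> (Suc l) (a \<oplus> b) = \<sigma> (Suc l) a \<oplus> \<sigma> (Suc l) b"
    "a \<in> C l \<Longrightarrow> b \<in> C l \<Longrightarrow> \<sigma> (Suc l) (a \<otimes> b) = \<sigma> (Suc l) a \<otimes> \<sigma> (Suc l) b"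
  using skew_K[OF assms] by (auto simp: skew_derivation_def ring_iso_def ring_hom_def bij_betw_def)

lemma \<delta>_facts:
  assumes "l < n"
  shows "a \<in> C l \<Longrightarrow> \<delta> (Suc l) a \<in> C l"
    "a \<in> C l \<Longrightarrow> b \<in> C l \<Longrightarrow> \<delta> (Suc l) (a \<oplus> b) = \<delta> (Suc l) a \<oplus> \<delta> (Suc l) b"
    "a \<in> C l \<Longrightarrow> b \<in> C l \<Longrightarrow> \<delta> (Suc l) (a \<otimes> b) = \<delta> (Suc l) a \<otimes> b \<oplus> \<sigma> (Suc l) a \<otimes> \<delta> (Suc l) b"
  using skew_K[OF assms] by (auto simp: skew_derivation_def)

definition vbase :: "nat \<Rightarrow> 'a \<Rightarrow> val" where
  "vbase i a = (if a \<in> max_ideal (K i) then Infty else 0)"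

text \<open>For \<open>i \<le> j\<close> this is the valuation on \<open>C j\<close> that is trivial modulo the maximal ideal of \<open>C i\<close>,
  infinite on that ideal, and records the exponents of \<open>x (Suc i)\<close>, \dots, \<open>x j\<close>.\<close>

primrec vv :: "nat \<Rightarrow> nat \<Rightarrow> 'a \<Rightarrow> val" where
  "vv i 0 = vbase i"
| "vv i (Suc j) = (if Suc j \<le> i then vbase i else extv N (Suc j) (vv i j) (cf j))"

declare vv.simps [simp del]

lemma vv_base: "vv i i = vbase i"
  by (cases i) (auto simp: vv.simps)

text \<open>The facts about coefficients on which the next level relies, bundled because they become
  available only during the induction. Series are written over \<open>R\<close> instead of
  \<open>K l\<close>, which changes nothing, as only zero and one enter.\<close>

definition level_ok :: "nat \<Rightarrow> bool" where
  "level_ok l \<longleftrightarrow> (\<forall>a\<in>C (Suc l). \<forall>s. cf l a s \<in> C l) \<and> (\<forall>a\<in>C l. cf l a = ps_const R a) \<and>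
     (\<forall>a\<in>C (Suc l). \<exists>a'\<in>C (Suc l). a = cf l a 0 \<oplus> a' \<otimes> x (Suc l) \<and> (\<forall>s. cf l a' s = cf l a (Suc s))) \<and>
     x (Suc l) \<in> C (Suc l) \<and> cf l (x (Suc l)) = ps_var R \<and> C l \<subseteq> C (Suc l) \<and> inj_on (cf l) (C (Suc l))"

text \<open>The elements of positive value form a maximal ideal for every pseudo-valuation, and a
  local ring has only one. So all the valuations on one level have the same positive
  elements.\<close>

lemma max_ideal_eq:
  assumes "j < n" "pval (K j) M i v"
  shows "max_ideal (K j) = {a \<in> C j. 0 < v a}"
proof -
  interpret L: pval "K j" M i v by fact
  have "\<exists>!m. maximalideal m (K j)"
    using complete_K[OF assms(1)] by (simp add: complete_local_def local_ring_def)
  then have "(THE m. maximalideal m (K j)) = {a \<in> carrier (K j). 0 < v a}"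
    using L.maximalideal_pos by (rule the1_equality)
  then show ?thesis by (simp add: max_ideal_def)
qed

section \<open>Values along the tower\<close>

context
  fixes i :: nat
begin

abbreviation good :: "nat \<Rightarrow> bool" where "good l \<equiv> pval (K l) N l (vv i l)"

lemma vv_Suc: "i \<le> l \<Longrightarrow> vv i (Suc l) = extv N (Suc l) (vv i l) (cf l)"
  by (simp add: vv.simps)

lemma vv_ext:
  assumes "i \<le> l" "l < n" "good l" "level_ok l" "a \<in> C (Suc l)"
  shows "\<exists>s. vv i (Suc l) a = vv i l (cf l a s) + Val (of_nat s * evec N (Suc l))"
    and "vv i (Suc l) a \<le> vv i l (cf l a s) + Val (of_nat s * evec N (Suc l))"
proof -
  interpret L: pval "K l" N l "vv i l" by fact
  have "vv i l (cf l a s) \<in> Vals N l" for s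
    using assms(4,5) L.v_Vals[of "cf l a s"] by (auto simp: level_ok_def)
  note * = extv_attained[of "vv i l" "cf l" a N l, OF this]
  show "\<exists>s. vv i (Suc l) a = vv i l (cf l a s) + Val (of_nat s * evec N (Suc l))"
    "vv i (Suc l) a \<le> vv i l (cf l a s) + Val (of_nat s * evec N (Suc l))"
    using *(1,2) assms(1,2) by (simp_all only: vv_Suc)
qed

lemma vv_const:
  assumes "i \<le> l" "l < n" "good l" "level_ok l" "a \<in> C l"
  shows "vv i (Suc l) a = vv i l a"
proof -
  interpret L: pval "K l" N l "vv i l" by fact
  have a: "a \<in> C (Suc l)" and c: "cf l a = ps_const R a" using assms by (auto simp: level_ok_def)
  have "vv i (Suc l) a \<le> vv i l a" using vv_ext(2)[OF assms(1-4) a, of 0] by (simp add: c ps_const_def)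
  moreover obtain s where s: "vv i (Suc l) a = vv i l (cf l a s) + Val (of_nat s * evec N (Suc l))"
    using vv_ext(1)[OF assms(1-4) a] by blast
  have "vv i l a \<le> vv i (Suc l) a"
    using L.v_zero by (cases "s = 0") (auto simp: s c ps_const_def)
  ultimately show ?thesis by simp
qed

lemma C_mono: "l \<le> j \<Longrightarrow> (\<And>m. m < j \<Longrightarrow> level_ok m) \<Longrightarrow> C l \<subseteq> C j"
proof (induction rule: dec_induct)
  case (step m)
  have "C l \<subseteq> C m" using step by simp
  also have "C m \<subseteq> C (Suc m)" using step.prems[of m] by (simp add: level_ok_def)
  finally show ?case .
qed simp

lemma vv_const_le:
  assumes "i \<le> l" "l \<le> j" "j \<le> n" "\<And>m. i \<le> m \<Longrightarrow> m < j \<Longrightarrow> good m" "\<And>m. m < j \<Longrightarrow> level_ok m" "a \<in> C l"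
  shows "vv i j a = vv i l a"
  using assms(2,3,4,5)
proof (induction rule: dec_induct)
  case (step m)
  have "a \<in> C m" using C_mono[of l m] step assms(6) by auto
  then have "vv i (Suc m) a = vv i m a" using step assms(1) by (intro vv_const) auto
  then show ?case using step by simp
qed simp

lemma vv_x_pos:
  assumes "i \<le> l" "l < n" "good l" "level_ok l"
  shows "0 < vv i (Suc l) (x (Suc l))"
proof -
  interpret L: pval "K l" N l "vv i l" by fact
  have x: "x (Suc l) \<in> C (Suc l)" "cf l (x (Suc l)) = ps_var R" using assms by (auto simp: level_ok_def)
  obtain s where s: "vv i (Suc l) (x (Suc l)) = vv i l (cf l (x (Suc l)) s) + Val (of_nat s * evec N (Suc l))"
    using vv_ext(1)[OF assms x(1)] by blast
  have "0 < evec N (Suc l)"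
    using Gam_lessI[of 0 N "Suc l" "evec N (Suc l)"] evec_Gam[of "Suc l" "Suc l" N] assms(2)
    by (simp add: evec_coeff)
  then show ?thesis unfolding s x(2) using L.v_zero L.v_one
    by (cases "s = 1") (auto simp: ps_var_def zero_val_def)
qed

lemma vv_split:
  assumes "i \<le> l" "l < n" "good l" "level_ok l" "a \<in> C (Suc l)"
  shows "\<exists>a0\<in>C l. \<exists>a'\<in>C (Suc l). a = a0 \<oplus> a' \<otimes> x (Suc l) \<and> vv i (Suc l) a \<le> vv i l a0 \<and>
    vv i (Suc l) a \<le> vv i (Suc l) a' + Val (evec N (Suc l))"
proof -
  obtain a' where a': "a' \<in> C (Suc l)" "a = cf l a 0 \<oplus> a' \<otimes> x (Suc l)" "\<And>s. cf l a' s = cf l a (Suc s)"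
    using assms(4,5) by (auto simp: level_ok_def)
  have "cf l a 0 \<in> C l" using assms(4,5) by (auto simp: level_ok_def)
  moreover have "vv i (Suc l) a \<le> vv i l (cf l a 0)" using vv_ext(2)[OF assms, of 0] by simp
  moreover have "vv i (Suc l) a \<le> vv i (Suc l) a' + Val (evec N (Suc l))"
  proof -
    obtain s where s: "vv i (Suc l) a' = vv i l (cf l a' s) + Val (of_nat s * evec N (Suc l))"
      using vv_ext(1)[OF assms(1-4) a'(1)] by blast
    then have "vv i (Suc l) a' + Val (evec N (Suc l)) =
        vv i l (cf l a (Suc s)) + Val (of_nat (Suc s) * evec N (Suc l))"
      by (simp only: a'(3) add.assoc) (simp add: algebra_simps)
    then show ?thesis using vv_ext(2)[OF assms, of "Suc s"] by (simp only:)
  qed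
  ultimately show ?thesis using a' by blast
qed

section \<open>The effect of \<open>\<sigma>\<close> and \<open>\<delta>\<close> on values and
  degrees\<close>

context
  fixes j :: nat
  assumes ij: "i \<le> j" and jn: "j < n"
    and good: "\<And>l. i \<le> l \<Longrightarrow> l \<le> j \<Longrightarrow> good l"
    and levels: "\<And>l. l < j \<Longrightarrow> level_ok l"
begin

interpretation V: pval "K j" N j "vv i j"
  using good ij by blast

lemma vv_restrict: "i \<le> l \<Longrightarrow> l \<le> j \<Longrightarrow> a \<in> C l \<Longrightarrow> vv i j a = vv i l a"
  by (rule vv_const_le) (use jn good levels in auto)

lemma sub_C: "l \<le> j \<Longrightarrow> a \<in> C l \<Longrightarrow> a \<in> C j"
  using C_mono levels by blast

lemma mi: "i \<le> l \<Longrightarrow> l \<le> j \<Longrightarrow> max_ideal (K l) = {a \<in> C l. 0 < vv i l a}"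
  by (rule max_ideal_eq) (use good jn in auto)

lemma max_ideal_vbase: "max_ideal (K i) \<subseteq> C i"
  using mi[of i] ij by auto

text \<open>Stability keeps the image of the variable in \<open>C (Suc l)\<close>, where
  \<open>evec N (Suc l)\<close> is the least positive value. Locality of \<open>\<sigma>\<close> on
  \<open>C j\<close> alone would not do: later variables have smaller values.\<close>

lemma \<sigma>_x_ge:
  assumes l: "i \<le> l" "Suc l \<le> j"
  shows "Val (evec N (Suc l)) \<le> vv i j (\<sigma> (Suc j) (x (Suc l)))"
proof -
  have "0 < vv i (Suc l) (x (Suc l))" "x (Suc l) \<in> C (Suc l)"
    using vv_x_pos[of l] good levels l jn by (auto simp: level_ok_def)
  then have "x (Suc l) \<in> max_ideal (K (Suc l))" using mi l by simp
  then have "\<sigma> (Suc j) (x (Suc l)) \<in> max_ideal (K (Suc l))"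
    using stable_\<sigma>[of "Suc l" "Suc j"] l jn by auto
  then have s: "\<sigma> (Suc j) (x (Suc l)) \<in> C (Suc l)" "0 < vv i (Suc l) (\<sigma> (Suc j) (x (Suc l)))"
    using mi[of "Suc l"] l by auto
  interpret L: pval "K (Suc l)" N "Suc l" "vv i (Suc l)" using good l by simp
  have "Val (evec N (Suc l)) \<le> vv i (Suc l) (\<sigma> (Suc j) (x (Suc l)))"
    using s L.v_Vals[of "\<sigma> (Suc j) (x (Suc l))"] evec_least[of _ N "Suc l"] l jn
    by (cases "vv i (Suc l) (\<sigma> (Suc j) (x (Suc l)))") (auto simp: zero_val_def)
  then show ?thesis using vv_restrict[of "Suc l"] s l by simp
qed

text \<open>This comes from locality, not from stability: \<open>\<delta>\<close> maps the maximal
  ideal of \<open>C j\<close> into its square.\<close>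

lemma \<delta>_x_ge:
  assumes l: "i \<le> l" "Suc l \<le> j"
  shows "2 \<le> V.dg (\<delta> (Suc j) (x (Suc l)))"
proof -
  have x: "0 < vv i (Suc l) (x (Suc l))" "x (Suc l) \<in> C (Suc l)"
    using vv_x_pos[of l] good levels l jn by (auto simp: level_ok_def)
  then have "x (Suc l) \<in> max_ideal (K j)" using mi[of j] vv_restrict[of "Suc l"] l ij sub_C by simp
  then have "\<delta> (Suc j) (x (Suc l)) \<in> ideal_pow (K j) (max_ideal (K j)) 2"
    using local_K[OF jn] by (auto simp: local_skew_derivation_def)
  moreover have "max_ideal (K j) \<subseteq> {a \<in> carrier (K j). 1 \<le> V.dg a}"
    using mi[of j] ij V.v_pos_iff by auto
  ultimately have "enat 2 \<le> V.dg (\<delta> (Suc j) (x (Suc l)))" using V.ideal_pow_dg by blast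
  then show ?thesis by (simp add: numeral_eq_enat)
qed

lemma evec_mult_Vals: "Suc l \<le> j \<Longrightarrow> Val (of_nat M * evec N (Suc l)) \<in> Vals N j"
  using jn by (auto intro: evec_mult_Gam)

text \<open>The truncations \<open>min (vv i l a) (M e)\<close> in the proof replace the infinite expansion of \<open>a\<close> by an
  induction on \<open>M\<close>.\<close>

lemma \<sigma>_ge: "i \<le> l \<Longrightarrow> l \<le> j \<Longrightarrow> a \<in> C l \<Longrightarrow> vv i l a \<le> vv i j (\<sigma> (Suc j) a)"
proof (induction l arbitrary: a rule: dec_induct)
  case base
  show ?case
  proof (cases "a \<in> max_ideal (K i)")
    case True
    then have "\<sigma> (Suc j) a \<in> max_ideal (K i)" using stable_\<sigma>[of i "Suc j"] ij jn by auto
    then have "vv i j (\<sigma> (Suc j) a) = Infty"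
      using vv_restrict[of i "\<sigma> (Suc j) a"] max_ideal_vbase ij by (auto simp: vv_base vbase_def)
    then show ?thesis by simp
  next
    case False
    then show ?thesis using base V.v_nonneg[of "\<sigma> (Suc j) a"] \<sigma>_facts(2)[OF jn] sub_C ij
      by (simp add: vv_base vbase_def)
  qed
next
  case (step l)
  let ?s = "\<sigma> (Suc j)" and ?e = "evec N (Suc l)"
  have l: "i \<le> l" "l < n" "good l" "level_ok l" using step good levels jn by auto
  have xl: "x (Suc l) \<in> C (Suc l)" using l(4) by (simp add: level_ok_def)
  have main: "min (vv i (Suc l) a) (Val (of_nat M * ?e)) \<le> vv i j (?s a)" if "a \<in> C (Suc l)" for a M
    using that
  proof (induction M arbitrary: a)
    case 0
    then show ?case using V.v_nonneg[of "?s a"] \<sigma>_facts(2)[OF jn] sub_C step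
      by (simp add: zero_val_def min.coboundedI2)
  next
    case (Suc M)
    obtain a0 a' where a: "a0 \<in> C l" "a' \<in> C (Suc l)" "a = a0 \<oplus> a' \<otimes> x (Suc l)"
      "vv i (Suc l) a \<le> vv i l a0" "vv i (Suc l) a \<le> vv i (Suc l) a' + Val ?e"
      using vv_split[OF l Suc.prems] by blast
    have cl: "a0 \<in> C j" "a' \<in> C j" "x (Suc l) \<in> C j" using a xl sub_C[of l a0] sub_C[of "Suc l"] step by auto
    then have cs: "?s a0 \<in> C j" "?s a' \<in> C j" "?s (x (Suc l)) \<in> C j" using \<sigma>_facts(2)[OF jn] by auto
    have "a' \<otimes> x (Suc l) \<in> C j" using V.m_closed[of a' "x (Suc l)"] cl by simp
    then have sa: "?s a = ?s a0 \<oplus> ?s a' \<otimes> ?s (x (Suc l))" using a(3) cl \<sigma>_facts(3,4)[OF jn] by simp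
    let ?m = "min (vv i (Suc l) a) (Val (of_nat (Suc M) * ?e))"
    have "vv i l a0 \<le> vv i j (?s a0)" using step.IH a(1) step by simp
    then have 1: "?m \<le> vv i j (?s a0)" using a(4) by (meson min.coboundedI1 order_trans)
    have "?m \<le> min (vv i (Suc l) a') (Val (of_nat M * ?e)) + Val ?e"
    proof -
      have "Val (of_nat (Suc M) * ?e) = Val (of_nat M * ?e) + Val ?e" by (simp add: algebra_simps)
      then show ?thesis using a(5) by (auto simp: min_def split: if_splits)
    qed
    also have "\<dots> \<le> vv i j (?s a') + vv i j (?s (x (Suc l)))"
      using Suc.IH[OF a(2)] \<sigma>_x_ge[of l] step by (intro val_add_mono) auto
    also have "\<dots> = vv i j (?s a' \<otimes> ?s (x (Suc l)))" using V.v_mult cs by simp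
    finally have 2: "?m \<le> vv i j (?s a' \<otimes> ?s (x (Suc l)))" .
    have "?s a' \<otimes> ?s (x (Suc l)) \<in> C j" using V.m_closed[of "?s a'" "?s (x (Suc l))"] cs by simp
    then show ?case using V.v_add_ge[of "?s a0" "?s a' \<otimes> ?s (x (Suc l))"] 1 2 cs by (simp add: sa)
  qed
  have sc: "?s a \<in> C j" using step \<sigma>_facts(2)[OF jn] sub_C by simp
  show ?case
  proof (cases "vv i (Suc l) a")
    case (Val p)
    interpret L: pval "K (Suc l)" N "Suc l" "vv i (Suc l)" using good step by simp
    have p: "p \<in> Gam N (Suc l)" using L.v_Vals[of a] step Val by simp
    \<comment> \<open>Large enough for \<open>M\<close> times the exponent of the variable to exceed
      \<open>p\<close>, so the truncated bound is the full one.\<close>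
    define M where "M = nat (pcoeff p N) + 1"
    have "pcoeff p N < pcoeff (of_nat M * ?e) N"
      unfolding of_nat_mult_evec_coeff using step jn by (simp add: M_def)
    then have "p < of_nat M * ?e"
      using step jn by (intro Gam_lessI[OF p evec_mult_Gam]) auto
    then show ?thesis using main[of a M] step Val by (simp add: min_def)
  next
    case Infty
    \<comment> \<open>No truncation is reached when the value of \<open>a\<close> is infinite; the
      degree of the image then exceeds every bound.\<close>
    have "enat M \<le> V.dg (?s a)" for M
    proof -
      have "Val (of_nat M * ?e) \<le> vv i j (?s a)" using main[of a M] step Infty by simp
      then have "vdeg N (Val (of_nat M * ?e)) \<le> V.dg (?s a)"
        unfolding V.dg_def using V.v_Vals[of "?s a"] sc evec_mult_Vals step jn by (intro vdeg_mono) auto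
      then show ?thesis using step jn by (simp add: of_nat_mult_evec_coeff)
    qed
    then show ?thesis using V.dg_all_imp_Infty by simp
  qed
qed

lemma vdeg_restrict: "i \<le> l \<Longrightarrow> l \<le> j \<Longrightarrow> a \<in> C l \<Longrightarrow> V.dg a = vdeg N (vv i l a)"
  by (simp add: V.dg_def vv_restrict)

lemma dg_\<sigma>_ge: "a \<in> C j \<Longrightarrow> V.dg a \<le> V.dg (\<sigma> (Suc j) a)"
  unfolding V.dg_def using \<sigma>_ge[of j a] ij V.v_Vals[of a] V.v_Vals[of "\<sigma> (Suc j) a"] \<sigma>_facts(2)[OF jn] jn
  by (intro vdeg_mono) auto

text \<open>In \<open>\<delta>(a' x) = \<delta>(a') x + \<sigma>(a') \<delta>(x)\<close> the first
  summand gains a degree by induction on the truncation \<open>M\<close>, the second because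
  \<open>\<delta> x\<close> has degree at least two. The start \<open>M = 0\<close> is
  \<open>\<delta>(R) \<subseteq> \<mm>\<close>, and on the support of the valuation stability is
  used.\<close>

lemma \<delta>_ge: "i \<le> l \<Longrightarrow> l \<le> j \<Longrightarrow> a \<in> C l \<Longrightarrow> V.dg a + 1 \<le> V.dg (\<delta> (Suc j) a)"
proof (induction l arbitrary: a rule: dec_induct)
  case base
  show ?case
  proof (cases "a \<in> max_ideal (K i)")
    case True
    then have "\<delta> (Suc j) a \<in> max_ideal (K i)" using stable_\<delta>[of i "Suc j"] ij jn by auto
    then have "vv i j (\<delta> (Suc j) a) = Infty"
      using vv_restrict[of i "\<delta> (Suc j) a"] max_ideal_vbase ij by (auto simp: vv_base vbase_def)
    then show ?thesis by (simp add: V.dg_def)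
  next
    case False
    then have "V.dg a = 0" using vdeg_restrict[of i a] base ij by (simp add: vv_base vbase_def)
    moreover have "\<delta> (Suc j) a \<in> max_ideal (K j)"
      using local_K[OF jn] base sub_C ij by (auto simp: local_skew_derivation_def)
    ultimately show ?thesis using mi[of j] ij V.v_pos_iff by auto
  qed
next
  case (step l)
  let ?s = "\<sigma> (Suc j)" and ?d = "\<delta> (Suc j)" and ?x = "x (Suc l)"
  have l: "i \<le> l" "l < n" "good l" "level_ok l" using step good levels jn by auto
  have xl: "x (Suc l) \<in> C (Suc l)" using l(4) by (simp add: level_ok_def)
  have dle: "vdeg N u \<le> vdeg N w" if "u \<le> w" "u \<in> Vals N j" "w \<in> Vals N j" for u w
    using that jn by (intro vdeg_mono[of _ N j]) auto
  have dgx: "1 \<le> V.dg ?x"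
    using vv_x_pos[OF l] vv_restrict[of "Suc l" ?x] V.v_pos_iff[of ?x] xl sub_C step by simp
  have main: "min (V.dg a) (enat M) + 1 \<le> V.dg (?d a)" if "a \<in> C (Suc l)" for a M
    using that
  proof (induction M arbitrary: a)
    case 0
    have "?d a \<in> max_ideal (K j)"
      using local_K[OF jn] 0 sub_C step by (auto simp: local_skew_derivation_def)
    then have "1 \<le> V.dg (?d a)" using mi[of j] ij V.v_pos_iff by auto
    then show ?case by (simp add: min.absorb2 zero_enat_def[symmetric])
  next
    case (Suc M)
    obtain a0 a' where a: "a0 \<in> C l" "a' \<in> C (Suc l)" "a = a0 \<oplus> a' \<otimes> ?x"
      "vv i (Suc l) a \<le> vv i l a0" "vv i (Suc l) a \<le> vv i (Suc l) a' + Val (evec N (Suc l))"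
      using vv_split[OF l Suc.prems] by blast
    have cl: "a0 \<in> C j" "a' \<in> C j" "?x \<in> C j" "a \<in> C j" using a xl sub_C[of l a0] sub_C[of "Suc l"] step Suc.prems by auto
    then have cs: "?d a0 \<in> C j" "?d a' \<in> C j" "?d ?x \<in> C j" "?s a' \<in> C j"
      using \<sigma>_facts(2)[OF jn] \<delta>_facts(1)[OF jn] by auto
    have "a' \<otimes> ?x \<in> C j" using V.m_closed[of a' ?x] cl by simp
    then have da: "?d a = ?d a0 \<oplus> (?d a' \<otimes> ?x \<oplus> ?s a' \<otimes> ?d ?x)"
      using a(3) cl \<delta>_facts(2,3)[OF jn] by simp
    have g0: "V.dg a \<le> V.dg a0"
      using a(4) vdeg_restrict[of "Suc l" a] vdeg_restrict[of l a0] vv_restrict[of "Suc l" a]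
        vv_restrict[of l a0] V.v_Vals[of a] V.v_Vals[of a0] Suc.prems a(1) cl step by (auto intro!: dle)
    have g1: "V.dg a \<le> V.dg a' + 1"
    proof -
      have e: "Val (evec N (Suc l)) \<in> Vals N j" using step jn by (auto intro: evec_Gam)
      have "vv i j a \<le> vv i j a' + Val (evec N (Suc l))"
        using a(5) vv_restrict[of "Suc l"] Suc.prems a(2) step by simp
      then have "vdeg N (vv i j a) \<le> vdeg N (vv i j a' + Val (evec N (Suc l)))"
        using V.v_Vals[of a] V.v_Vals[of a'] cl e by (intro dle Vals_add) auto
      also have "\<dots> = vdeg N (vv i j a') + 1"
        using V.v_Vals[of a'] cl e step jn by (subst vdeg_add[of _ N j]) (auto simp: evec_coeff one_enat_def)
      finally show ?thesis by (simp add: V.dg_def)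
    qed
    let ?m = "min (V.dg a) (enat (Suc M))"
    have "V.dg a0 + 1 \<le> V.dg (?d a0)" using step.IH a(1) step by simp
    then have 1: "?m + 1 \<le> V.dg (?d a0)"
      using g0 by (meson add_right_mono min.coboundedI1 order_trans)
    have "?m \<le> min (V.dg a') (enat M) + 1"
      using g1 by (auto simp: min_def one_enat_def split: if_splits)
    also have "\<dots> \<le> V.dg (?d a')" using Suc.IH[OF a(2)] .
    finally have "?m + 1 \<le> V.dg (?d a') + V.dg ?x" using dgx by (rule add_mono)
    then have 2: "?m + 1 \<le> V.dg (?d a' \<otimes> ?x)" using V.dg_mult[of "?d a'" ?x] cs cl by simp
    have "?m \<le> V.dg a' + 1" using g1 by (rule min.coboundedI1)
    then have "?m + 1 \<le> V.dg a' + 1 + 1" by (rule add_right_mono)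
    then have "?m + 1 \<le> V.dg a' + 2" by (simp only: add.assoc one_add_one)
    also have "\<dots> \<le> V.dg (?s a') + V.dg (?d ?x)"
      using dg_\<sigma>_ge[OF cl(2)] \<delta>_x_ge[of l] step by (intro add_mono) auto
    finally have 3: "?m + 1 \<le> V.dg (?s a' \<otimes> ?d ?x)" using V.dg_mult[of "?s a'" "?d ?x"] cs by simp
    have c: "?d a' \<otimes> ?x \<in> C j" "?s a' \<otimes> ?d ?x \<in> C j"
      using V.m_closed[of "?d a'" ?x] V.m_closed[of "?s a'" "?d ?x"] cs cl by auto
    then have 4: "?m + 1 \<le> V.dg (?d a' \<otimes> ?x \<oplus> ?s a' \<otimes> ?d ?x)"
      using V.dg_add_ge[of "?d a' \<otimes> ?x" "?s a' \<otimes> ?d ?x"] 2 3 by simp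
    have "?d a' \<otimes> ?x \<oplus> ?s a' \<otimes> ?d ?x \<in> C j"
      using V.add.m_closed[of "?d a' \<otimes> ?x" "?s a' \<otimes> ?d ?x"] c by simp
    then show ?case unfolding da
      using V.dg_add_ge[of "?d a0" "?d a' \<otimes> ?x \<oplus> ?s a' \<otimes> ?d ?x"] 1 4 cs by simp
  qed
  show ?case
  proof (cases "V.dg a")
    case (enat m)
    then show ?thesis using main[of a m] step by simp
  next
    case infinity
    have "enat M \<le> V.dg (?d a)" for M
    proof -
      have "enat M \<le> enat M + 1" by (simp add: one_enat_def)
      also have "\<dots> \<le> V.dg (?d a)" using main[of a M] step infinity by simp
      finally show ?thesis .
    qed
    then have "V.dg (?d a) = \<infinity>" unfolding V.dg_infinite by (rule V.dg_all_imp_Infty)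
    then show ?thesis by simp
  qed
qed

lemma pval_skew_stage: "pval_skew (K j) N j (vv i j) (\<sigma> (Suc j)) (\<delta> (Suc j))"
proof
  fix a assume a: "a \<in> carrier (K j)"
  show "vv i j (\<sigma> (Suc j) a) = vv i j a"
    using \<sigma>_facts[OF jn] \<sigma>_ge[of j] ij a by (intro V.v_surj_endo) simp_all
  show "vdeg N (vv i j a) + 1 \<le> vdeg N (vv i j (\<delta> (Suc j) a))"
    using \<delta>_ge[of j a] ij a by (simp add: V.dg_def)
qed (use \<sigma>_facts[OF jn] \<delta>_facts[OF jn] in auto)

end

end

end

section \<open>The chain of prime ideals\<close>

lemma (in ring) ideal_pow_ideal: "ideal I R \<Longrightarrow> ideal (ideal_pow R I m) R"
  by (induction m) (auto simp: oneideal ideal_prod_is_ideal)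

lemma ideal_pow_mono:
  assumes "I \<subseteq> I'" "H \<subseteq> H'"
  shows "ideal_pow (R\<lparr>carrier := H\<rparr>) I m \<subseteq> ideal_pow (R\<lparr>carrier := H'\<rparr>) I' m"
proof (induction m)
  case (Suc m)
  have "a \<in> I' \<cdot>\<^bsub>R\<lparr>carrier := H'\<rparr>\<^esub> ideal_pow (R\<lparr>carrier := H'\<rparr>) I' m"
    if "a \<in> I \<cdot>\<^bsub>R\<lparr>carrier := H\<rparr>\<^esub> ideal_pow (R\<lparr>carrier := H\<rparr>) I m" for a
    using that
  proof (induction a rule: ideal_prod.induct)
    case (prod p q)
    then show ?case using ideal_prod.prod[of p I' q "ideal_pow (R\<lparr>carrier := H'\<rparr>) I' m" "R\<lparr>carrier := H'\<rparr>"]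
      assms Suc by auto
  next
    case (sum p q)
    then show ?case
      using ideal_prod.sum[of p "R\<lparr>carrier := H'\<rparr>" I' "ideal_pow (R\<lparr>carrier := H'\<rparr>) I' m" q] by simp
  qed
  then show ?case by auto
qed (use assms in auto)

section \<open>Completeness of the extension\<close>

context skew_ps_iso
begin

text \<open>Completeness is assumed for coefficient rings only, so it must be carried to the top of
  the tower. An element of degree \<open>m\<close> has a \<open>k\<close>-th coefficient of degree
  at least \<open>m - k\<close>: each coefficient converges at its own rate, and the factor
  \<open>x^k\<close> restores the missing \<open>k\<close>.\<close>

lemma complete_ext:
  assumes h: "\<And>m. h m \<in> carrier S"
    and d: "\<And>m. enat (m - t) \<le> vdeg N (extv N (Suc j) v c (h m))"
  shows "\<exists>q\<in>carrier S. \<forall>M. enat (M - t) \<le> vdeg N (extv N (Suc j) v c (q \<ominus>\<^bsub>S\<^esub> finsum S h {..<M}))"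
proof -
  have "pval_skew A N j v \<sigma> \<delta>" by unfold_locales
  moreover have "ideal_pow A (max_ideal A) m \<subseteq> {a \<in> carrier A. enat m \<le> vdeg N (v a)}" for m
    by (simp add: pow dg_def)
  ultimately interpret E: skew_ext A N j v \<sigma> \<delta> S c by (rule skew_extI)
  interpret W: pval S N "Suc j" "extv N (Suc j) v c" by (rule E.pval_ext)
  let ?w = "extv N (Suc j) v c"
  have dg_tail: "vdeg N (v a + Val (of_nat s * evec N (Suc j))) = dg a + enat s" if "a \<in> carrier A" for a s
  proof -
    have "v a \<in> Vals N (Suc j)" using Vals_mono[of j "Suc j" N] v_Vals that SjN by simp
    then show ?thesis using SjN
      by (subst vdeg_add[of _ N "Suc j"]) (auto simp: evec_mult_Gam of_nat_mult_evec_coeff dg_def)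
  qed
  have coef_dg: "enat (m - k) \<le> dg (c a k)" if "a \<in> carrier S" "enat m \<le> W.dg a" for a m k
  proof -
    have "v (c a k) \<in> Vals N (Suc j)" using Vals_mono[of j "Suc j" N] v_Vals c_closed that SjN by simp
    then have "W.dg a \<le> vdeg N (v (c a k) + Val (of_nat k * evec N (Suc j)))"
      unfolding W.dg_def using E.w_le[OF that(1), of k] E.w_Vals[OF that(1)] SjN
      by (intro vdeg_mono[of _ N "Suc j"]) (auto intro!: Vals_add evec_mult_Gam)
    then have "enat m \<le> dg (c a k) + enat k" using that(2) dg_tail[OF c_closed[OF that(1)]] by simp
    then show ?thesis by (cases "dg (c a k)") auto
  qed
  define P where "P = (\<lambda>M. finsum S h {..<M})"
  have Pc: "P M \<in> carrier S" for M unfolding P_def using h by (intro S.finsum_closed) auto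
  have P_Suc: "P (Suc M) = h M \<oplus>\<^bsub>S\<^esub> P M" for M
    unfolding P_def lessThan_Suc using h by (intro S.finsum_insert) auto
  have P_diff: "enat (M - t) \<le> W.dg (P (M + r) \<ominus>\<^bsub>S\<^esub> P M)" for M r
  proof (induction r)
    case 0
    then show ?case using Pc by (simp add: S.r_right_minus_eq[THEN iffD2])
  next
    case (Suc r)
    have "P (M + Suc r) \<ominus>\<^bsub>S\<^esub> P M = h (M + r) \<oplus>\<^bsub>S\<^esub> (P (M + r) \<ominus>\<^bsub>S\<^esub> P M)"
      using Pc h by (simp add: P_Suc S.minus_eq S.a_assoc)
    moreover have "enat (M - t) \<le> W.dg (h (M + r))"
      using d[of "M + r"] unfolding W.dg_def by (rule order_trans[rotated]) simp
    ultimately show ?case using Suc Pc h W.dg_add_ge by simp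
  qed
  define f where "f = (\<lambda>k M. c (P M) k)"
  have fc: "f k M \<in> carrier A" for k M unfolding f_def using c_closed Pc by blast
  have f_diff: "enat (M - t - k) \<le> dg (f k p \<ominus> f k M)" if "M \<le> p" for k M p
  proof -
    have "f k p \<ominus> f k M = c (P p \<ominus>\<^bsub>S\<^esub> P M) k" unfolding f_def using E.c_minus Pc by simp
    then show ?thesis using coef_dg[of "P p \<ominus>\<^bsub>S\<^esub> P M" "M - t" k] P_diff[of M "p - M"] Pc that by simp
  qed
  define q where "q = (\<lambda>k. adic_lim A (max_ideal A) (f k))"
  have conv: "adic_conv A (max_ideal A) (f k) (q k)" for k
    unfolding q_def
  proof (rule adic_cauchyI)
    fix m show "\<exists>M. \<forall>p\<ge>M. enat m \<le> dg (f k p \<ominus> f k M)"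
      using f_diff[of "m + t + k" _ k] by (intro exI[of _ "m + t + k"]) auto
  qed (rule fc)
  have qc: "q k \<in> carrier A" for k using conv by (simp add: adic_conv_def)
  have q_diff: "enat (M - t - k) \<le> dg (q k \<ominus> f k M)" for M k
  proof -
    obtain M' where M': "\<forall>p\<ge>M'. enat (M - t - k) \<le> dg (f k p \<ominus> q k)"
      using conv[of k] unfolding adic_conv_iff by blast
    define p where "p = max M M'"
    have "q k \<ominus> f k M = (f k p \<ominus> f k M) \<ominus> (f k p \<ominus> q k)"
      using minus_minus_cancel_left[OF qc fc fc] by simp
    then show ?thesis using M' f_diff[of M p k] qc fc
      dg_minus_ge[of "f k p \<ominus> f k M" "f k p \<ominus> q k" "enat (M - t - k)"] by (simp add: p_def)
  qed
  define Q where "Q = \<phi> q"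
  have q: "q \<in> carrier (skew_ps_ring A \<sigma> \<delta>)" using qc by (simp add: ps_carrier)
  then have Q: "Q \<in> carrier S" "c Q = q" by (auto simp: Q_def \<phi>_closed c_\<phi>)
  have "enat (M - t) \<le> vdeg N (?w (Q \<ominus>\<^bsub>S\<^esub> P M))" for M
  proof -
    let ?a = "Q \<ominus>\<^bsub>S\<^esub> P M"
    have ac: "?a \<in> carrier S" using Q Pc by simp
    obtain s where s: "?w ?a = v (c ?a s) + Val (of_nat s * evec N (Suc j))"
      using E.w_attained[OF ac] by blast
    have "c ?a s = q s \<ominus> f s M" using E.c_minus[OF Q(1) Pc] Q(2) by (simp add: f_def)
    then have "enat (M - t - s) \<le> dg (c ?a s)" using q_diff[of M s] by simp
    then have "enat (M - t - s) + enat s \<le> dg (c ?a s) + enat s" by (rule add_right_mono)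
    moreover have "enat (M - t) \<le> enat (M - t - s) + enat s" by simp
    ultimately have "enat (M - t) \<le> dg (c ?a s) + enat s" by (rule order_trans[rotated])
    then show ?thesis unfolding s dg_tail[OF c_closed[OF ac]] .
  qed
  then show ?thesis using Q(1) unfolding P_def by blast
qed

end

section \<open>Construction of the valuations by induction along the tower\<close>

context tower
begin

lemma max_ideal_0: "max_ideal (K 0) = {\<zero>}"
proof -
  interpret A: ring "K 0" using ring_K by simp
  have d: "\<zero> \<noteq> \<one>" "\<And>a. a \<in> C 0 \<Longrightarrow> a \<noteq> \<zero> \<Longrightarrow> a \<in> Units (K 0)"
    using C_division by (auto simp: division_ring_def)
  have "maximalideal {\<zero>\<^bsub>K 0\<^esub>} (K 0)"
  proof (rule maximalidealI)
    show "ideal {\<zero>\<^bsub>K 0\<^esub>} (K 0)" by (rule A.zeroideal)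
    show "carrier (K 0) \<noteq> {\<zero>\<^bsub>K 0\<^esub>}" using d(1) A.one_closed by auto
    fix J assume J: "ideal J (K 0)" "{\<zero>\<^bsub>K 0\<^esub>} \<subseteq> J" "J \<subseteq> carrier (K 0)"
    interpret J: ideal J "K 0" by fact
    show "J = {\<zero>\<^bsub>K 0\<^esub>} \<or> J = carrier (K 0)"
    proof (rule disjCI)
      assume "J \<noteq> carrier (K 0)"
      have "b = \<zero>\<^bsub>K 0\<^esub>" if b: "b \<in> J" for b
      proof (rule ccontr)
        assume "b \<noteq> \<zero>\<^bsub>K 0\<^esub>"
        then have U: "b \<in> Units (K 0)" using d(2)[of b] b J(3) by auto
        then have "\<one>\<^bsub>K 0\<^esub> \<in> J" using J.I_l_closed[OF b A.Units_inv_closed[OF U]] A.Units_l_inv[OF U] by metis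
        then show False using J.one_imp_carrier \<open>J \<noteq> carrier (K 0)\<close> by blast
      qed
      then show "J = {\<zero>\<^bsub>K 0\<^esub>}" using J(2) by blast
    qed
  qed
  moreover have "\<exists>!m. maximalideal m (K 0)"
    using complete_K[of 0] n_pos by (simp add: complete_local_def local_ring_def)
  ultimately have "(THE m. maximalideal m (K 0)) = {\<zero>\<^bsub>K 0\<^esub>}" by (intro the1_equality)
  then show ?thesis by (simp add: max_ideal_def)
qed

lemma pval_0: "pval (K 0) N 0 (vv 0 0)"
proof -
  interpret A: ring "K 0" using ring_K by simp
  have d: "\<zero> \<noteq> \<one>" "\<And>a. a \<in> C 0 \<Longrightarrow> a \<noteq> \<zero> \<Longrightarrow> a \<in> Units (K 0)"
    using C_division by (auto simp: division_ring_def)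
  have v: "vv 0 0 a = (if a = \<zero> then Infty else 0)" for a
    by (simp add: vv_base vbase_def max_ideal_0)
  have nz: "a \<otimes> b \<noteq> \<zero>" if "a \<in> C 0" "b \<in> C 0" "a \<noteq> \<zero>" "b \<noteq> \<zero>" for a b
  proof
    assume "a \<otimes> b = \<zero>"
    moreover have "inv\<^bsub>K 0\<^esub> a \<otimes> (a \<otimes> b) = b"
      using A.m_assoc[of "inv\<^bsub>K 0\<^esub> a" a b] A.Units_l_inv[of a] A.Units_inv_closed[of a] A.l_one[of b] d(2) that
      by simp
    ultimately show False using A.r_null[of "inv\<^bsub>K 0\<^esub> a"] A.Units_inv_closed[of a] d(2) that by simp
  qed
  show ?thesis
  proof
    fix a b assume ab: "a \<in> carrier (K 0)" "b \<in> carrier (K 0)"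
    show "min (vv 0 0 a) (vv 0 0 b) \<le> vv 0 0 (a \<oplus>\<^bsub>K 0\<^esub> b)"
      using ab A.l_zero[of b] by (auto simp: v min_def)
    show "vv 0 0 (a \<otimes>\<^bsub>K 0\<^esub> b) = vv 0 0 a + vv 0 0 b"
      using ab nz[of a b] A.l_null[of b] A.r_null[of a] by (auto simp: v)
    assume "vv 0 0 a = vv 0 0 b" "vv 0 0 b \<noteq> Infty"
    then have "a \<in> Units (K 0)" "b \<in> Units (K 0)" using ab d(2) by (auto simp: v split: if_splits)
    define u where "u = a \<otimes>\<^bsub>K 0\<^esub> inv\<^bsub>K 0\<^esub> b"
    have u: "u \<in> carrier (K 0)" using ab \<open>b \<in> Units (K 0)\<close> by (simp only: u_def A.m_closed A.Units_inv_closed)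
    have "u \<otimes>\<^bsub>K 0\<^esub> b = a"
      unfolding u_def using ab \<open>b \<in> Units (K 0)\<close> by (simp only: A.m_assoc A.Units_inv_closed A.Units_l_inv A.r_one)
    then have "a \<ominus>\<^bsub>K 0\<^esub> u \<otimes>\<^bsub>K 0\<^esub> b = \<zero>\<^bsub>K 0\<^esub>" using A.r_right_minus_eq[of a a] ab by simp
    then show "\<exists>u\<in>carrier (K 0). vv 0 0 b < vv 0 0 (a \<ominus>\<^bsub>K 0\<^esub> u \<otimes>\<^bsub>K 0\<^esub> b)"
      using u \<open>vv 0 0 b \<noteq> Infty\<close> by (intro bexI[of _ u]) (auto simp: v less_Infty_iff)
  qed (use d(1) in \<open>auto simp: v\<close>)
qed

text \<open>The adic and the degree filtration of \<open>K j\<close> coincide. Every level needs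
  this before the products of the next one can be estimated.\<close>

definition pow_ok :: "nat \<Rightarrow> bool" where
  "pow_ok j \<longleftrightarrow> (\<forall>m. ideal_pow (K j) (max_ideal (K j)) m = {a \<in> C j. enat m \<le> vdeg N (vv 0 j a)})"

lemma ideal_pow_le:
  assumes "j < n" "pval (K j) N j v"
  shows "ideal_pow (K j) (max_ideal (K j)) m \<subseteq> {a \<in> C j. enat m \<le> vdeg N (v a)}"
proof -
  interpret L: pval "K j" N j v by fact
  have "max_ideal (K j) \<subseteq> {a \<in> carrier (K j). 1 \<le> L.dg a}"
    using max_ideal_eq[OF assms] L.v_pos_iff by auto
  from L.ideal_pow_dg[OF this, of m] show ?thesis by (simp add: L.dg_def)
qed

lemma pow_ok_0: "pow_ok 0"
  unfolding pow_ok_def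
proof
  fix m
  interpret L: pval "K 0" N 0 "vv 0 0" by (rule pval_0)
  have n0: "0 < n" using n_pos by simp
  have I: "ideal (ideal_pow (K 0) (max_ideal (K 0)) m) (K 0)"
    using L.ideal_pow_ideal[OF L.zeroideal] by (simp add: max_ideal_0)
  show "ideal_pow (K 0) (max_ideal (K 0)) m = {a \<in> C 0. enat m \<le> vdeg N (vv 0 0 a)}"
  proof
    show "{a \<in> C 0. enat m \<le> vdeg N (vv 0 0 a)} \<subseteq> ideal_pow (K 0) (max_ideal (K 0)) m"
    proof (cases m)
      case (Suc m')
      have "a = \<zero>" if "enat m \<le> vdeg N (vv 0 0 a)" for a
        using that Suc by (auto simp: vv_base vbase_def max_ideal_0 zero_enat_def split: if_splits)
      then show ?thesis using additive_subgroup.zero_closed[OF ideal.axioms(1)[OF I]] by auto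
    qed auto
  qed (rule ideal_pow_le[OF n0 pval_0])
qed

lemma stage_iso:
  assumes j: "j < n" and good: "\<And>l. l \<le> j \<Longrightarrow> pval (K l) N l (vv 0 l)" and lv: "\<And>l. l < j \<Longrightarrow> level_ok l"
    and pow: "pow_ok j"
  shows "skew_ps_iso (K j) N j (vv 0 j) (\<sigma> (Suc j)) (\<delta> (Suc j)) (K (Suc j)) (phi j) (x (Suc j))"
proof -
  interpret L: pval_skew "K j" N j "vv 0 j" "\<sigma> (Suc j)" "\<delta> (Suc j)"
    using pval_skew_stage[of 0 j] j good lv by simp
  interpret S: ring "K (Suc j)" using ring_K j by simp
  show ?thesis
  proof
    show "ideal_pow (K j) (max_ideal (K j)) m = {a \<in> carrier (K j). enat m \<le> L.dg a}" for m
      using pow by (simp add: pow_ok_def L.dg_def)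
  qed (use j phi[OF j] complete_K skew_K in auto)
qed

lemma stage_level:
  assumes "skew_ps_iso (K j) N j (vv 0 j) (\<sigma> (Suc j)) (\<delta> (Suc j)) (K (Suc j)) (phi j) (x (Suc j))"
  shows "level_ok j" "skew_ps_iso.c (K j) (\<sigma> (Suc j)) (\<delta> (Suc j)) (phi j) = cf j"
proof -
  interpret L: skew_ps_iso "K j" N j "vv 0 j" "\<sigma> (Suc j)" "\<delta> (Suc j)" "K (Suc j)" "phi j" "x (Suc j)" by fact
  show c: "L.c = cf j" by (simp add: L.c_def cf_def)
  show "level_ok j"
    unfolding level_ok_def
  proof (intro conjI ballI allI)
    fix a s assume "a \<in> C (Suc j)" then show "cf j a s \<in> C j" using L.c_closed c by simp
  next
    fix a assume "a \<in> C j"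
    moreover have "ps_const (K j) = (ps_const R :: 'a \<Rightarrow> nat \<Rightarrow> 'a)" by (intro ext) (simp add: ps_const_def)
    ultimately show "cf j a = ps_const R a" using L.c_const[of a] c by simp
  next
    fix a assume "a \<in> C (Suc j)"
    then show "\<exists>a'\<in>C (Suc j). a = cf j a 0 \<oplus> a' \<otimes> x (Suc j) \<and> (\<forall>s. cf j a' s = cf j a (Suc s))"
      using L.split_off_constant[of a] c by simp
  next
    show "x (Suc j) \<in> C (Suc j)" using L.x_closed by simp
    have "ps_var (K j) = (ps_var R :: nat \<Rightarrow> 'a)" by (intro ext) (simp add: ps_var_def)
    then show "cf j (x (Suc j)) = ps_var R" using L.c_var c by simp
    show "C j \<subseteq> C (Suc j)" using L.const_closed by simp
    show "inj_on (cf j) (C (Suc j))" using L.c_inj c by (auto intro: inj_onI)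
  qed
qed

lemma stage_pval:
  assumes iso: "skew_ps_iso (K j) N j (vv 0 j) (\<sigma> (Suc j)) (\<delta> (Suc j)) (K (Suc j)) (phi j) (x (Suc j))"
    and ij: "i \<le> j" "j < n" and sk: "pval_skew (K j) N j (vv i j) (\<sigma> (Suc j)) (\<delta> (Suc j))"
  shows "pval (K (Suc j)) N (Suc j) (vv i (Suc j))"
proof -
  interpret L: skew_ps_iso "K j" N j "vv 0 j" "\<sigma> (Suc j)" "\<delta> (Suc j)" "K (Suc j)" "phi j" "x (Suc j)" by fact
  interpret L': pval_skew "K j" N j "vv i j" "\<sigma> (Suc j)" "\<delta> (Suc j)" by fact
  have "pval (K j) N j (vv i j)" by unfold_locales
  then have "skew_ext (K j) N j (vv i j) (\<sigma> (Suc j)) (\<delta> (Suc j)) (K (Suc j)) L.c"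
    using ideal_pow_le[OF ij(2)] by (intro L.skew_extI sk) simp
  from skew_ext.pval_ext[OF this] show ?thesis using ij stage_level(2)[OF iso] by (simp add: vv_Suc)
qed

text \<open>An element of degree \<open>m + 1\<close> splits into a constant of degree at least
  \<open>m + 1\<close>, covered by the previous level, and a multiple \<open>a' x\<close> with
  \<open>a'\<close> of degree at least \<open>m\<close>. Only one splitting is needed, since
  \<open>a'\<close> falls under the induction on \<open>m\<close>.\<close>

lemma pow_ok_Suc:
  assumes j: "Suc j < n" and pow: "pow_ok j" and lv: "level_ok j"
    and V: "pval (K j) N j (vv 0 j)" and W: "pval (K (Suc j)) N (Suc j) (vv 0 (Suc j))"
  shows "pow_ok (Suc j)"
proof -
  interpret V: pval "K j" N j "vv 0 j" by fact
  interpret W: pval "K (Suc j)" N "Suc j" "vv 0 (Suc j)" by fact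
  let ?S = "K (Suc j)" and ?m = "max_ideal (K (Suc j))"
  have mW: "?m = {a \<in> C (Suc j). 0 < vv 0 (Suc j) a}" using max_ideal_eq[OF j W] .
  have mV: "max_ideal (K j) = {a \<in> C j. 0 < vv 0 j a}" using max_ideal_eq[OF _ V] j by simp
  have CC: "C j \<subseteq> C (Suc j)" and xc: "x (Suc j) \<in> C (Suc j)" using lv by (auto simp: level_ok_def)
  have jn: "j < n" using j by simp
  have const: "vv 0 (Suc j) a = vv 0 j a" if "a \<in> C j" for a using vv_const[OF _ jn V lv that] by simp
  have mm: "max_ideal (K j) \<subseteq> ?m" using CC const by (auto simp: mV mW)
  have I: "ideal (ideal_pow ?S ?m m) ?S" for m
    using W.ideal_pow_ideal[OF W.ideal_pos] mW by simp
  have dgx: "1 \<le> W.dg (x (Suc j))" using vv_x_pos[of 0 j, OF _ jn V lv] W.v_pos_iff xc by simp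
  have le: "{a \<in> C (Suc j). enat m \<le> W.dg a} \<subseteq> ideal_pow ?S ?m m" for m
  proof (induction m)
    case 0
    then show ?case by auto
  next
    case (Suc m)
    have eq: "ideal_pow ?S ?m m = {a \<in> C (Suc j). enat m \<le> W.dg a}"
      using Suc ideal_pow_le[OF j W, of m] by (auto simp: W.dg_def)
    \<comment> \<open>Powers grow by factors on the left, but \<open>x\<close> stands on the right.
      In a product \<open>p q\<close> the factor \<open>q x\<close> has degree at least
      \<open>m\<close>, hence lies in the \<open>m\<close>-th power by \<open>eq\<close>, and
      \<open>p\<close> supplies the additional factor.\<close>
    have times_x: "a \<otimes> x (Suc j) \<in> ideal_pow ?S ?m (Suc m)" if a: "a \<in> ideal_pow ?S ?m m" for a
    proof (cases m)
      case 0
      have "a \<in> C (Suc j)" using a 0 by simp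
      then have ax: "a \<otimes> x (Suc j) \<in> C (Suc j)" using W.m_closed[of a "x (Suc j)"] xc by simp
      have "1 \<le> W.dg (a \<otimes> x (Suc j))"
        using W.dg_mult[of a "x (Suc j)"] \<open>a \<in> C (Suc j)\<close> xc dgx by (simp add: add_increasing)
      then have "a \<otimes> x (Suc j) \<in> ?m" using ax W.v_pos_iff[of "a \<otimes> x (Suc j)"] by (simp add: mW)
      then have "(a \<otimes> x (Suc j)) \<otimes>\<^bsub>?S\<^esub> \<one>\<^bsub>?S\<^esub> \<in> ?m \<cdot>\<^bsub>?S\<^esub> carrier ?S"
        using W.one_closed by (rule ideal_prod.prod)
      then show ?thesis using 0 ax W.r_one[of "a \<otimes> x (Suc j)"] by simp
    next
      case (Suc m')
      then have "a \<in> ?m \<cdot>\<^bsub>?S\<^esub> ideal_pow ?S ?m m'" using a by simp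
      then have "a \<otimes> x (Suc j) \<in> ?m \<cdot>\<^bsub>?S\<^esub> ideal_pow ?S ?m m \<and> a \<in> C (Suc j)"
      proof (induction a rule: ideal_prod.induct)
        case (prod p q)
        have pq: "p \<in> C (Suc j)" "q \<in> C (Suc j)" "enat m' \<le> W.dg q"
          using prod mW ideal_pow_le[OF j W, of m'] by (auto simp: W.dg_def)
        then have qx: "q \<otimes> x (Suc j) \<in> C (Suc j)" using W.m_closed[of q "x (Suc j)"] xc by simp
        have "enat m' + 1 \<le> W.dg q + W.dg (x (Suc j))" using pq(3) dgx by (rule add_mono)
        then have "enat m \<le> W.dg (q \<otimes> x (Suc j))"
          using W.dg_mult[of q "x (Suc j)"] pq xc Suc by (simp add: one_enat_def)
        then have "q \<otimes> x (Suc j) \<in> ideal_pow ?S ?m m" using qx eq by simp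
        then have "p \<otimes>\<^bsub>?S\<^esub> (q \<otimes> x (Suc j)) \<in> ?m \<cdot>\<^bsub>?S\<^esub> ideal_pow ?S ?m m"
          by (rule ideal_prod.prod[OF prod(1)])
        then show ?case using W.m_assoc[of p q "x (Suc j)"] W.m_closed[of p q] pq xc by simp
      next
        case (sum p q)
        then have "p \<otimes> x (Suc j) \<oplus>\<^bsub>?S\<^esub> q \<otimes> x (Suc j) \<in> ?m \<cdot>\<^bsub>?S\<^esub> ideal_pow ?S ?m m"
          by (intro ideal_prod.sum) auto
        then show ?case using W.l_distr[of p q "x (Suc j)"] W.add.m_closed[of p q] sum xc by simp
      qed
      then show ?thesis by simp
    qed
    show ?case
    proof
      fix a assume "a \<in> {a \<in> C (Suc j). enat (Suc m) \<le> W.dg a}"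
      then have a: "a \<in> C (Suc j)" "enat (Suc m) \<le> W.dg a" by auto
      obtain a0 a' where s: "a0 \<in> C j" "a' \<in> C (Suc j)" "a = a0 \<oplus> a' \<otimes> x (Suc j)"
        "vv 0 (Suc j) a \<le> vv 0 j a0" "vv 0 (Suc j) a \<le> vv 0 (Suc j) a' + Val (evec N (Suc j))"
        using vv_split[OF _ jn V lv a(1)] by auto
      have a0S: "a0 \<in> C (Suc j)" using s CC by auto
      have "W.dg a \<le> vdeg N (vv 0 j a0)" unfolding W.dg_def
        using s(4) W.v_Vals[of a] W.v_Vals[of a0] a(1) a0S const[OF s(1)] jn
        by (intro vdeg_mono[of _ N "Suc j"]) auto
      then have "enat (Suc m) \<le> vdeg N (vv 0 j a0)" using a(2) by (rule order_trans[rotated])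
      then have "a0 \<in> {a \<in> C j. enat (Suc m) \<le> vdeg N (vv 0 j a)}" using s(1) by blast
      then have "a0 \<in> ideal_pow (K j) (max_ideal (K j)) (Suc m)"
        using pow unfolding pow_ok_def by blast
      then have 1: "a0 \<in> ideal_pow ?S ?m (Suc m)"
        using ideal_pow_mono[OF mm CC, of R "Suc m"] by blast
      have e: "Val (evec N (Suc j)) \<in> Vals N (Suc j)" using jn by (auto intro: evec_Gam)
      have "W.dg a \<le> vdeg N (vv 0 (Suc j) a' + Val (evec N (Suc j)))" unfolding W.dg_def
        using s(5) W.v_Vals[of a] W.v_Vals[of a'] a(1) s(2) e jn
        by (intro vdeg_mono[of _ N "Suc j"] Vals_add) auto
      also have "\<dots> = W.dg a' + 1"
        using W.v_Vals[of a'] s(2) e jn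
        by (subst vdeg_add[of _ N "Suc j"]) (auto simp: evec_coeff one_enat_def W.dg_def)
      finally have "enat (Suc m) \<le> W.dg a' + 1" using a(2) by (rule order_trans[rotated])
      then have "enat m \<le> W.dg a'" by (cases "W.dg a'") (auto simp: one_enat_def)
      then have "a' \<otimes> x (Suc j) \<in> ideal_pow ?S ?m (Suc m)" using times_x eq s(2) by simp
      then have "a0 \<oplus>\<^bsub>?S\<^esub> a' \<otimes> x (Suc j) \<in> ideal_pow ?S ?m (Suc m)"
        using additive_subgroup.a_closed[OF ideal.axioms(1)[OF I] 1] by blast
      then show "a \<in> ideal_pow ?S ?m (Suc m)" using s(3) by simp
    qed
  qed
  show ?thesis unfolding pow_ok_def
    using le ideal_pow_le[OF j W] by (auto simp: W.dg_def)
qed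

text \<open>The three claims cannot be separated: products at the next level are controlled through
  \<open>pow_ok\<close>, coefficients through products, and valuations through coefficients.
  \<open>pow_ok\<close> stops below \<open>n\<close> because only those levels are assumed to be
  local.\<close>

lemma base_zero:
  "j \<le> n \<Longrightarrow> (\<forall>l\<le>j. pval (K l) N l (vv 0 l)) \<and> (\<forall>l<j. level_ok l) \<and> (\<forall>l\<le>j. l < n \<longrightarrow> pow_ok l)"
proof (induction j)
  case 0
  then show ?case using pval_0 pow_ok_0 by simp
next
  case (Suc j)
  then have IH: "\<And>l. l \<le> j \<Longrightarrow> pval (K l) N l (vv 0 l)" "\<And>l. l < j \<Longrightarrow> level_ok l" "pow_ok j"
    and rest: "\<forall>l\<le>j. l < n \<longrightarrow> pow_ok l" and j: "j < n" by auto
  have iso: "skew_ps_iso (K j) N j (vv 0 j) (\<sigma> (Suc j)) (\<delta> (Suc j)) (K (Suc j)) (phi j) (x (Suc j))"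
    by (rule stage_iso) (use IH j in auto)
  have sk: "pval_skew (K j) N j (vv 0 j) (\<sigma> (Suc j)) (\<delta> (Suc j))"
    using pval_skew_stage[of 0 j] j IH by simp
  have P: "pval (K (Suc j)) N (Suc j) (vv 0 (Suc j))" using stage_pval[OF iso _ j sk] by simp
  have L: "level_ok j" using stage_level[OF iso] by simp
  have "pow_ok (Suc j)" if "Suc j < n" using pow_ok_Suc[OF that IH(3) L IH(1)[OF order_refl] P] .
  then show ?case using IH(1,2) P L rest by (auto simp: le_Suc_eq less_Suc_eq)
qed

lemma pval_zero: "j \<le> n \<Longrightarrow> pval (K j) N j (vv 0 j)"
  and level: "l < n \<Longrightarrow> level_ok l"
  and pow: "l < n \<Longrightarrow> pow_ok l"
  using base_zero[of n] by auto

lemma iso: "j < n \<Longrightarrow>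
    skew_ps_iso (K j) N j (vv 0 j) (\<sigma> (Suc j)) (\<delta> (Suc j)) (K (Suc j)) (phi j) (x (Suc j))"
  by (rule stage_iso) (use pval_zero level pow in auto)

text \<open>The complement of the maximal ideal consists of the elements of value zero for
  \<open>vv 0 i\<close>. Additivity of values makes that ideal completely prime, and
  \<open>v_unit\<close> at value zero gives division in the quotient.\<close>

lemma pval_vbase: assumes "i < n" shows "pval (K i) N i (vbase i)"
proof -
  interpret V: pval "K i" N i "vv 0 i" using pval_zero assms by simp
  have v: "vbase i a = (if 0 < vv 0 i a then Infty else 0)" if "a \<in> C i" for a
    using max_ideal_eq[OF assms V.pval_axioms] that by (simp add: vbase_def)
  show ?thesis
  proof
    fix a b assume ab: "a \<in> carrier (K i)" "b \<in> carrier (K i)"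
    have cl: "a \<oplus> b \<in> C i" "a \<otimes> b \<in> C i" using V.add.m_closed[OF ab] V.m_closed[OF ab] by auto
    show "min (vbase i a) (vbase i b) \<le> vbase i (a \<oplus>\<^bsub>K i\<^esub> b)"
      using ab cl V.v_add_gt[OF ab, of 0] by (auto simp: v min_def)
    show "vbase i (a \<otimes>\<^bsub>K i\<^esub> b) = vbase i a + vbase i b"
    proof -
      have "vv 0 i (a \<otimes> b) = vv 0 i a + vv 0 i b" using V.v_mult[OF ab] by simp
      moreover have "0 \<le> vv 0 i a" "0 \<le> vv 0 i b" using V.v_nonneg ab by auto
      ultimately have "0 < vv 0 i (a \<otimes> b) \<longleftrightarrow> 0 < vv 0 i a \<or> 0 < vv 0 i b"
        by (cases "vv 0 i a"; cases "vv 0 i b") (auto simp: zero_val_def add_pos_nonneg add_nonneg_pos)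
      then show ?thesis using ab cl by (simp add: v)
    qed
    assume "vbase i a = vbase i b" "vbase i b \<noteq> Infty"
    then have "vv 0 i a = 0" "vv 0 i b = 0"
      using ab V.v_nonneg[OF ab(1)] V.v_nonneg[OF ab(2)] by (auto simp: v split: if_splits)
    then obtain u where u: "u \<in> carrier (K i)" "0 < vv 0 i (a \<ominus>\<^bsub>K i\<^esub> u \<otimes>\<^bsub>K i\<^esub> b)"
      using V.v_unit[OF ab] by auto
    then have "vbase i (a \<ominus>\<^bsub>K i\<^esub> u \<otimes>\<^bsub>K i\<^esub> b) = Infty"
      using v[of "a \<ominus>\<^bsub>K i\<^esub> u \<otimes>\<^bsub>K i\<^esub> b"] V.minus_closed[OF ab(1) V.m_closed[OF u(1) ab(2)]] by simp
    then show "\<exists>u\<in>carrier (K i). vbase i b < vbase i (a \<ominus>\<^bsub>K i\<^esub> u \<otimes>\<^bsub>K i\<^esub> b)"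
      using u(1) \<open>vbase i b \<noteq> Infty\<close> by (intro bexI[of _ u]) (auto simp: less_Infty_iff)
  qed (use assms V.zero_closed V.one_closed V.v_zero V.v_one in \<open>auto simp: v less_Infty_iff\<close>)
qed

lemma pval_vv: "i < n \<Longrightarrow> i \<le> j \<Longrightarrow> j \<le> n \<Longrightarrow> pval (K j) N j (vv i j)"
proof (induction j rule: less_induct)
  case (less j)
  show ?case
  proof (cases "i = j")
    case True
    then show ?thesis using pval_vbase less.prems by (simp add: vv_base)
  next
    case False
    then obtain j' where j': "j = Suc j'" "i \<le> j'" "j' < n" using less.prems by (cases j) auto
    have "pval_skew (K j') N j' (vv i j') (\<sigma> (Suc j')) (\<delta> (Suc j'))"
      by (rule pval_skew_stage) (use j' less level in auto)
    then show ?thesis using stage_pval[OF iso] j' by simp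
  qed
qed

text \<open>The last member is described by positive values instead of an infinite value: the base
  valuation at level \<open>n\<close> would refer to a maximal ideal whose uniqueness is not among
  the assumptions.\<close>

definition chain :: "nat \<Rightarrow> 'a set" where
  "chain i = (if i < n then {a \<in> carrier R. vv i n a = Infty} else {a \<in> carrier R. 0 < vv (n - 1) n a})"

lemma prime_chain: "prime_ideal (chain i) R"
proof -
  have g: "pval R N n (vv l n)" if "l < n" for l
    using pval_vv[of l n] that K_n by simp
  show ?thesis
  proof (cases "i < n")
    case True
    then show ?thesis using pval.prime_ideal_Infty[OF g[OF True]] by (simp add: chain_def)
  next
    case False
    have "n - 1 < n" using n_pos by simp
    from pval.prime_ideal_pos[OF g[OF this]] False show ?thesis by (simp add: chain_def)
  qed
qed

text \<open>At level \<open>Suc i\<close> an infinite value is positive, hence puts the element into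
  the maximal ideal, the support of the next valuation. Above that level supports are compared
  coefficient by coefficient.\<close>

lemma vv_Infty_Suc:
  assumes "Suc i < n" "Suc i \<le> j" "j \<le> n" "a \<in> C j" "vv i j a = Infty"
  shows "vv (Suc i) j a = Infty"
  using assms(2,3,4,5)
proof (induction j arbitrary: a rule: dec_induct)
  case base
  then have "a \<in> max_ideal (K (Suc i))"
    using max_ideal_eq[OF assms(1) pval_vv[of i "Suc i"]] assms(1) by (simp add: zero_val_def)
  then show ?case by (simp add: vv_base vbase_def)
next
  case (step j)
  have lv: "level_ok j" using level step by simp
  have "vv i j (cf j a s) = Infty" for s
    using vv_ext(2)[of i j a s] pval_vv[of i j] lv step assms(1) by simp
  then have "vv (Suc i) j (cf j a s) = Infty" for s
    using step lv by (simp add: level_ok_def)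
  then show ?case using vv_ext(1)[of "Suc i" j a] pval_vv[of "Suc i" j] lv step assms(1) by auto
qed

lemma vv_x_finite: assumes "i < n" shows "vv i n (x (Suc i)) \<noteq> Infty" "0 < vv i n (x (Suc i))"
    "x (Suc i) \<in> carrier R"
proof -
  have lv: "level_ok i" using level assms by simp
  have xc: "x (Suc i) \<in> C (Suc i)" "cf i (x (Suc i)) = ps_var R" using lv by (auto simp: level_ok_def)
  have g: "pval (K i) N i (vv i i)" using pval_vv assms by simp
  interpret L: pval "K i" N i "vv i i" by fact
  have "vv i (Suc i) (x (Suc i)) \<le> vv i i \<one> + Val (of_nat 1 * evec N (Suc i))"
    using vv_ext(2)[OF order_refl assms g lv xc(1), of 1] by (simp add: xc(2) ps_var_def)
  then have "vv i (Suc i) (x (Suc i)) \<noteq> Infty" using L.v_one by (auto simp: zero_val_def)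
  moreover have "vv i n (x (Suc i)) = vv i (Suc i) (x (Suc i))"
    by (rule vv_const_le) (use assms pval_vv level xc in auto)
  ultimately show "vv i n (x (Suc i)) \<noteq> Infty" "0 < vv i n (x (Suc i))"
    using vv_x_pos[OF order_refl assms g lv] by auto
  show "x (Suc i) \<in> carrier R" using C_mono[of "Suc i" n] level assms xc C_n by auto
qed

text \<open>The variable \<open>x (Suc i)\<close> separates the two: its value for
  \<open>vv i\<close> is finite but positive, and positivity places it in the next member.\<close>

lemma chain_strict: assumes "i < n" shows "chain i \<subset> chain (Suc i)"
proof (cases "Suc i < n")
  case True
  have "chain i \<subseteq> chain (Suc i)" using vv_Infty_Suc[OF True, of n] True by (auto simp: chain_def C_n)
  moreover have "x (Suc i) \<notin> chain i" using vv_x_finite[OF assms] assms by (simp add: chain_def)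
  moreover have "x (Suc i) \<in> chain (Suc i)"
  proof -
    have lv: "level_ok i" using level assms by simp
    have xc: "x (Suc i) \<in> C (Suc i)" using lv by (auto simp: level_ok_def)
    have "x (Suc i) \<in> max_ideal (K (Suc i))"
      using max_ideal_eq[OF True pval_vv[of i "Suc i"]] vv_x_pos[OF order_refl assms _ lv]
        pval_vv[of i i] xc assms by simp
    then have "vv (Suc i) (Suc i) (x (Suc i)) = Infty" by (simp add: vv_base vbase_def)
    moreover have "vv (Suc i) n (x (Suc i)) = vv (Suc i) (Suc i) (x (Suc i))"
      by (rule vv_const_le) (use assms True pval_vv level xc in auto)
    ultimately show ?thesis using vv_x_finite[OF assms] True by (simp add: chain_def)
  qed
  ultimately show ?thesis by blast
next
  case False
  then have n: "n = Suc i" using assms by simp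
  then have n1: "n - 1 = i" by simp
  have "chain i = {a \<in> carrier R. vv i n a = Infty}" unfolding chain_def using assms by simp
  moreover have "chain (Suc i) = {a \<in> carrier R. 0 < vv i n a}" unfolding chain_def n1 using False by simp
  ultimately show ?thesis using vv_x_finite[OF assms] by (auto simp: zero_val_def)
qed

lemma krull_dim_ge: "enat n \<le> krull_dim R"
  unfolding krull_dim_def
  by (rule Sup_upper) (use prime_chain chain_strict in blast)

lemma vv_Infty_iff: "j \<le> n \<Longrightarrow> a \<in> C j \<Longrightarrow> vv 0 j a = Infty \<Longrightarrow> a = \<zero>"
proof (induction j arbitrary: a)
  case 0
  then show ?case by (simp add: vv_base vbase_def max_ideal_0 split: if_splits)
next
  case (Suc j)
  have lv: "level_ok j" and g: "pval (K j) N j (vv 0 j)" using level pval_zero Suc by auto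
  interpret V: pval "K j" N j "vv 0 j" by fact
  have "vv 0 j (cf j a s) = Infty" for s
    using vv_ext(2)[of 0 j a s] g lv Suc by simp
  then have "cf j a s = \<zero>" for s using Suc lv by (simp add: level_ok_def)
  moreover have "cf j \<zero> = ps_const R \<zero>" using lv V.zero_closed by (simp add: level_ok_def)
  ultimately have "cf j a = cf j \<zero>" by (auto simp: ps_const_def)
  moreover have "\<zero> \<in> C (Suc j)" using lv V.zero_closed by (auto simp: level_ok_def)
  ultimately show ?case using lv Suc.prems by (auto simp: level_ok_def dest: inj_onD)
qed

lemma complete_R:
  assumes "\<And>m. h m \<in> carrier R" "\<And>m. enat (m - t) \<le> vdeg N (vv 0 n (h m))"
  shows "\<exists>q\<in>carrier R. \<forall>M. enat (M - t) \<le> vdeg N (vv 0 n (q \<ominus> finsum R h {..<M}))"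
proof -
  obtain j where j: "n = Suc j" using n_pos by (cases n) auto
  have i: "skew_ps_iso (K j) N j (vv 0 j) (\<sigma> (Suc j)) (\<delta> (Suc j)) (K (Suc j)) (phi j) (x (Suc j))"
    using iso j by simp
  have e: "vv 0 (Suc j) = extv N (Suc j) (vv 0 j) (cf j)" by (rule vv_Suc) simp
  have eq: "vv 0 n = vv 0 (Suc j)" by (rule arg_cong[OF j])
  have KR: "K (Suc j) = R" using K_n arg_cong[OF j, of "\<lambda>i. K i"] by metis
  note * = skew_ps_iso.complete_ext[OF i, of h t, unfolded stage_level(2)[OF i] KR e[symmetric] eq[symmetric]]
  show ?thesis by (rule *) (use assms in auto)
qed

end

section \<open>Regular elements modulo a prime ideal\<close>

context ring
begin

lemma left_idealI:
  assumes "I \<subseteq> carrier R" "\<zero> \<in> I" "\<And>a b. a \<in> I \<Longrightarrow> b \<in> I \<Longrightarrow> a \<oplus> b \<in> I"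
    "\<And>r a. r \<in> carrier R \<Longrightarrow> a \<in> I \<Longrightarrow> r \<otimes> a \<in> I"
  shows "left_ideal I R"
proof -
  have "\<ominus> a \<in> I" if "a \<in> I" for a
  proof -
    have "\<ominus> a = \<ominus> \<one> \<otimes> a" using assms(1) that by (simp add: l_minus subsetD)
    then show ?thesis using assms(4)[of "\<ominus> \<one>" a] that by simp
  qed
  then have "subgroup I (add_monoid R)"
    using assms by unfold_locales (auto simp: a_inv_def)
  then show ?thesis using assms(4) by (simp add: left_ideal_def additive_subgroup_def)
qed

lemma left_idealD:
  assumes "left_ideal I R"
  shows "I \<subseteq> carrier R" "\<zero> \<in> I" "a \<in> I \<Longrightarrow> b \<in> I \<Longrightarrow> a \<oplus> b \<in> I"
    "r \<in> carrier R \<Longrightarrow> a \<in> I \<Longrightarrow> r \<otimes> a \<in> I" "a \<in> I \<Longrightarrow> b \<in> I \<Longrightarrow> a \<ominus> b \<in> I"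
proof -
  interpret I: additive_subgroup I R using assms by (simp add: left_ideal_def)
  show "I \<subseteq> carrier R" "\<zero> \<in> I" "a \<in> I \<Longrightarrow> b \<in> I \<Longrightarrow> a \<oplus> b \<in> I"
    "r \<in> carrier R \<Longrightarrow> a \<in> I \<Longrightarrow> r \<otimes> a \<in> I"
    using I.a_subset assms by (auto simp: left_ideal_def)
  show "a \<in> I \<Longrightarrow> b \<in> I \<Longrightarrow> a \<ominus> b \<in> I" by (simp add: minus_eq)
qed

lemma ideal_left: "ideal I R \<Longrightarrow> left_ideal I R"
  by (simp add: left_ideal_def ideal.axioms(1) ideal.I_l_closed)

lemma ideal_closureI:
  assumes "I \<subseteq> carrier R" "\<zero> \<in> I" "\<And>a b. a \<in> I \<Longrightarrow> b \<in> I \<Longrightarrow> a \<oplus> b \<in> I"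
    "\<And>r a. r \<in> carrier R \<Longrightarrow> a \<in> I \<Longrightarrow> r \<otimes> a \<in> I"
    "\<And>r a. r \<in> carrier R \<Longrightarrow> a \<in> I \<Longrightarrow> a \<otimes> r \<in> I"
  shows "ideal I R"
  using left_idealI[OF assms(1-4)] assms(5)
  by (intro idealI ring_axioms) (auto simp: left_ideal_def additive_subgroup_def)

definition lin_comb :: "nat \<Rightarrow> (nat \<Rightarrow> 'a) \<Rightarrow> (nat \<Rightarrow> 'a) \<Rightarrow> 'a" where
  "lin_comb r g Q = finsum R (\<lambda>i. Q i \<otimes> g i) {..<r}"

lemma lin_comb_closed:
  "(\<And>i. i < r \<Longrightarrow> g i \<in> carrier R) \<Longrightarrow> (\<And>i. Q i \<in> carrier R) \<Longrightarrow> lin_comb r g Q \<in> carrier R"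
  unfolding lin_comb_def by (intro finsum_closed) auto

lemma lin_comb_add:
  assumes "\<And>i. i < r \<Longrightarrow> g i \<in> carrier R" "\<And>i. A i \<in> carrier R" "\<And>i. B i \<in> carrier R"
  shows "lin_comb r g (\<lambda>i. A i \<oplus> B i) = lin_comb r g A \<oplus> lin_comb r g B"
proof -
  have "lin_comb r g (\<lambda>i. A i \<oplus> B i) = finsum R (\<lambda>i. A i \<otimes> g i \<oplus> B i \<otimes> g i) {..<r}"
    unfolding lin_comb_def using assms by (intro finsum_cong') (auto simp: l_distr)
  also have "\<dots> = lin_comb r g A \<oplus> lin_comb r g B"
    unfolding lin_comb_def using assms by (intro finsum_addf) auto
  finally show ?thesis .
qed

lemma lin_comb_minus:
  assumes "\<And>i. i < r \<Longrightarrow> g i \<in> carrier R" "\<And>i. A i \<in> carrier R" "\<And>i. B i \<in> carrier R"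
  shows "lin_comb r g A \<ominus> lin_comb r g B = lin_comb r g (\<lambda>i. A i \<ominus> B i)"
proof -
  have "lin_comb r g A = lin_comb r g (\<lambda>i. (A i \<ominus> B i) \<oplus> B i)"
    using assms(2,3) by (simp add: a_minus_def a_assoc l_neg)
  also have "\<dots> = lin_comb r g (\<lambda>i. A i \<ominus> B i) \<oplus> lin_comb r g B"
    using assms by (intro lin_comb_add) auto
  finally show ?thesis
    using lin_comb_closed[of r g B] lin_comb_closed[of r g "\<lambda>i. A i \<ominus> B i"] assms
    by (simp add: a_minus_def a_assoc r_neg)
qed

lemma lin_comb_zero:
  assumes "\<And>i. i < r \<Longrightarrow> g i \<in> carrier R" shows "lin_comb r g (\<lambda>_. \<zero>) = \<zero>"
proof -
  have "lin_comb r g (\<lambda>_. \<zero>) = finsum R (\<lambda>_. \<zero>) {..<r}"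
    unfolding lin_comb_def using assms by (intro finsum_cong') auto
  then show ?thesis by simp
qed

lemma lin_comb_single:
  assumes "\<And>i. i < r \<Longrightarrow> g i \<in> carrier R" "k < r" "u \<in> carrier R"
  shows "lin_comb r g (\<lambda>i. if i = k then u else \<zero>) = u \<otimes> g k"
proof -
  have "lin_comb r g (\<lambda>i. if i = k then u else \<zero>) = (if k = k then u else \<zero>) \<otimes> g k"
    unfolding lin_comb_def using assms by (intro finsum_eq_single) auto
  then show ?thesis by simp
qed

lemma lin_comb_left_ideal:
  assumes "left_ideal L R" "\<And>i. i < r \<Longrightarrow> g i \<in> L" "\<And>i. Q i \<in> carrier R"
  shows "lin_comb r g Q \<in> L"
  using assms(2)
proof (induction r)
  case 0
  then show ?case using left_idealD(2)[OF assms(1)] by (simp add: lin_comb_def)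
next
  case (Suc r)
  have gc: "g i \<in> carrier R" if "i < Suc r" for i using Suc.prems left_idealD(1)[OF assms(1)] that by blast
  have "lin_comb (Suc r) g Q = Q r \<otimes> g r \<oplus> lin_comb r g Q"
    unfolding lin_comb_def lessThan_Suc using gc assms(3) by (intro finsum_insert) auto
  then show ?case using Suc left_idealD(3,4)[OF assms(1)] assms(3) by simp
qed

text \<open>Two residual ideals are used in turn. The condition \<open>a r y \<in> P\<close> passes
  from \<open>b\<close> to the ideal \<open>B\<close> it generates, and then
  \<open>z B \<subseteq> P\<close> passes from \<open>a\<close> to the ideal it generates.\<close>

lemma prime_ideal_elementwise:
  assumes P: "prime_ideal P R" and a: "a \<in> carrier R" and b: "b \<in> carrier R"
    and ab: "\<And>r. r \<in> carrier R \<Longrightarrow> a \<otimes> r \<otimes> b \<in> P"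
  shows "a \<in> P \<or> b \<in> P"
proof -
  interpret P: ideal P R using P by (simp add: prime_ideal_def)
  have 1: "ideal {y \<in> carrier R. \<forall>r\<in>carrier R. a \<otimes> r \<otimes> y \<in> P} R"
  proof (rule ideal_closureI)
    fix s y assume s: "s \<in> carrier R" and y: "y \<in> {y \<in> carrier R. \<forall>r\<in>carrier R. a \<otimes> r \<otimes> y \<in> P}"
    have "a \<otimes> r \<otimes> (s \<otimes> y) = a \<otimes> (r \<otimes> s) \<otimes> y" if "r \<in> carrier R" for r
      using a s y that by (simp add: m_assoc)
    then show "s \<otimes> y \<in> {y \<in> carrier R. \<forall>r\<in>carrier R. a \<otimes> r \<otimes> y \<in> P}" using y s by simp
    have "a \<otimes> r \<otimes> (y \<otimes> s) = (a \<otimes> r \<otimes> y) \<otimes> s" if "r \<in> carrier R" for r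
      using a s y that by (simp add: m_assoc)
    then show "y \<otimes> s \<in> {y \<in> carrier R. \<forall>r\<in>carrier R. a \<otimes> r \<otimes> y \<in> P}"
      using y s P.I_r_closed by simp
  qed (use a in \<open>auto simp: r_distr\<close>)
  define B where "B = Idl {b}"
  have B: "ideal B R" "b \<in> B" unfolding B_def using b by (auto intro: genideal_ideal genideal_self')
  have aB: "a \<otimes> y \<in> P" if "y \<in> B" for y
  proof -
    have "B \<subseteq> {y \<in> carrier R. \<forall>r\<in>carrier R. a \<otimes> r \<otimes> y \<in> P}"
      unfolding B_def using b ab by (intro genideal_minimal[OF 1]) auto
    then have "y \<in> carrier R" "a \<otimes> \<one> \<otimes> y \<in> P" using that by auto
    then show ?thesis using a by simp
  qed
  have Bc: "y \<in> carrier R" if "y \<in> B" for y using that ideal.Icarr[OF B(1)] by blast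
  have 2: "ideal {z \<in> carrier R. \<forall>y\<in>B. z \<otimes> y \<in> P} R"
  proof (rule ideal_closureI)
    fix s z assume s: "s \<in> carrier R" and z: "z \<in> {z \<in> carrier R. \<forall>y\<in>B. z \<otimes> y \<in> P}"
    show "s \<otimes> z \<in> {z \<in> carrier R. \<forall>y\<in>B. z \<otimes> y \<in> P}"
      using z s Bc P.I_l_closed by (simp add: m_assoc)
    show "z \<otimes> s \<in> {z \<in> carrier R. \<forall>y\<in>B. z \<otimes> y \<in> P}"
      using z s Bc ideal.I_l_closed[OF B(1)] by (simp add: m_assoc)
  qed (use Bc in \<open>auto simp: l_distr\<close>)
  define A where "A = Idl {a}"
  have A: "ideal A R" "a \<in> A" unfolding A_def using a by (auto intro: genideal_ideal genideal_self')
  have AB: "z \<otimes> y \<in> P" if "z \<in> A" "y \<in> B" for z y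
  proof -
    have "A \<subseteq> {z \<in> carrier R. \<forall>y\<in>B. z \<otimes> y \<in> P}"
      unfolding A_def using a aB by (intro genideal_minimal[OF 2]) auto
    then show ?thesis using that by auto
  qed
  have "A \<cdot> B \<subseteq> P"
  proof
    fix z assume "z \<in> A \<cdot> B"
    then show "z \<in> P" by (induction z rule: ideal_prod.induct) (auto intro: AB)
  qed
  then have "A \<subseteq> P \<or> B \<subseteq> P" using P A B by (simp add: prime_ideal_def)
  then show ?thesis using A B by blast
qed

end

text \<open>Larger left ideals count as smaller here, so well-foundedness is the ascending chain
  condition.\<close>

definition left_ideal_gt :: "('a, 'b) ring_scheme \<Rightarrow> ('a set \<times> 'a set) set" where
  "left_ideal_gt R = {(L', L). left_ideal L R \<and> left_ideal L' R \<and> L \<subset> L'}"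

section \<open>Goldie's argument without a quotient ring\<close>

locale left_noetherian = ring R for R (structure) +
  assumes acc: "wf (left_ideal_gt R)"
begin

lemma maximal_left_ideal:
  assumes "A \<noteq> {}" "\<And>L. L \<in> A \<Longrightarrow> left_ideal L R"
  shows "\<exists>L\<in>A. \<forall>L'\<in>A. L \<subseteq> L' \<longrightarrow> L' = L"
proof -
  obtain L0 where "L0 \<in> A" using assms(1) by blast
  obtain L where L: "L \<in> A" "\<And>L'. (L', L) \<in> left_ideal_gt R \<Longrightarrow> L' \<notin> A"
    using wfE_min[OF acc \<open>L0 \<in> A\<close>] by metis
  have "L' = L" if "L' \<in> A" "L \<subseteq> L'" for L'
    using L(2)[of L'] assms(2)[OF that(1)] assms(2)[OF L(1)] that unfolding left_ideal_gt_def by blast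
  then show ?thesis using L(1) by blast
qed

context
  fixes P :: "'a set"
  assumes P: "prime_ideal P R"
begin

interpretation P: ideal P R
  using P by (simp add: prime_ideal_def)

text \<open>The preimage in \<open>R\<close> of the left annihilator of the class of
  \<open>c\<close> modulo \<open>P\<close>.\<close>

definition ann :: "'a \<Rightarrow> 'a set" where
  "ann c = {r \<in> carrier R. r \<otimes> c \<in> P}"

lemma ann_left_ideal: "c \<in> carrier R \<Longrightarrow> left_ideal (ann c) R"
  unfolding ann_def by (rule left_idealI) (auto simp: l_distr m_assoc P.I_l_closed)

lemma ann_mult: "c \<in> carrier R \<Longrightarrow> d \<in> carrier R \<Longrightarrow> ann c \<subseteq> ann (c \<otimes> d)"
  by (auto simp: ann_def m_assoc[symmetric] P.I_r_closed)

lemma P_cancel_right: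
  assumes "x = a \<oplus> b" "x \<in> P" "a \<in> carrier R" "b \<in> P" shows "a \<in> P"
proof -
  have "x \<ominus> b = a" using assms P.Icarr by (simp add: minus_eq a_assoc r_neg)
  moreover have "x \<ominus> b \<in> P" using assms(2,4) by (simp add: minus_eq)
  ultimately show ?thesis by simp
qed

lemma P_cancel_left:
  assumes "x = a \<oplus> b" "x \<in> P" "a \<in> P" "b \<in> carrier R" shows "b \<in> P"
  using P_cancel_right[of x b a] assms P.Icarr by (simp add: a_comm)

lemma pow_rotate:
  assumes "a \<in> carrier R" "t \<in> carrier R"
  shows "(a \<otimes> t) [^] Suc k = a \<otimes> ((t \<otimes> a) [^] k \<otimes> t)"
proof (induction k)
  case (Suc k)
  have "(a \<otimes> t) [^] Suc (Suc k) = (a \<otimes> t) [^] Suc k \<otimes> (a \<otimes> t)" by simp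
  also have "\<dots> = a \<otimes> ((t \<otimes> a) [^] Suc k \<otimes> t)"
    unfolding Suc using assms by (simp add: m_assoc)
  finally show ?case .
qed (use assms in simp)

text \<open>A left ideal that is nonzero modulo a prime ideal cannot be nil, by the chain condition
  on annihilators. A suitable power of a non-nilpotent element then has the same annihilator as its
  square.\<close>

lemma non_nilpotent_element:
  assumes N: "left_ideal J R" and "\<not> J \<subseteq> P"
  shows "\<exists>c\<in>J. c \<notin> P \<and> ann (c \<otimes> c) = ann c"
proof -
  note Jc = left_idealD(1)[OF N]
  obtain a where a: "a \<in> J" "a \<notin> P" using assms(2) by blast
  have ac: "a \<in> carrier R" using a Jc by blast
  define Z where "Z = {a \<otimes> s | s. s \<in> carrier R \<and> a \<otimes> s \<notin> P}"
  have "a \<otimes> \<one> \<in> Z" unfolding Z_def using a ac by (intro CollectI exI[of _ "\<one>"]) simp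
  then have "ann ` Z \<noteq> {}" by blast
  moreover have Zc: "z \<in> carrier R" if "z \<in> Z" for z using that ac by (auto simp: Z_def)
  ultimately obtain L where L: "L \<in> ann ` Z" "\<forall>L'\<in>ann ` Z. L \<subseteq> L' \<longrightarrow> L' = L"
    using maximal_left_ideal[of "ann ` Z"] ann_left_ideal by blast
  then obtain z where z: "z \<in> Z" "\<And>y. y \<in> Z \<Longrightarrow> ann z \<subseteq> ann y \<Longrightarrow> ann y = ann z" by blast
  obtain s where s: "s \<in> carrier R" "z = a \<otimes> s" "z \<notin> P" using z(1) by (auto simp: Z_def)
  have zc: "z \<in> carrier R" using z Zc by blast
  have "\<exists>r\<in>carrier R. \<forall>k::nat. (z \<otimes> r) [^] k \<notin> P"
  proof (rule ccontr)
    assume "\<not> ?thesis"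
    then have nil: "\<exists>k::nat. (z \<otimes> r) [^] k \<in> P" if "r \<in> carrier R" for r using that by blast
    have "z \<otimes> r \<otimes> z \<in> P" if r: "r \<in> carrier R" for r
    proof (cases "z \<otimes> r \<in> P")
      case True
      then show ?thesis using zc P.I_r_closed by blast
    next
      case False
      define w where "w = z \<otimes> r"
      have wc: "w \<in> carrier R" using zc r by (simp add: w_def)
      \<comment> \<open>With \<open>k\<close> the nilpotency index of \<open>w\<close> modulo
        \<open>P\<close>, the power of exponent \<open>k - 1\<close> still lies in
        \<open>a R\<close> and is annihilated by \<open>w\<close> from the left. Maximality of
        \<open>ann z\<close> forces \<open>w\<close> to annihilate \<open>z\<close> as well.\<close>
      define k where "k = (LEAST k::nat. w [^] k \<in> P)"
      have k: "w [^] k \<in> P" unfolding k_def w_def using LeastI_ex[OF nil[OF r]] .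
      have "\<one> \<notin> P" using P P.one_imp_carrier by (auto simp: prime_ideal_def)
      then have "k \<noteq> 0" using k by (metis nat_pow_0)
      moreover have "k \<noteq> 1"
      proof
        assume "k = 1"
        then have "w [^] (1::nat) \<in> P" using k by (simp only:)
        then show False using False wc by (simp add: w_def)
      qed
      ultimately obtain k' where k': "k = Suc (Suc k')" using that[of "k - 2"] by linarith
      have nP: "w [^] Suc k' \<notin> P" using not_less_Least[of "Suc k'" "\<lambda>k. w [^] k \<in> P"] k' by (simp add: k_def)
      have e: "w [^] Suc k' = z \<otimes> (r \<otimes> w [^] k')"
        using nat_pow_Suc2[OF wc, of k'] zc r wc by (simp add: w_def m_assoc)
      then have e': "w [^] Suc k' = a \<otimes> (s \<otimes> (r \<otimes> w [^] k'))" using s ac r wc by (simp add: m_assoc)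
      have "s \<otimes> (r \<otimes> w [^] k') \<in> carrier R" using s r wc by simp
      then have "w [^] Suc k' \<in> Z" unfolding Z_def using nP e' by (metis (mono_tags, lifting) mem_Collect_eq)
      moreover have "ann z \<subseteq> ann (w [^] Suc k')" unfolding e using zc r wc by (intro ann_mult) auto
      ultimately have "ann (w [^] Suc k') = ann z" using z(2) by blast
      moreover have "w \<in> ann (w [^] Suc k')"
        using k k' wc nat_pow_Suc2[OF wc, of "Suc k'"] by (simp add: ann_def)
      ultimately show ?thesis by (simp add: ann_def w_def)
    qed
    then show False using prime_ideal_elementwise[OF P zc zc] s(3) by blast
  qed
  then obtain r where r: "r \<in> carrier R" "\<And>k::nat. (z \<otimes> r) [^] k \<notin> P" by blast
  \<comment> \<open>The product \<open>a t\<close> is not nilpotent modulo \<open>P\<close>, but it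
    need not lie in \<open>J\<close>. The rotated product \<open>t a\<close> does, and by
    \<open>pow_rotate\<close> it is not nilpotent either.\<close>
  define t where "t = s \<otimes> r"
  have tc: "t \<in> carrier R" and zr: "z \<otimes> r = a \<otimes> t" using s r ac by (auto simp: t_def m_assoc)
  define d where "d = t \<otimes> a"
  have dJ: "d \<in> J" using left_idealD(4)[OF N tc a(1)] by (simp add: d_def)
  have dc: "d \<in> carrier R" using dJ Jc by blast
  have dP: "d [^] k \<notin> P" for k :: nat
  proof
    assume "d [^] k \<in> P"
    then have "a \<otimes> (d [^] k \<otimes> t) \<in> P" using ac tc P.I_l_closed P.I_r_closed by blast
    then show False using r(2)[of "Suc k"] pow_rotate[OF ac tc, of k] by (simp add: zr d_def)
  qed
  \<comment> \<open>Among the annihilators of the powers of \<open>d\<close> a maximal one is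
    chosen; it is unchanged by squaring.\<close>
  define D where "D = {d [^] Suc k | k. True}"
  have "ann ` D \<noteq> {}" by (auto simp: D_def)
  moreover have "c \<in> carrier R" if "c \<in> D" for c using that dc by (auto simp: D_def)
  ultimately obtain L where L: "L \<in> ann ` D" "\<forall>L'\<in>ann ` D. L \<subseteq> L' \<longrightarrow> L' = L"
    using maximal_left_ideal[of "ann ` D"] ann_left_ideal by blast
  then obtain c where c: "c \<in> D" "\<And>y. y \<in> D \<Longrightarrow> ann c \<subseteq> ann y \<Longrightarrow> ann y = ann c" by blast
  obtain k where k: "c = d [^] Suc k" using c(1) by (auto simp: D_def)
  have cc: "c \<in> carrier R" using k dc by simp
  have "c \<otimes> c = d [^] Suc (Suc (k + k))"
    unfolding k using nat_pow_mult[OF dc, of "Suc k" "Suc k"] by (simp add: add.commute)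
  then have "c \<otimes> c \<in> D" unfolding D_def by blast
  then have "ann (c \<otimes> c) = ann c" using c(2) ann_mult cc by blast
  moreover have "c \<in> J" using left_idealD(4)[OF N _ dJ, of "d [^] k"] dc by (simp add: k)
  moreover have "c \<notin> P" using dP[of "Suc k"] by (simp only: k not_False_eq_True)
  ultimately show ?thesis by blast
qed

text \<open>Goldie's argument: a maximal left ideal \<open>L\<close> that meets \<open>ann c\<close> trivially modulo \<open>P\<close>, for some
  \<open>c \<in> Q\<close> with \<open>ann (c \<otimes> c) = ann c\<close>, leaves no room in \<open>ann c \<inter> Q\<close>.\<close>

lemma regular_element:
  assumes Q: "ideal Q R" and PQ: "P \<subset> Q"
  shows "\<exists>c\<in>Q. \<forall>r\<in>carrier R. r \<otimes> c \<in> P \<longrightarrow> r \<in> P"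
proof -
  interpret Q: ideal Q R by fact
  define A where "A = {L. left_ideal L R \<and> (\<exists>c\<in>Q. ann (c \<otimes> c) = ann c \<and> L \<inter> ann c \<subseteq> P)}"
  \<comment> \<open>The search for a maximal \<open>L\<close> starts with \<open>c = \<zero>\<close>
    and \<open>L = P\<close>.\<close>
  have "ann (\<zero> \<otimes> \<zero>) = ann \<zero>" by simp
  then have "P \<in> A" unfolding A_def using ideal_left[OF P.is_ideal] Q.zero_closed by blast
  then have "A \<noteq> {}" by blast
  moreover have "left_ideal L R" if "L \<in> A" for L using that by (simp add: A_def)
  ultimately obtain L where L: "L \<in> A" "\<And>L'. L' \<in> A \<Longrightarrow> L \<subseteq> L' \<Longrightarrow> L' = L"
    using maximal_left_ideal[of A] by metis
  then obtain c where c: "c \<in> Q" "ann (c \<otimes> c) = ann c" "L \<inter> ann c \<subseteq> P" and Ll: "left_ideal L R"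
    unfolding A_def by blast
  have cc: "c \<in> carrier R" using c Q.Icarr by blast
  have c2: "r \<otimes> c \<in> P" if "r \<in> carrier R" "r \<otimes> c \<otimes> c \<in> P" for r
    using that c(2) cc by (auto simp: ann_def m_assoc)
  have small: "ann c \<inter> Q \<subseteq> P"
  proof (rule ccontr)
    assume "\<not> ann c \<inter> Q \<subseteq> P"
    moreover have "left_ideal (ann c \<inter> Q) R"
      using left_idealD[OF ann_left_ideal[OF cc]] left_idealD[OF ideal_left[OF Q]]
      by (intro left_idealI) auto
    ultimately obtain d where d: "d \<in> ann c" "d \<in> Q" "d \<notin> P" "ann (d \<otimes> d) = ann d"
      using non_nilpotent_element by blast
    have dc: "d \<in> carrier R" and dcP: "d \<otimes> c \<in> P" using d by (auto simp: ann_def)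
    have d2: "r \<otimes> d \<in> P" if "r \<in> carrier R" "r \<otimes> d \<otimes> d \<in> P" for r
      using that d(4) dc by (auto simp: ann_def m_assoc)
    \<comment> \<open>Because \<open>d c\<close> lies in \<open>P\<close>, multiplying
      \<open>r c'\<close> by \<open>c\<close> isolates \<open>r c c\<close>; as \<open>ann c\<close>
      is stable under squaring, \<open>r c'\<close> in \<open>P\<close> forces both
      \<open>r c\<close> and \<open>r d\<close> into \<open>P\<close>.\<close>
    define c' where "c' = c \<oplus> d"
    have c'c: "c' \<in> carrier R" using cc dc by (simp add: c'_def)
    have ann_c': "r \<otimes> c \<in> P \<and> r \<otimes> d \<in> P" if r: "r \<in> carrier R" "r \<otimes> c' \<in> P" for r
    proof -
      have e: "r \<otimes> c' = r \<otimes> c \<oplus> r \<otimes> d" using r cc dc by (simp add: c'_def r_distr)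
      have ec: "r \<otimes> c' \<otimes> c = r \<otimes> c \<otimes> c \<oplus> r \<otimes> (d \<otimes> c)" unfolding e using r cc dc by (simp add: l_distr m_assoc)
      have "r \<otimes> c' \<otimes> c \<in> P" "r \<otimes> (d \<otimes> c) \<in> P" using r cc dcP P.I_r_closed P.I_l_closed by blast+
      then have "r \<otimes> c \<otimes> c \<in> P" using P_cancel_right[OF ec] r(1) cc by blast
      then have rc: "r \<otimes> c \<in> P" using c2 r(1) by blast
      then show ?thesis using P_cancel_left[OF e r(2) rc] r(1) dc by blast
    qed
    have "r \<otimes> c' \<in> P" if r: "r \<in> carrier R" "r \<otimes> (c' \<otimes> c') \<in> P" for r
    proof -
      have "r \<otimes> c' \<in> carrier R" "r \<otimes> c' \<otimes> c' \<in> P" using r c'c by (auto simp: m_assoc)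
      then have 1: "r \<otimes> c' \<otimes> c \<in> P" "r \<otimes> c' \<otimes> d \<in> P" using ann_c' by auto
      have e: "r \<otimes> c' = r \<otimes> c \<oplus> r \<otimes> d" using r cc dc by (simp add: c'_def r_distr)
      have ec: "r \<otimes> c' \<otimes> c = r \<otimes> c \<otimes> c \<oplus> r \<otimes> (d \<otimes> c)" unfolding e using r cc dc by (simp add: l_distr m_assoc)
      have "r \<otimes> (d \<otimes> c) \<in> P" using r dcP P.I_l_closed by blast
      then have "r \<otimes> c \<otimes> c \<in> P" using P_cancel_right[OF ec 1(1)] r(1) cc by blast
      then have rc: "r \<otimes> c \<in> P" using c2 r(1) by blast
      have ed: "r \<otimes> c' \<otimes> d = r \<otimes> c \<otimes> d \<oplus> r \<otimes> d \<otimes> d" unfolding e using r cc dc by (simp add: l_distr)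
      have "r \<otimes> c \<otimes> d \<in> P" using rc dc P.I_r_closed by blast
      then have "r \<otimes> d \<otimes> d \<in> P" using P_cancel_left[OF ed 1(2)] r(1) dc by blast
      then have "r \<otimes> d \<in> P" using d2 r(1) by blast
      then show ?thesis unfolding e using rc by simp
    qed
    then have "ann (c' \<otimes> c') \<subseteq> ann c'" by (auto simp: ann_def)
    then have ann_eq: "ann (c' \<otimes> c') = ann c'" using ann_mult[OF c'c c'c] by blast
    \<comment> \<open>The sum \<open>L + R d\<close> still meets \<open>ann c'\<close> inside
      \<open>P\<close>, and it contains \<open>d\<close>. But \<open>d\<close> is in
      \<open>ann c\<close> and not in \<open>P\<close>, so it is not in \<open>L\<close>, contrary
      to maximality.\<close>
    define L' where "L' = {l \<oplus> r \<otimes> d | l r. l \<in> L \<and> r \<in> carrier R}"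
    note LD = left_idealD[OF Ll]
    have L'l: "left_ideal L' R"
    proof (rule left_idealI)
      show "L' \<subseteq> carrier R" using LD(1) dc by (auto simp: L'_def)
      have "\<zero> = \<zero> \<oplus> \<zero> \<otimes> d" using dc by simp
      then show "\<zero> \<in> L'" unfolding L'_def using LD(2) zero_closed by blast
    next
      fix y y' assume "y \<in> L'" "y' \<in> L'"
      then obtain l r l' r' where *: "y = l \<oplus> r \<otimes> d" "y' = l' \<oplus> r' \<otimes> d" "l \<in> L" "l' \<in> L"
        "r \<in> carrier R" "r' \<in> carrier R" by (auto simp: L'_def)
      then have "l \<in> carrier R" "l' \<in> carrier R" using LD(1) by auto
      then have "y \<oplus> y' = (l \<oplus> l') \<oplus> (r \<oplus> r') \<otimes> d" using * dc by (simp add: l_distr a_ac)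
      then show "y \<oplus> y' \<in> L'" unfolding L'_def using * LD(3) by blast
    next
      fix s y assume s: "s \<in> carrier R" "y \<in> L'"
      then obtain l r where *: "y = l \<oplus> r \<otimes> d" "l \<in> L" "r \<in> carrier R" by (auto simp: L'_def)
      then have "l \<in> carrier R" using LD(1) by auto
      then have "s \<otimes> y = s \<otimes> l \<oplus> (s \<otimes> r) \<otimes> d" using * dc s by (simp add: r_distr m_assoc)
      then show "s \<otimes> y \<in> L'" unfolding L'_def using * LD(4) s by blast
    qed
    have "L' \<inter> ann c' \<subseteq> P"
    proof
      fix y assume y: "y \<in> L' \<inter> ann c'"
      then obtain l r where *: "y = l \<oplus> r \<otimes> d" "l \<in> L" "r \<in> carrier R" by (auto simp: L'_def)
      have lc: "l \<in> carrier R" using * LD(1) by blast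
      have "y \<in> carrier R" "y \<otimes> c' \<in> P" using y by (auto simp: ann_def)
      then have yP: "y \<otimes> c \<in> P" "y \<otimes> d \<in> P" using ann_c' by auto
      have ec: "y \<otimes> c = l \<otimes> c \<oplus> r \<otimes> (d \<otimes> c)" using * lc cc dc by (simp add: l_distr m_assoc)
      have "r \<otimes> (d \<otimes> c) \<in> P" using * dcP P.I_l_closed by blast
      then have "l \<otimes> c \<in> P" using P_cancel_right[OF ec yP(1)] lc cc by blast
      then have "l \<in> P" using c(3) *(2) lc by (auto simp: ann_def)
      have ed: "y \<otimes> d = l \<otimes> d \<oplus> r \<otimes> d \<otimes> d" using * lc dc by (simp add: l_distr)
      have "l \<otimes> d \<in> P" using \<open>l \<in> P\<close> dc P.I_r_closed by blast
      then have "r \<otimes> d \<otimes> d \<in> P" using P_cancel_left[OF ed yP(2)] *(3) dc by blast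
      then have "r \<otimes> d \<in> P" using d2 *(3) by blast
      then show "y \<in> P" using *(1) \<open>l \<in> P\<close> by simp
    qed
    moreover have "c' \<in> Q" using c d by (simp add: c'_def)
    ultimately have "L' \<in> A" unfolding A_def using L'l ann_eq by blast
    moreover have "L \<subseteq> L'"
    proof
      fix l assume l: "l \<in> L"
      then have "l = l \<oplus> \<zero> \<otimes> d" using LD(1) dc by auto
      then show "l \<in> L'" unfolding L'_def using l zero_closed by blast
    qed
    ultimately have "L' = L" using L(2) by blast
    moreover have "d = \<zero> \<oplus> \<one> \<otimes> d" using dc by simp
    then have "d \<in> L'" unfolding L'_def using LD(2) one_closed by blast
    ultimately show False using d c(3) by blast
  qed
  have "r \<in> P" if r: "r \<in> carrier R" "r \<otimes> c \<in> P" for r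
  proof -
    obtain q where q: "q \<in> Q" "q \<notin> P" using PQ by blast
    have qc: "q \<in> carrier R" using q Q.Icarr by blast
    \<comment> \<open>With \<open>q \<in> Q\<close> outside \<open>P\<close>, all products
      \<open>q s r\<close> lie in \<open>ann c \<inter> Q\<close>, hence in \<open>P\<close>;
      primeness then puts \<open>r\<close> into \<open>P\<close>.\<close>
    have "q \<otimes> s \<otimes> r \<in> P" if s: "s \<in> carrier R" for s
    proof -
      have "q \<otimes> s \<otimes> r \<in> Q" using q s r Q.I_r_closed by blast
      moreover have "q \<otimes> s \<otimes> r \<otimes> c = (q \<otimes> s) \<otimes> (r \<otimes> c)" using qc s r cc by (simp add: m_assoc)
      then have "q \<otimes> s \<otimes> r \<otimes> c \<in> P" using P.I_l_closed[OF r(2), of "q \<otimes> s"] qc s by simp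
      ultimately show ?thesis using small qc s r by (auto simp: ann_def)
    qed
    then show ?thesis using prime_ideal_elementwise[OF P qc r(1)] q by blast
  qed
  then show ?thesis using c(1) by blast
qed

end

end

section \<open>Leading exponents of left ideals\<close>

text \<open>The top of the tower, reduced to what division needs: trivial support, a monomial for
  every exponent, and summation of series whose terms reach high degree with a delay
  \<open>t\<close>.\<close>

locale valued_ring = pval R N j v for R (structure) and N j v +
  assumes v_Infty: "a \<in> carrier R \<Longrightarrow> v a = Infty \<Longrightarrow> a = \<zero>"
    and v_onto: "p \<in> Gam N j \<Longrightarrow> \<exists>f\<in>carrier R. v f = Val p"
    and v_complete: "(\<And>m. h m \<in> carrier R) \<Longrightarrow> (\<And>m. enat (m - t) \<le> vdeg N (v (h m))) \<Longrightarrow>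
      \<exists>q\<in>carrier R. \<forall>M. enat (M - t) \<le> vdeg N (v (q \<ominus> finsum R h {..<M}))"
begin

definition lead :: "'a set \<Rightarrow> int poly set" where
  "lead L = {p. \<exists>f\<in>L. v f = Val p}"

lemma lead_Gam:
  assumes "L \<subseteq> carrier R" shows "lead L \<subseteq> Gam N j"
proof
  fix p assume "p \<in> lead L"
  then obtain f where "f \<in> L" "v f = Val p" by (auto simp: lead_def)
  then show "p \<in> Gam N j" using v_Vals[of f] assms by auto
qed

text \<open>A monomial of value \<open>p - q\<close> lifts \<open>g\<close> to the value of
  \<open>f\<close>, after which \<open>v_unit\<close> cancels the leading term. The quotient
  inherits at least the degree of the monomial.\<close>

lemma reduce_step:
  assumes f: "f \<in> carrier R" and g: "g \<in> carrier R" and vf: "v f = Val p" and vg: "v g = Val q"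
    and pq: "p - q \<in> Gam N j"
  shows "\<exists>u\<in>carrier R. v f < v (f \<ominus> u \<otimes> g) \<and> enat (nat (pcoeff p N - pcoeff q N)) \<le> dg u"
proof -
  obtain m where m: "m \<in> carrier R" "v m = Val (p - q)" using v_onto[OF pq] by blast
  have mg: "v (m \<otimes> g) = Val p" using m g vg by (simp add: v_mult)
  then obtain u where u: "u \<in> carrier R" "v f < v (f \<ominus> u \<otimes> (m \<otimes> g))"
    using v_unit[OF f m_closed[OF m(1) g]] vf by (metis val.distinct(1))
  have "dg m \<le> dg (u \<otimes> m)" using u m by (simp add: dg_mult add_increasing)
  moreover have "dg m = enat (nat (pcoeff p N - pcoeff q N))" by (simp add: dg_def m)
  moreover have "u \<otimes> (m \<otimes> g) = (u \<otimes> m) \<otimes> g" using u m g by (simp add: m_assoc)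
  ultimately show ?thesis using u m by (intro bexI[of _ "u \<otimes> m"]) auto
qed

section \<open>Division by a standard basis\<close>

context
  fixes L :: "'a set" and g :: "nat \<Rightarrow> 'a" and r t :: nat
  assumes L: "left_ideal L R"
    and gL: "\<And>i. i < r \<Longrightarrow> g i \<in> L"
    and cover: "\<And>p. p \<in> lead L \<Longrightarrow> \<exists>i<r. \<exists>q. v (g i) = Val q \<and> p - q \<in> Gam N j \<and> pcoeff q N \<le> int t"
begin

lemma g_closed: "i < r \<Longrightarrow> g i \<in> carrier R"
  using gL left_idealD(1)[OF L] by blast

lemma L_closed: "f \<in> L \<Longrightarrow> f \<in> carrier R"
  using left_idealD(1)[OF L] by blast

lemma lin_comb_L: "(\<And>i. Q i \<in> carrier R) \<Longrightarrow> lin_comb r g Q \<in> L"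
  by (rule lin_comb_left_ideal[OF L gL])

text \<open>The last conjunct delays the successive approximation of \<open>f\<close> to the degree of \<open>f\<close>, so that the
  quotients in the limit inherit the degree bound.\<close>

lemma reduce_degree:
  assumes "f \<in> L" "enat m \<le> dg f"
  shows "\<exists>Q. (\<forall>i. Q i \<in> carrier R \<and> enat (m - t) \<le> dg (Q i)) \<and> enat (Suc m) \<le> dg (f \<ominus> lin_comb r g Q)
    \<and> (enat (Suc m) \<le> dg f \<longrightarrow> Q = (\<lambda>_. \<zero>))"
  using assms
\<comment> \<open>Every reduction raises \<open>v f\<close> strictly, and only finitely many
  exponents of degree at most \<open>m\<close> remain to be passed.\<close>
proof (induction "card {p \<in> Gam_le N j m. v f \<le> Val p}" arbitrary: f rule: less_induct)
  case less
  have fc: "f \<in> carrier R" using less.prems L_closed by blast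
  show ?case
  proof (cases "enat (Suc m) \<le> dg f")
    case True
    then show ?thesis using fc lin_comb_zero[of r g, OF g_closed]
      by (intro exI[of _ "\<lambda>_. \<zero>"]) (simp add: minus_eq)
  next
    case False
    then obtain p where p1: "v f = Val p" by (cases "v f") (auto simp: dg_def)
    have pG: "p \<in> Gam N j" using v_Vals[OF fc] p1 by simp
    have "pcoeff p N = int m"
      using False less.prems(2) p1 Gam_N_nonneg[OF pG] by (simp add: dg_def)
    note p = p1 this
    have "p \<in> lead L" using less.prems p by (auto simp: lead_def)
    then obtain i q where i: "i < r" "v (g i) = Val q" "p - q \<in> Gam N j" "pcoeff q N \<le> int t"
      using cover by blast
    obtain u where u: "u \<in> carrier R" "v f < v (f \<ominus> u \<otimes> g i)"
      "enat (nat (pcoeff p N - pcoeff q N)) \<le> dg u"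
      using reduce_step[OF fc g_closed[OF i(1)] p(1) i(2,3)] by blast
    define f' where "f' = f \<ominus> u \<otimes> g i"
    have f'L: "f' \<in> L" unfolding f'_def using less.prems gL[OF i(1)] left_idealD(4,5)[OF L] u by blast
    have f'c: "f' \<in> carrier R" using f'L L_closed by blast
    have dgf': "enat m \<le> dg f'"
    proof -
      have "dg f \<le> dg f'" unfolding dg_def f'_def
        using u(2) v_Vals fc f'c[unfolded f'_def] level by (intro vdeg_mono[of _ N j]) auto
      then show ?thesis using less.prems(2) by (rule order_trans[rotated])
    qed
    have sub: "{p \<in> Gam_le N j m. v f' \<le> Val p} \<subset> {p \<in> Gam_le N j m. v f \<le> Val p}"
    proof
      show "{p \<in> Gam_le N j m. v f' \<le> Val p} \<subseteq> {p \<in> Gam_le N j m. v f \<le> Val p}"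
        using u(2) unfolding f'_def by (auto intro: order_trans less_imp_le)
      have "p \<in> {p \<in> Gam_le N j m. v f \<le> Val p}" "p \<notin> {p \<in> Gam_le N j m. v f' \<le> Val p}"
        using p pG u(2) by (auto simp: Gam_le_def f'_def)
      then show "{p \<in> Gam_le N j m. v f' \<le> Val p} \<noteq> {p \<in> Gam_le N j m. v f \<le> Val p}" by blast
    qed
    have "finite {p \<in> Gam_le N j m. v f \<le> Val p}" using Gam_le_bound[OF level, of m] by simp
    then have "card {p \<in> Gam_le N j m. v f' \<le> Val p} < card {p \<in> Gam_le N j m. v f \<le> Val p}"
      using sub by (rule psubset_card_mono)
    from less.hyps[OF this f'L dgf'] obtain Q where Q0: "\<forall>i. Q i \<in> carrier R \<and> enat (m - t) \<le> dg (Q i)"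
      "enat (Suc m) \<le> dg (f' \<ominus> lin_comb r g Q)" by (elim exE conjE)
    then have Q: "\<And>i. Q i \<in> carrier R" "\<And>i. enat (m - t) \<le> dg (Q i)"
      "enat (Suc m) \<le> dg (f' \<ominus> lin_comb r g Q)" by simp_all
    define U where "U = (\<lambda>k. if k = i then u else \<zero>)"
    have U: "U k \<in> carrier R" for k using u by (simp add: U_def)
    have "enat (m - t) \<le> enat (nat (pcoeff p N - pcoeff q N))" using p i(4) by simp
    then have dgu: "enat (m - t) \<le> dg u" using u(3) by (rule order_trans)
    have "lin_comb r g (\<lambda>k. U k \<oplus> Q k) = u \<otimes> g i \<oplus> lin_comb r g Q"
      using lin_comb_add[of r g U Q, OF g_closed U Q(1)] lin_comb_single[of r g i u, OF g_closed i(1) u(1)]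
      unfolding U_def by simp
    then have eq: "f \<ominus> lin_comb r g (\<lambda>k. U k \<oplus> Q k) = f' \<ominus> lin_comb r g Q"
      unfolding f'_def using fc u g_closed[OF i(1)] lin_comb_closed[of r g Q, OF g_closed Q(1)]
      by (simp add: minus_eq minus_add a_assoc)
    have "enat (m - t) \<le> dg (U k \<oplus> Q k)" for k
      using dgu Q U by (intro dg_add_ge) (auto simp: U_def)
    then show ?thesis using False eq Q U by (intro exI[of _ "\<lambda>k. U k \<oplus> Q k"]) auto
  qed
qed

text \<open>Round \<open>m\<close> clears the degree \<open>m\<close> with quotients of degree at
  least \<open>m - t\<close>, where \<open>t\<close> bounds the degrees of the basis leads. The
  quotients thus form summable series, and the remainder has infinite degree.\<close>

lemma division:
  assumes f: "f \<in> L" and M: "enat M \<le> dg f"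
  shows "\<exists>Q. (\<forall>i. Q i \<in> carrier R \<and> enat (M - t) \<le> dg (Q i)) \<and> f = lin_comb r g Q"
proof -
  define good where "good = (\<lambda>m f Q. (\<forall>i. Q i \<in> carrier R \<and> enat (m - t) \<le> dg (Q i)) \<and>
    enat (Suc m) \<le> dg (f \<ominus> lin_comb r g Q) \<and> (enat (Suc m) \<le> dg f \<longrightarrow> Q = (\<lambda>_. \<zero>)))"
  define H where "H = (\<lambda>m f. SOME Q. good m f Q)"
  have H: "good m f (H m f)" if "f \<in> L" "enat m \<le> dg f" for m f
  proof -
    have "\<exists>Q. good m f Q" unfolding good_def by (rule reduce_degree[OF that])
    then show ?thesis unfolding H_def by (rule someI_ex)
  qed
  define F where "F = rec_nat f (\<lambda>m f. f \<ominus> lin_comb r g (H m f))"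
  have F_Suc: "F (Suc m) = F m \<ominus> lin_comb r g (H m (F m))" and F_0: "F 0 = f" for m
    by (simp_all add: F_def)
  have F: "F m \<in> L \<and> enat m \<le> dg (F m)" for m
  proof (induction m)
    case 0
    then show ?case using f by (simp add: F_0 zero_enat_def[symmetric])
  next
    case (Suc m)
    have "good m (F m) (H m (F m))" using H Suc by blast
    then show ?case unfolding F_Suc using Suc left_idealD(5)[OF L] lin_comb_L by (simp add: good_def)
  qed
  define h where "h = (\<lambda>m. H m (F m))"
  have h: "h m i \<in> carrier R" "enat (m - t) \<le> dg (h m i)" for m i
    using H F unfolding h_def good_def by blast+
  \<comment> \<open>Rounds before the degree \<open>M\<close> of \<open>f\<close> choose zero
    quotients, so the sums start at round \<open>M\<close>; this is the source of the bound
    \<open>M - t\<close>.\<close>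
  have early: "F m = f \<and> (\<forall>i<m. h i = (\<lambda>_. \<zero>))" if "m \<le> M" for m
    using that
  proof (induction m)
    case (Suc m)
    then have Fm: "F m = f" by simp
    have "enat (Suc m) \<le> enat M" using Suc.prems by simp
    then have "enat (Suc m) \<le> dg (F m)" unfolding Fm using M by (rule order_trans)
    then have "h m = (\<lambda>_. \<zero>)" using H[of "F m" m] F unfolding h_def good_def by blast
    moreover have "F (Suc m) = f"
      unfolding F_Suc h_def[symmetric] using calculation Fm lin_comb_zero[of r g, OF g_closed] L_closed[OF f]
      by (simp add: h_def minus_eq)
    ultimately show ?case using Suc by (auto simp: less_Suc_eq)
  qed (simp add: F_0)
  define S where "S = (\<lambda>m i. finsum R (\<lambda>k. h k i) {..<m})"
  have S: "S m i \<in> carrier R" for m i unfolding S_def using h by (intro finsum_closed) auto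
  have S_Suc: "S (Suc m) i = h m i \<oplus> S m i" for m i
    unfolding S_def lessThan_Suc using h by (intro finsum_insert) auto
  have sum: "F m \<oplus> lin_comb r g (S m) = f" for m
  proof (induction m)
    case 0
    have "S 0 = (\<lambda>_. \<zero>)" by (auto simp: S_def)
    then show ?case using lin_comb_zero[of r g, OF g_closed] L_closed[OF f] by (simp add: F_0)
  next
    case (Suc m)
    have "S (Suc m) = (\<lambda>i. h m i \<oplus> S m i)" by (rule ext) (rule S_Suc)
    then have 1: "lin_comb r g (S (Suc m)) = lin_comb r g (h m) \<oplus> lin_comb r g (S m)"
      using lin_comb_add[of r g "h m" "S m", OF g_closed h(1)[of m] S[of m]] by (simp only:)
    have 2: "F (Suc m) = F m \<ominus> lin_comb r g (h m)" by (simp only: F_Suc h_def)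
    have "lin_comb r g (h m) \<in> carrier R" "lin_comb r g (S m) \<in> carrier R" "F m \<in> carrier R"
      using lin_comb_closed[of r g "h m", OF g_closed h(1)] lin_comb_closed[of r g "S m", OF g_closed S]
        F[of m] L_closed by auto
    then show ?case using Suc unfolding 1 2 by (simp add: minus_eq a_assoc r_neg1)
  qed
  have "\<exists>q\<in>carrier R. \<forall>m. enat (m - t) \<le> dg (q \<ominus> S m i)" for i
    unfolding dg_def S_def using h by (intro v_complete) (auto simp: dg_def)
  then obtain q where q0: "\<forall>i. q i \<in> carrier R \<and> (\<forall>m. enat (m - t) \<le> dg (q i \<ominus> S m i))" by metis
  then have q: "q i \<in> carrier R" "enat (m - t) \<le> dg (q i \<ominus> S m i)" for i m by simp_all
  have "enat (M - t) \<le> dg (q i)" for i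
  proof -
    have "S M i = finsum R (\<lambda>_. \<zero>) {..<M}" unfolding S_def using early[of M] by (intro finsum_cong') auto
    then have "q i \<ominus> S M i = q i" using q(1) by (simp add: minus_eq)
    then show ?thesis using q(2)[of M i] by simp
  qed
  moreover have "f = lin_comb r g q"
  proof -
    have gc: "lin_comb r g q \<in> carrier R" by (rule lin_comb_closed) (use g_closed q in auto)
    have "enat m \<le> dg (f \<ominus> lin_comb r g q)" for m
    proof -
      \<comment> \<open>Going \<open>t\<close> rounds further compensates for the delay in the
        convergence of the quotients.\<close>
      let ?m = "m + t"
      have Sc: "lin_comb r g (S ?m) \<in> carrier R" by (rule lin_comb_closed) (use g_closed S in auto)
      have Fc: "F ?m \<in> carrier R" using F L_closed by blast
      have D: "lin_comb r g (\<lambda>i. q i \<ominus> S ?m i) = lin_comb r g q \<ominus> lin_comb r g (S ?m)"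
        using lin_comb_minus[of r g q "S ?m", OF g_closed q(1) S] by simp
      have "f \<ominus> lin_comb r g q = F ?m \<ominus> (lin_comb r g q \<ominus> lin_comb r g (S ?m))"
        using sum[of ?m, symmetric] Fc Sc gc by (simp add: minus_eq minus_add a_ac)
      also have "\<dots> = F ?m \<ominus> lin_comb r g (\<lambda>i. q i \<ominus> S ?m i)" by (simp only: D)
      finally have e: "f \<ominus> lin_comb r g q = F ?m \<ominus> lin_comb r g (\<lambda>i. q i \<ominus> S ?m i)" .
      have "enat m \<le> dg (lin_comb r g (\<lambda>i. q i \<ominus> S ?m i))"
        unfolding lin_comb_def
      proof (rule dg_finsum_ge)
        fix i assume "i \<in> {..<r}"
        then have gi: "g i \<in> carrier R" using g_closed by simp
        have "enat m \<le> dg (q i \<ominus> S ?m i)" using q(2)[of ?m i] by simp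
        also have "\<dots> \<le> dg ((q i \<ominus> S ?m i) \<otimes> g i)" using gi q(1) S by (simp add: dg_mult add_increasing2)
        finally show "enat m \<le> dg ((q i \<ominus> S ?m i) \<otimes> g i)" .
      qed (use g_closed q S in auto)
      moreover have "enat m \<le> dg (F ?m)"
        using F[of ?m] by (meson enat_ord_simps(1) le_add1 order_trans)
      ultimately show ?thesis unfolding e
        using Fc lin_comb_closed[of r g "\<lambda>i. q i \<ominus> S ?m i"] g_closed q(1) S by (intro dg_minus_ge) auto
    qed
    then have "v (f \<ominus> lin_comb r g q) = Infty" by (rule dg_all_imp_Infty)
    then have "f \<ominus> lin_comb r g q = \<zero>" using v_Infty L_closed[OF f] gc by simp
    then show ?thesis using r_right_minus_eq[OF L_closed[OF f] gc] by (simp only:)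
  qed
  ultimately show ?thesis using q(1) by (intro exI[of _ q] conjI allI)
qed

end

lemma standard_basis:
  assumes L: "left_ideal L R"
  obtains r t :: nat and g :: "nat \<Rightarrow> 'a" where "\<And>i. i < r \<Longrightarrow> g i \<in> L"
    "\<And>p. p \<in> lead L \<Longrightarrow> \<exists>i<r. \<exists>q. v (g i) = Val q \<and> p - q \<in> Gam N j \<and> pcoeff q N \<le> int t"
proof -
  obtain G where G: "finite G" "G \<subseteq> lead L" "\<forall>p\<in>lead L. \<exists>q\<in>G. p - q \<in> Gam N j"
    using Dickson[OF lead_Gam[OF left_idealD(1)[OF L]] level] by blast
  obtain xs where xs: "set xs = G" using G(1) finite_list by blast
  have "\<exists>f\<in>L. v f = Val q" if "q \<in> G" for q using that G(2) by (auto simp: lead_def)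
  then obtain F where F: "\<And>q. q \<in> G \<Longrightarrow> F q \<in> L \<and> v (F q) = Val q" by metis
  define t where "t = Max (insert 0 ((\<lambda>q. nat (pcoeff q N)) ` G))"
  show ?thesis
  proof (rule that[of "length xs" "\<lambda>i. F (xs ! i)" t])
    show "F (xs ! i) \<in> L" if "i < length xs" for i using F xs that nth_mem by blast
    fix p assume "p \<in> lead L"
    then obtain q where q: "q \<in> G" "p - q \<in> Gam N j" using G(3) by blast
    obtain i where i: "i < length xs" "xs ! i = q" using q(1) xs by (metis in_set_conv_nth)
    have "nat (pcoeff q N) \<le> t" unfolding t_def using G(1) q(1) by (intro Max_ge) auto
    then have "pcoeff q N \<le> int t" by linarith
    moreover have "v (F (xs ! i)) = Val q" using F[OF q(1)] i(2) by simp
    ultimately show "\<exists>i<length xs. \<exists>q. v (F (xs ! i)) = Val q \<and> p - q \<in> Gam N j \<and> pcoeff q N \<le> int t"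
      using q(2) i(1) by (intro exI[of _ i] exI[of _ q] conjI)
  qed
qed

text \<open>A standard basis of \<open>L'\<close> covers the leading exponents of \<open>L\<close>
  too, so division by it expresses each element of \<open>L\<close> through elements of
  \<open>L'\<close>.\<close>

lemma left_ideal_eqI:
  assumes L: "left_ideal L R" and L': "left_ideal L' R" and "L' \<subseteq> L" "lead L \<subseteq> lead L'"
  shows "L = L'"
proof -
  obtain r t :: nat and g :: "nat \<Rightarrow> 'a" where g: "\<And>i. i < r \<Longrightarrow> g i \<in> L'"
    "\<And>p. p \<in> lead L' \<Longrightarrow> \<exists>i<r. \<exists>q. v (g i) = Val q \<and> p - q \<in> Gam N j \<and> pcoeff q N \<le> int t"
    by (rule standard_basis[OF L']) blast
  have "f \<in> L'" if f: "f \<in> L" for f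
  proof -
    have "\<exists>Q. (\<forall>i. Q i \<in> carrier R \<and> enat (0 - t) \<le> dg (Q i)) \<and> f = lin_comb r g Q"
      by (rule division[OF L]) (use g assms f in \<open>auto simp: zero_enat_def[symmetric]\<close>)
    then show ?thesis using lin_comb_left_ideal[OF L', of r g] g(1) by blast
  qed
  then show ?thesis using assms(3) by blast
qed

text \<open>The union of an ascending chain has a finite standard basis, which lies in one member;
  by division that member is the whole union.\<close>

sublocale left_noetherian R
proof
  show "wf (left_ideal_gt R)"
    unfolding wf_iff_no_infinite_down_chain
  proof
    assume "\<exists>f. \<forall>i. (f (Suc i), f i) \<in> left_ideal_gt R"
    then obtain f where f0: "\<forall>i. (f (Suc i), f i) \<in> left_ideal_gt R" by (rule exE)
    have f: "left_ideal (f i) R" "f i \<subset> f (Suc i)" for i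
      using f0[rule_format, of i] by (simp_all add: left_ideal_gt_def)
    have mono: "f i \<subseteq> f k" if "i \<le> k" for i k
      by (rule lift_Suc_mono_le[of f, OF _ that]) (use f(2) in blast)
    define U where "U = (\<Union>i. f i)"
    have U: "left_ideal U R"
    proof (rule left_idealI)
      show "U \<subseteq> carrier R" using left_idealD(1)[OF f(1)] by (auto simp: U_def)
      show "\<zero> \<in> U" using left_idealD(2)[OF f(1)] by (auto simp: U_def)
      fix a b assume "a \<in> U" "b \<in> U"
      then obtain i k where "a \<in> f i" "b \<in> f k" by (auto simp: U_def)
      then have "a \<in> f (max i k)" "b \<in> f (max i k)" using mono[of i "max i k"] mono[of k "max i k"] by auto
      then show "a \<oplus> b \<in> U" using left_idealD(3)[OF f(1)] by (auto simp: U_def)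
    next
      fix s a assume "s \<in> carrier R" "a \<in> U"
      then show "s \<otimes> a \<in> U" using left_idealD(4)[OF f(1)] by (auto simp: U_def)
    qed
    obtain r t :: nat and g :: "nat \<Rightarrow> 'a" where g: "\<And>i. i < r \<Longrightarrow> g i \<in> U"
      "\<And>p. p \<in> lead U \<Longrightarrow> \<exists>i<r. \<exists>q. v (g i) = Val q \<and> p - q \<in> Gam N j \<and> pcoeff q N \<le> int t"
      by (rule standard_basis[OF U]) blast
    have "\<exists>k. \<forall>i<r. g i \<in> f k" using g(1)
    proof (induction r)
      case (Suc r)
      then obtain k where k: "\<forall>i<r. g i \<in> f k" by (metis less_Suc_eq)
      obtain k' where k': "g r \<in> f k'" using Suc.prems[of r] by (auto simp: U_def)
      have "g i \<in> f (max k k')" if "i < Suc r" for i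
        using that k k' mono[of k "max k k'"] mono[of k' "max k k'"] by (auto simp: less_Suc_eq)
      then show ?case by blast
    qed simp
    then obtain k where k: "\<And>i. i < r \<Longrightarrow> g i \<in> f k" by blast
    have "a \<in> f k" if a: "a \<in> U" for a
    proof -
      have "\<exists>Q. (\<forall>i. Q i \<in> carrier R \<and> enat (0 - t) \<le> dg (Q i)) \<and> a = lin_comb r g Q"
        by (rule division[OF U]) (use g a in \<open>auto simp: zero_enat_def[symmetric]\<close>)
      then show ?thesis using lin_comb_left_ideal[OF f(1), of r g k] k by blast
    qed
    then have "f (Suc k) \<subseteq> f k" by (auto simp: U_def)
    then show False using f(2)[of k] by blast
  qed
qed

lemma lead_zero:
  assumes L: "left_ideal L R" and "0 \<in> lead L" shows "L = carrier R"
proof -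
  obtain f where f: "f \<in> L" "v f = Val 0" using assms by (auto simp: lead_def)
  have C: "left_ideal (carrier R) R" by (rule ideal_left[OF oneideal])
  have "lead (carrier R) \<subseteq> lead L"
  proof
    fix p assume "p \<in> lead (carrier R)"
    then obtain m where m: "m \<in> carrier R" "v m = Val p" by (auto simp: lead_def)
    have "f \<in> carrier R" using f left_idealD(1)[OF L] by blast
    then have "v (m \<otimes> f) = Val p" using m f by (simp add: v_mult)
    then show "p \<in> lead L" using left_idealD(4)[OF L m(1) f(1)] by (auto simp: lead_def)
  qed
  then show ?thesis using left_ideal_eqI[OF C L left_idealD(1)[OF L]] by simp
qed

text \<open>A Hilbert function of \<open>R / L\<close> for the degree filtration: it counts the
  standard monomials.\<close>

definition count :: "'a set \<Rightarrow> nat \<Rightarrow> nat" where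
  "count L m = card {p \<in> Gam_le N j m. p \<notin> lead L}"

lemma finite_count: "finite {p \<in> Gam_le N j m. p \<notin> lead L}"
  using Gam_le_bound[OF level, of m] by simp

lemma count_le: "count L m \<le> (m + 1) ^ j"
proof -
  have "count L m \<le> card (Gam_le N j m)"
    unfolding count_def using Gam_le_bound[OF level, of m] by (intro card_mono) auto
  then show ?thesis using Gam_le_bound[OF level, of m] by linarith
qed

lemma count_pos:
  assumes "left_ideal L R" "L \<noteq> carrier R" shows "1 \<le> count L m"
proof -
  have "0 \<in> {p \<in> Gam_le N j m. p \<notin> lead L}" using lead_zero[OF assms(1)] assms(2) by (auto simp: Gam_le_def)
  then show ?thesis unfolding count_def using finite_count[of m L]
    by (metis One_nat_def Suc_leI card_gt_0_iff empty_iff)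
qed

lemma left_ideal_sum:
  assumes A: "left_ideal A R" and B: "left_ideal B R"
  shows "left_ideal {a \<oplus> b | a b. a \<in> A \<and> b \<in> B} R"
proof (rule left_idealI)
  note AD = left_idealD[OF A] and BD = left_idealD[OF B]
  show "{a \<oplus> b | a b. a \<in> A \<and> b \<in> B} \<subseteq> carrier R" using AD(1) BD(1) by auto
  have "\<zero> = \<zero> \<oplus> \<zero>" by simp
  then show "\<zero> \<in> {a \<oplus> b | a b. a \<in> A \<and> b \<in> B}" using AD(2) BD(2) by blast
  fix x y assume "x \<in> {a \<oplus> b | a b. a \<in> A \<and> b \<in> B}" "y \<in> {a \<oplus> b | a b. a \<in> A \<and> b \<in> B}"
  then obtain a b a' b' where *: "x = a \<oplus> b" "y = a' \<oplus> b'" "a \<in> A" "b \<in> B" "a' \<in> A" "b' \<in> B" by blast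
  then have "a \<in> carrier R" "b \<in> carrier R" "a' \<in> carrier R" "b' \<in> carrier R" using AD(1) BD(1) by auto
  then have "x \<oplus> y = (a \<oplus> a') \<oplus> (b \<oplus> b')" using * by (simp add: a_ac)
  then show "x \<oplus> y \<in> {a \<oplus> b | a b. a \<in> A \<and> b \<in> B}" using * AD(3) BD(3) by blast
next
  note AD = left_idealD[OF A] and BD = left_idealD[OF B]
  fix s x assume s: "s \<in> carrier R" "x \<in> {a \<oplus> b | a b. a \<in> A \<and> b \<in> B}"
  then obtain a b where *: "x = a \<oplus> b" "a \<in> A" "b \<in> B" by blast
  then have "a \<in> carrier R" "b \<in> carrier R" using AD(1) BD(1) by auto
  then have "s \<otimes> x = s \<otimes> a \<oplus> s \<otimes> b" using * s by (simp add: r_distr)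
  then show "s \<otimes> x \<in> {a \<oplus> b | a b. a \<in> A \<and> b \<in> B}" using * s AD(4) BD(4) by blast
qed

lemma left_ideal_times:
  assumes Y: "left_ideal Y R" and c: "c \<in> carrier R"
  shows "left_ideal {y \<otimes> c | y. y \<in> Y} R"
proof (rule left_idealI)
  note D = left_idealD[OF Y]
  show "{y \<otimes> c | y. y \<in> Y} \<subseteq> carrier R" using D(1) c by auto
  have "\<zero> = \<zero> \<otimes> c" using c by simp
  then show "\<zero> \<in> {y \<otimes> c | y. y \<in> Y}" using D(2) by blast
  fix a b assume "a \<in> {y \<otimes> c | y. y \<in> Y}" "b \<in> {y \<otimes> c | y. y \<in> Y}"
  then obtain y y' where *: "a = y \<otimes> c" "b = y' \<otimes> c" "y \<in> Y" "y' \<in> Y" by blast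
  then have "a \<oplus> b = (y \<oplus> y') \<otimes> c" using D(1) c by (simp add: l_distr subsetD)
  then show "a \<oplus> b \<in> {y \<otimes> c | y. y \<in> Y}" using * D(3) by blast
next
  note D = left_idealD[OF Y]
  fix s a assume s: "s \<in> carrier R" "a \<in> {y \<otimes> c | y. y \<in> Y}"
  then obtain y where *: "a = y \<otimes> c" "y \<in> Y" by blast
  then have "s \<otimes> a = (s \<otimes> y) \<otimes> c" using D(1) c s by (simp add: m_assoc subsetD)
  then show "s \<otimes> a \<in> {y \<otimes> c | y. y \<in> Y}" using * s D(4) by blast
qed

text \<open>The element \<open>y\<close> lies in \<open>P + R c\<close> and is divided by a standard
  basis of this left ideal. Modulo \<open>P\<close> the basis elements are multiples of
  \<open>c\<close>, so the quotients combine to \<open>r'\<close>; the loss \<open>s\<close> is the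
  degree bound of the basis.\<close>

lemma Artin_Rees:
  assumes P: "ideal P R" and c: "c \<in> carrier R"
  obtains s where "\<And>M r y. r \<in> carrier R \<Longrightarrow> y \<in> carrier R \<Longrightarrow> enat M \<le> dg y \<Longrightarrow> r \<otimes> c \<ominus> y \<in> P \<Longrightarrow>
    \<exists>r'\<in>carrier R. enat (M - s) \<le> dg r' \<and> (r \<ominus> r') \<otimes> c \<in> P"
proof -
  interpret P: ideal P R by fact
  define L where "L = {p \<oplus> z | p z. p \<in> P \<and> z \<in> {y \<otimes> c | y. y \<in> carrier R}}"
  have L: "left_ideal L R"
    unfolding L_def by (intro left_ideal_sum left_ideal_times ideal_left P oneideal c)
  have LI: "p \<oplus> y \<otimes> c \<in> L" if "p \<in> P" "y \<in> carrier R" for p y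
    unfolding L_def using that by blast
  obtain r t :: nat and g :: "nat \<Rightarrow> 'a" where g: "\<And>i. i < r \<Longrightarrow> g i \<in> L"
    "\<And>p. p \<in> lead L \<Longrightarrow> \<exists>i<r. \<exists>q. v (g i) = Val q \<and> p - q \<in> Gam N j \<and> pcoeff q N \<le> int t"
    by (rule standard_basis[OF L]) blast
  \<comment> \<open>Modulo \<open>P\<close> a combination of basis elements is a multiple of
    \<open>c\<close>, and its left factor is no lower in degree than the coefficients.\<close>
  have comb: "\<exists>r'\<in>carrier R. d \<le> dg r' \<and> lin_comb k g Q \<ominus> r' \<otimes> c \<in> P"
    if "k \<le> r" "\<And>i. Q i \<in> carrier R" "\<And>i. d \<le> dg (Q i)" for k Q d
    using that(1)
  proof (induction k)
    case 0
    then show ?case using c by (intro bexI[of _ \<zero>]) (auto simp: lin_comb_def minus_eq)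
  next
    case (Suc k)
    then obtain r' where r': "r' \<in> carrier R" "d \<le> dg r'" "lin_comb k g Q \<ominus> r' \<otimes> c \<in> P" by auto
    have gk: "g i \<in> carrier R" if "i < Suc k" for i using g(1) left_idealD(1)[OF L] Suc.prems that by (meson less_le_trans subsetD)
    obtain p y where py: "g k = p \<oplus> y \<otimes> c" "p \<in> P" "y \<in> carrier R" using g(1)[of k] Suc.prems by (auto simp: L_def)
    have pc: "p \<in> carrier R" using py P.Icarr by blast
    have lc: "lin_comb k g Q \<in> carrier R" using that(2) gk by (intro lin_comb_closed) auto
    have e: "lin_comb (Suc k) g Q = Q k \<otimes> g k \<oplus> lin_comb k g Q"
      unfolding lin_comb_def lessThan_Suc using gk that(2) by (intro finsum_insert) auto
    define r'' where "r'' = Q k \<otimes> y \<oplus> r'"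
    have r'': "r'' \<in> carrier R" using that(2) py r' by (simp add: r''_def)
    have "d \<le> dg (Q k \<otimes> y)" using that(2,3)[of k] py by (simp add: dg_mult add_increasing2)
    then have "d \<le> dg r''" unfolding r''_def using r' py that(2) by (intro dg_add_ge) auto
    moreover have "lin_comb (Suc k) g Q \<ominus> r'' \<otimes> c = Q k \<otimes> p \<oplus> (lin_comb k g Q \<ominus> r' \<otimes> c)"
    proof -
      define A B D E where "A = Q k \<otimes> p" and "B = Q k \<otimes> y \<otimes> c" and "D = lin_comb k g Q" and "E = r' \<otimes> c"
      have cl: "A \<in> carrier R" "B \<in> carrier R" "D \<in> carrier R" "E \<in> carrier R"
        using that(2) pc py c lc r' by (auto simp: A_def B_def D_def E_def)
      have "lin_comb (Suc k) g Q = (A \<oplus> B) \<oplus> D"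
        unfolding e py(1) A_def B_def D_def using that(2) pc py(3) c by (simp add: r_distr m_assoc)
      moreover have "r'' \<otimes> c = B \<oplus> E"
        unfolding r''_def B_def E_def using that(2) py r' c by (simp add: l_distr)
      moreover have "(A \<oplus> B) \<oplus> D \<ominus> (B \<oplus> E) = A \<oplus> (D \<ominus> E)"
      proof -
        have "(A \<oplus> B) \<oplus> D = (A \<oplus> (D \<ominus> E)) \<oplus> (B \<oplus> E)"
          using cl by (simp add: minus_eq a_assoc a_lcomm[of "\<ominus> E" B E] l_neg) (simp add: a_ac)
        then show ?thesis using cl by (simp add: minus_eq[of _ "B \<oplus> E"] a_assoc r_neg)
      qed
      ultimately show ?thesis by (simp add: A_def D_def E_def)
    qed
    moreover have "Q k \<otimes> p \<in> P" using that(2) py P.I_l_closed by blast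
    ultimately show ?case using r'' r'(3) by (intro bexI[of _ r'']) auto
  qed
  show ?thesis
  proof
    fix M a y assume a: "a \<in> carrier R" and y: "y \<in> carrier R" and M: "enat M \<le> dg y" and ay: "a \<otimes> c \<ominus> y \<in> P"
    have ac: "a \<otimes> c \<in> carrier R" using a c by simp
    have "y = \<ominus> (a \<otimes> c \<ominus> y) \<oplus> a \<otimes> c" using ac y by (simp add: minus_eq minus_add a_ac r_neg2 l_neg r_neg)
    then have yL: "y \<in> L" using LI[of "\<ominus> (a \<otimes> c \<ominus> y)" a] ay a by simp
    have "\<exists>Q. (\<forall>i. Q i \<in> carrier R \<and> enat (M - t) \<le> dg (Q i)) \<and> y = lin_comb r g Q"
      by (rule division[OF L g yL M])
    then obtain Q where Q0: "\<forall>i. Q i \<in> carrier R \<and> enat (M - t) \<le> dg (Q i)" and Qy: "y = lin_comb r g Q"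
      by (elim exE conjE)
    then have Q: "\<And>i. Q i \<in> carrier R" "\<And>i. enat (M - t) \<le> dg (Q i)" by simp_all
    obtain r' where r': "r' \<in> carrier R" "enat (M - t) \<le> dg r'" "y \<ominus> r' \<otimes> c \<in> P"
      using comb[of r Q "enat (M - t)", OF order_refl Q] unfolding Qy by blast
    have r'c: "r' \<otimes> c \<in> carrier R" using r' c by simp
    have "(a \<ominus> r') \<otimes> c = a \<otimes> c \<ominus> r' \<otimes> c" using a r' c by (simp add: minus_eq l_distr l_minus)
    also have "\<dots> = (a \<otimes> c \<ominus> y) \<oplus> (y \<ominus> r' \<otimes> c)" using ac y r'c by (simp add: minus_eq a_assoc r_neg1)
    also have "\<dots> \<in> P" using ay r'(3) by simp
    finally show "\<exists>r'\<in>carrier R. enat (M - t) \<le> dg r' \<and> (a \<ominus> r') \<otimes> c \<in> P" using r' by blast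
  qed
qed

end

section \<open>Growth of the counting function\<close>

context valued_ring
begin

lemma v_add_dominated:
  assumes "f \<in> carrier R" "z \<in> carrier R" "v f = Val p" "Val p < v z"
  shows "v (f \<ominus> z) = Val p"
  using v_add_eq[of f "\<ominus> z"] assms by (simp add: minus_eq v_uminus)

lemma dg_gt_imp_v_gt:
  assumes z: "z \<in> carrier R" and p: "p \<in> Gam N j" "pcoeff p N < int m" and m: "enat m \<le> dg z"
  shows "Val p < v z"
proof (cases "v z")
  case (Val q)
  have q: "q \<in> Gam N j" using v_Vals[OF z] Val by simp
  have "pcoeff p N < pcoeff q N" using m p(2) Val Gam_N_nonneg[OF q] by (simp add: dg_def)
  then show ?thesis using Gam_lessI[OF p(1) q level] Val by simp
qed simp

lemma left_ideal_dg: "left_ideal {z \<in> carrier R. m \<le> dg z} R"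
  by (rule ideal_left[OF ideal_dg])

text \<open>Right multiplication by \<open>c\<close> embeds \<open>R / P\<close> into \<open>Q / P\<close>; the shift \<open>s\<close> comes from the
  Artin--Rees bound.\<close>

lemma count_drop:
  assumes P: "ideal P R" and Q: "left_ideal Q R" and PQ: "P \<subseteq> Q" and c: "c \<in> Q"
    and reg: "\<And>r. r \<in> carrier R \<Longrightarrow> r \<otimes> c \<in> P \<Longrightarrow> r \<in> P"
  shows "\<exists>s. \<forall>s'\<ge>s. \<forall>m. count Q (m + s') + count P m \<le> count P (m + s')"
proof -
  have cc: "c \<in> carrier R" using c left_idealD(1)[OF Q] by blast
  interpret P: ideal P R by fact
  obtain s where AR: "\<And>M r y. r \<in> carrier R \<Longrightarrow> y \<in> carrier R \<Longrightarrow> enat M \<le> dg y \<Longrightarrow> r \<otimes> c \<ominus> y \<in> P \<Longrightarrow>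
    \<exists>r'\<in>carrier R. enat (M - s) \<le> dg r' \<and> (r \<ominus> r') \<otimes> c \<in> P"
    by (rule Artin_Rees[OF P cc]) blast
  show ?thesis
  proof (intro exI[of _ s] allI impI)
    fix s' m assume s': "s \<le> s'"
    \<comment> \<open>Everything of degree above \<open>m + s'\<close> is discarded, so new leading
      exponents are found within the range being counted.\<close>
    define J where "J = {z \<in> carrier R. enat (m + s' + 1) \<le> dg z}"
    have J: "left_ideal J R" unfolding J_def by (rule left_ideal_dg)
    define Sm where "Sm = (\<lambda>U. {p \<oplus> y | p y. p \<in> P \<and>
      y \<in> {a \<oplus> b | a b. a \<in> {y \<otimes> c | y. y \<in> {y \<in> carrier R. v y \<in> U}} \<and> b \<in> J}})"
    have Sm: "left_ideal (Sm U) R" if "\<And>x y. x \<in> U \<Longrightarrow> x \<le> y \<Longrightarrow> y \<in> U" "Infty \<in> U" for U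
    proof -
      have "ideal {y \<in> carrier R. v y \<in> U} R" using that by (rule ideal_up)
      then show ?thesis unfolding Sm_def by (intro left_ideal_sum left_ideal_times ideal_left P J cc)
    qed
    have Sm_iff: "x \<in> Sm U \<longleftrightarrow> (\<exists>p y z. x = p \<oplus> (y \<otimes> c \<oplus> z) \<and> p \<in> P \<and> y \<in> carrier R \<and> v y \<in> U \<and> z \<in> J)" for x U
      unfolding Sm_def by blast
    have SmI: "p \<oplus> (y \<otimes> c \<oplus> z) \<in> Sm U" if "p \<in> P" "y \<in> carrier R" "v y \<in> U" "z \<in> J" for p y z U
      unfolding Sm_iff using that by blast
    \<comment> \<open>Modulo \<open>P\<close> and \<open>J\<close>, these are the multiples
      \<open>y c\<close> with \<open>y\<close> of value at least \<open>\<beta>\<close>,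
      respectively above \<open>\<beta>\<close>. Each \<open>\<beta>\<close> outside
      \<open>lead P\<close> is shown to make this step strict.\<close>
    define M1 where "M1 = (\<lambda>\<beta>. Sm {x. Val \<beta> \<le> x})"
    define M2 where "M2 = (\<lambda>\<beta>. Sm {x. Val \<beta> < x})"
    have M1: "left_ideal (M1 \<beta>) R" and M2: "left_ideal (M2 \<beta>) R" for \<beta>
      unfolding M1_def M2_def by (rule Sm; auto)+
    have Sm_mono: "Sm U \<subseteq> Sm U'" if "U \<subseteq> U'" for U U'
    proof
      fix x assume "x \<in> Sm U"
      then obtain p y z where "x = p \<oplus> (y \<otimes> c \<oplus> z)" "p \<in> P" "y \<in> carrier R" "v y \<in> U" "z \<in> J"
        unfolding Sm_iff by blast
      then show "x \<in> Sm U'" unfolding Sm_iff using that by blast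
    qed
    have M21: "M2 \<beta> \<subseteq> M1 \<beta>" for \<beta>
      unfolding M1_def M2_def by (rule Sm_mono) auto
    have M12: "M1 \<beta>' \<subseteq> M2 \<beta>" if "\<beta> < \<beta>'" for \<beta> \<beta>'
      unfolding M1_def M2_def using that
      by (intro Sm_mono subsetI) (auto intro: order_less_le_trans[of "Val \<beta>" "Val \<beta>'"])
    define B where "B = {\<beta> \<in> Gam_le N j m. \<beta> \<notin> lead P}"
    have "\<exists>\<alpha>. \<alpha> \<in> lead (M1 \<beta>) \<and> \<alpha> \<notin> lead (M2 \<beta>)" if \<beta>: "\<beta> \<in> B" for \<beta>
    proof (rule ccontr)
      assume "\<not> ?thesis"
      then have "lead (M1 \<beta>) \<subseteq> lead (M2 \<beta>)" by blast
      then have eq: "M1 \<beta> = M2 \<beta>" by (rule left_ideal_eqI[OF M1 M2 M21])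
      have \<beta>G: "\<beta> \<in> Gam N j" "pcoeff \<beta> N \<le> int m" "\<beta> \<notin> lead P" using \<beta> by (auto simp: B_def Gam_le_def)
      obtain f where f: "f \<in> carrier R" "v f = Val \<beta>" using v_onto[OF \<beta>G(1)] by blast
      have "\<zero> \<oplus> (f \<otimes> c \<oplus> \<zero>) \<in> M1 \<beta>"
        unfolding M1_def by (rule SmI) (use f left_idealD(2)[OF J] in simp_all)
      then have "f \<otimes> c \<in> M1 \<beta>" using f cc by simp
      then obtain p y z where *: "f \<otimes> c = p \<oplus> (y \<otimes> c \<oplus> z)" "p \<in> P" "y \<in> carrier R" "Val \<beta> < v y" "z \<in> J"
        unfolding eq M2_def Sm_iff by blast
      have zc: "z \<in> carrier R" "enat (m + s' + 1) \<le> dg z" using * by (auto simp: J_def)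
      have pc: "p \<in> carrier R" using * P.Icarr by blast
      have yc: "y \<otimes> c \<in> carrier R" using * cc by simp
      have "(f \<ominus> y) \<otimes> c \<ominus> z = f \<otimes> c \<ominus> y \<otimes> c \<ominus> z" using f * cc by (simp add: minus_eq l_distr l_minus)
      also have "\<dots> = p" unfolding *(1) using pc yc zc
        by (simp add: minus_eq a_assoc) (simp add: a_ac r_neg r_neg1 r_neg2)
      finally have "(f \<ominus> y) \<otimes> c \<ominus> z \<in> P" using * by simp
      then have "\<exists>r'\<in>carrier R. enat (m + s' + 1 - s) \<le> dg r' \<and> ((f \<ominus> y) \<ominus> r') \<otimes> c \<in> P"
        using zc by (intro AR[of "f \<ominus> y" z]) (use f * in simp_all)
      then obtain r' where r': "r' \<in> carrier R" "enat (m + s' + 1 - s) \<le> dg r'" "((f \<ominus> y) \<ominus> r') \<otimes> c \<in> P"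
        by (elim bexE conjE)
      have inP: "(f \<ominus> y) \<ominus> r' \<in> P" by (rule reg) (use r' f * in simp_all)
      \<comment> \<open>The extra 1 in \<open>J\<close> leaves \<open>r'\<close> with degree above
        \<open>m\<close>, hence beyond \<open>\<beta>\<close>. So
        \<open>f \<ominus> y \<ominus> r'\<close> keeps the leading exponent \<open>\<beta>\<close>
        although regularity of \<open>c\<close> places it in \<open>P\<close>.\<close>
      have "enat (m + 1) \<le> enat (m + s' + 1 - s)" using s' by simp
      then have "enat (m + 1) \<le> dg r'" using r'(2) by (rule order_trans)
      then have "Val \<beta> < v r'" using dg_gt_imp_v_gt[OF r'(1) \<beta>G(1), of "m + 1"] \<beta>G(2) by simp
      then have "v ((f \<ominus> y) \<ominus> r') = Val \<beta>"
        using v_add_dominated[of "f \<ominus> y" r' \<beta>] v_add_dominated[of f y \<beta>] f * r'(1) by simp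
      then show False using inP \<beta>G(3) by (auto simp: lead_def)
    qed
    then obtain \<alpha> where \<alpha>: "\<And>\<beta>. \<beta> \<in> B \<Longrightarrow> \<alpha> \<beta> \<in> lead (M1 \<beta>) \<and> \<alpha> \<beta> \<notin> lead (M2 \<beta>)" by metis
    \<comment> \<open>For \<open>\<beta> < \<beta>'\<close> the larger layer of
      \<open>\<beta>'\<close> sits inside the smaller layer of \<open>\<beta>\<close>, so an
      exponent that is new for one is not new for the other.\<close>
    have inj: "inj_on \<alpha> B"
    proof (rule inj_onI, rule ccontr)
      fix \<beta> \<beta>' assume *: "\<beta> \<in> B" "\<beta>' \<in> B" "\<alpha> \<beta> = \<alpha> \<beta>'" "\<beta> \<noteq> \<beta>'"
      have lm: "lead A \<subseteq> lead A'" if "A \<subseteq> A'" for A A' using that by (auto simp: lead_def)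
      consider "\<beta> < \<beta>'" | "\<beta>' < \<beta>" using *(4) by (meson linorder_neqE)
      then show False
        by cases (use \<alpha>[OF *(1)] \<alpha>[OF *(2)] *(3) lm[OF M12] in auto)
    qed
    \<comment> \<open>A new exponent avoids \<open>lead P\<close> and all degrees beyond
      \<open>m + s'\<close>, since both \<open>P\<close> and \<open>J\<close> lie in
      \<open>M2 \<beta>\<close>. It belongs to \<open>lead Q\<close> because the
      \<open>J\<close>-part cannot affect it.\<close>
    have sub: "\<alpha> ` B \<subseteq> {p \<in> Gam_le N j (m + s'). p \<notin> lead P} - {p \<in> Gam_le N j (m + s'). p \<notin> lead Q}"
    proof
      fix a assume "a \<in> \<alpha> ` B"
      then obtain \<beta> where \<beta>: "\<beta> \<in> B" "a = \<alpha> \<beta>" by blast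
      have a1: "a \<in> lead (M1 \<beta>)" and a2: "a \<notin> lead (M2 \<beta>)" using \<alpha>[OF \<beta>(1)] \<beta>(2) by auto
      have aG: "a \<in> Gam N j" using a1 lead_Gam[OF left_idealD(1)[OF M1]] by blast
      have adeg: "pcoeff a N \<le> int (m + s')"
      proof (rule ccontr)
        assume n: "\<not> ?thesis"
        obtain z where z: "z \<in> carrier R" "v z = Val a" using v_onto[OF aG] by blast
        then have "z \<in> J" using n by (simp add: J_def dg_def)
        then have "\<zero> \<oplus> (\<zero> \<otimes> c \<oplus> z) \<in> M2 \<beta>" unfolding M2_def by (intro SmI) (simp_all add: v_zero)
        then have "z \<in> M2 \<beta>" using z cc by simp
        then show False using a2 z by (auto simp: lead_def)
      qed
      have "a \<notin> lead P"
      proof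
        assume "a \<in> lead P"
        then obtain p where p: "p \<in> P" "v p = Val a" by (auto simp: lead_def)
        have "p \<oplus> (\<zero> \<otimes> c \<oplus> \<zero>) \<in> M2 \<beta>" unfolding M2_def
          using p left_idealD(2)[OF J] by (intro SmI) (simp_all add: v_zero)
        then have "p \<in> M2 \<beta>" using p cc P.Icarr by simp
        then show False using a2 p by (auto simp: lead_def)
      qed
      moreover have "a \<in> lead Q"
      proof -
        obtain f where f: "f \<in> M1 \<beta>" "v f = Val a" using a1 by (auto simp: lead_def)
        obtain p y z where *: "f = p \<oplus> (y \<otimes> c \<oplus> z)" "p \<in> P" "y \<in> carrier R" "z \<in> J"
          using f(1) unfolding M1_def Sm_iff by blast
        have zc: "z \<in> carrier R" "enat (m + s' + 1) \<le> dg z" using * by (auto simp: J_def)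
        have pc: "p \<in> carrier R" using * P.Icarr by blast
        have fc: "f \<in> carrier R" using * pc zc cc by simp
        have "Val a < v z" using dg_gt_imp_v_gt[OF zc(1) aG _ zc(2)] adeg by simp
        then have "v (f \<ominus> z) = Val a" using v_add_dominated[OF fc zc(1) f(2)] by simp
        moreover have "f \<ominus> z = p \<oplus> y \<otimes> c" unfolding *(1) using pc zc * cc by (simp add: minus_eq a_assoc r_neg)
        moreover have "p \<oplus> y \<otimes> c \<in> Q" using left_idealD(3,4)[OF Q] * PQ c by blast
        ultimately show ?thesis by (auto simp: lead_def)
      qed
      ultimately show "a \<in> {p \<in> Gam_le N j (m + s'). p \<notin> lead P} - {p \<in> Gam_le N j (m + s'). p \<notin> lead Q}"
        using aG adeg by (simp add: Gam_le_def)
    qed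
    have QP: "{p \<in> Gam_le N j (m + s'). p \<notin> lead Q} \<subseteq> {p \<in> Gam_le N j (m + s'). p \<notin> lead P}"
      using PQ by (auto simp: lead_def)
    have "count P m = card (\<alpha> ` B)" unfolding count_def B_def[symmetric] using inj by (simp add: card_image)
    also have "\<dots> \<le> card ({p \<in> Gam_le N j (m + s'). p \<notin> lead P} - {p \<in> Gam_le N j (m + s'). p \<notin> lead Q})"
      using sub finite_count by (intro card_mono) auto
    also have "\<dots> = count P (m + s') - count Q (m + s')"
      unfolding count_def using QP finite_count by (intro card_Diff_subset) auto
    finally have "count P m \<le> count P (m + s') - count Q (m + s')" .
    moreover have "count Q (m + s') \<le> count P (m + s')"
      unfolding count_def using QP finite_count by (intro card_mono) auto
    ultimately show "count Q (m + s') + count P m \<le> count P (m + s')" by linarith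
  qed
qed

text \<open>Each strict inclusion turns \<open>count_drop\<close> into a difference inequality, and
  Pascal's rule solves it. \<open>K\<close> rescales \<open>m\<close> to absorb the shifts.\<close>

lemma count_growth:
  assumes prime: "\<And>i. i \<le> t \<Longrightarrow> prime_ideal (P i) R" and strict: "\<And>i. i < t \<Longrightarrow> P i \<subset> P (Suc i)"
  shows "k \<le> t \<Longrightarrow> \<exists>K\<ge>1. \<forall>m. m choose k \<le> count (P (t - k)) (K * m)"
proof (induction k)
  case 0
  have "left_ideal (P t) R" "P t \<noteq> carrier R" using prime[of t] by (auto simp: prime_ideal_def ideal_left)
  then show ?case using count_pos by (intro exI[of _ 1]) simp
next
  case (Suc k)
  define A where "A = P (t - Suc k)"
  define B where "B = P (t - k)"
  have id: "t - k = Suc (t - Suc k)" "t - Suc k < t" using Suc.prems by auto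
  have pA: "prime_ideal A R" and pB: "prime_ideal B R" and AB: "A \<subset> B"
    unfolding A_def B_def using prime strict[of "t - Suc k"] id by auto
  have iA: "ideal A R" and iB: "ideal B R" using pA pB by (auto simp: prime_ideal_def)
  obtain K where K: "1 \<le> K" "\<And>m. m choose k \<le> count B (K * m)" using Suc by (auto simp: B_def)
  obtain c where c: "c \<in> B" "\<And>r. r \<in> carrier R \<Longrightarrow> r \<otimes> c \<in> A \<Longrightarrow> r \<in> A"
    using regular_element[OF pA iB AB] by blast
  obtain s where s: "\<And>s' m. s \<le> s' \<Longrightarrow> count B (m + s') + count A m \<le> count A (m + s')"
    using count_drop[OF iA ideal_left[OF iB] _ c] AB by blast
  \<comment> \<open>The step \<open>K * S\<close> is a multiple of \<open>K\<close>, so the bound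
    for \<open>B\<close> applies at its multiples, and it dominates the shift \<open>s\<close>; the
    added 1 keeps it positive.\<close>
  define S where "S = s + 1"
  have "1 * S \<le> K * S" using K(1) by (rule mult_le_mono1)
  then have KS: "s \<le> K * S" "1 \<le> K * S" unfolding S_def by simp_all
  have "m choose Suc k \<le> count A (K * S * m)" for m
  proof (induction m)
    case (Suc m)
    have "m choose k \<le> S * Suc m choose k"
      by (rule binomial_right_mono) (simp add: S_def)
    also have "\<dots> \<le> count B (K * (S * Suc m))" by (rule K(2))
    also have "K * (S * Suc m) = K * S * m + K * S" by (simp add: algebra_simps)
    finally have "m choose k \<le> count B (K * S * m + K * S)" .
    then have "Suc m choose Suc k \<le> count B (K * S * m + K * S) + count A (K * S * m)"
      using Suc by simp
    also have "\<dots> \<le> count A (K * S * m + K * S)" by (rule s[OF KS(1)])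
    also have "K * S * m + K * S = K * S * Suc m" by simp
    finally show ?case .
  qed simp
  then show ?case using KS(2) unfolding A_def by blast
qed

text \<open>Growth of order \<open>t\<close> from below meets the bound of order \<open>j\<close>
  from above. The comparison is made at arguments \<open>t * L\<close>, where the binomial
  coefficient is at least \<open>L ^ t\<close>.\<close>

lemma prime_chain_length:
  assumes "\<And>i. i \<le> t \<Longrightarrow> prime_ideal (P i) R" "\<And>i. i < t \<Longrightarrow> P i \<subset> P (Suc i)"
  shows "t \<le> j"
proof (rule ccontr)
  assume "\<not> t \<le> j"
  then have t: "j < t" by simp
  obtain K where K: "\<And>m. m choose t \<le> count (P 0) (K * m)"
    using count_growth[of t P t, OF assms order_refl] by auto
  \<comment> \<open>One more than the constant \<open>(K * t + 1) ^ j\<close> that remains after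
    factoring \<open>L ^ j\<close> out of the upper bound.\<close>
  define L where "L = (K * t + 1) ^ j + 1"
  have "1 \<le> L" by (simp add: L_def)
  then have KL: "K * (t * L) + 1 \<le> (K * t + 1) * L" by (simp add: algebra_simps)
  have "real (L ^ t) = (real (t * L) / real t) ^ t" using t by simp
  also have "\<dots> \<le> real (t * L choose t)"
    using binomial_ge_n_over_k_pow_k[of t "t * L", where ?'a = real] by (simp add: L_def)
  finally have "L ^ t \<le> t * L choose t" by (simp only: of_nat_le_iff)
  also have "\<dots> \<le> count (P 0) (K * (t * L))" by (rule K)
  also have "\<dots> \<le> (K * (t * L) + 1) ^ j" by (rule count_le)
  also have "\<dots> \<le> ((K * t + 1) * L) ^ j" using KL by (rule power_mono) simp
  also have "\<dots> = (K * t + 1) ^ j * L ^ j" by (rule power_mult_distrib)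
  also have "\<dots> < L * L ^ j" by (simp add: L_def)
  also have "\<dots> = L ^ Suc j" by simp
  also have "\<dots> \<le> L ^ t" using t by (intro power_increasing) (auto simp: L_def)
  finally show False by simp
qed

lemma krull_dim_le: "krull_dim R \<le> enat j"
  unfolding krull_dim_def
proof (rule Sup_least)
  fix d assume "d \<in> {enat t | t. \<exists>P. (\<forall>i\<le>t. prime_ideal (P i) R) \<and> (\<forall>i<t. P i \<subset> P (Suc i))}"
  then obtain t P where t: "d = enat t" "\<forall>i\<le>t. prime_ideal (P i) R" "\<forall>i<t. P i \<subset> P (Suc i)" by blast
  have "t \<le> j" by (rule prime_chain_length[of t P]) (use t in simp_all)
  then show "d \<le> enat j" using t(1) by simp
qed

end

section \<open>The valuation on the top ring and the dimension\<close>

context tower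
begin

lemma vv_x: assumes "l < n" shows "vv 0 n (x (Suc l)) = Val (evec N (Suc l))"
proof -
  have lv: "level_ok l" and g: "pval (K l) N l (vv 0 l)" using level pval_zero assms by auto
  interpret L: pval "K l" N l "vv 0 l" by fact
  have xc: "x (Suc l) \<in> C (Suc l)" "cf l (x (Suc l)) = ps_var R" using lv by (auto simp: level_ok_def)
  obtain s where s: "vv 0 (Suc l) (x (Suc l)) = vv 0 l (cf l (x (Suc l)) s) + Val (of_nat s * evec N (Suc l))"
    using vv_ext(1)[OF _ assms g lv xc(1)] by auto
  have "vv 0 (Suc l) (x (Suc l)) \<le> vv 0 l \<one> + Val (of_nat 1 * evec N (Suc l))"
    using vv_ext(2)[OF _ assms g lv xc(1), of 1] by (simp add: xc(2) ps_var_def)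
  then have "vv 0 (Suc l) (x (Suc l)) \<noteq> Infty" using L.v_one by (auto simp: zero_val_def)
  then have "s = 1" using s L.v_zero by (auto simp: xc(2) ps_var_def split: if_splits)
  then have "vv 0 (Suc l) (x (Suc l)) = Val (evec N (Suc l))"
    using s L.v_one by (simp add: xc(2) ps_var_def zero_val_def)
  moreover have "vv 0 n (x (Suc l)) = vv 0 (Suc l) (x (Suc l))"
    by (rule vv_const_le) (use assms pval_zero level xc in auto)
  ultimately show ?thesis by simp
qed

lemma valued_ring: "valued_ring R N n (vv 0 n)"
proof -
  have "pval R N n (vv 0 n)" using pval_zero[of n] K_n by simp
  then interpret V: pval R N n "vv 0 n" .
  \<comment> \<open>Monomials realise all exponents: one variable is split off by
    \<open>Gam_pred\<close>, which lowers the degree by one.\<close>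
  have onto: "\<exists>f\<in>carrier R. vv 0 n f = Val p" if "p \<in> Gam N n" for p
    using that
  proof (induction "nat (pcoeff p N)" arbitrary: p rule: less_induct)
    case less
    show ?case
    proof (cases "p = 0")
      case True
      then show ?thesis using V.v_one by (intro bexI[of _ "\<one>"]) (auto simp: zero_val_def)
    next
      case False
      then obtain l where l: "1 \<le> l" "l \<le> n" "p - evec N l \<in> Gam N n" using Gam_pred[OF less.prems] by auto
      have c: "pcoeff (p - evec N l) N = pcoeff p N - 1" using l by (simp add: evec_coeff)
      have "nat (pcoeff (p - evec N l) N) < nat (pcoeff p N)" using c Gam_N_nonneg[OF l(3)] by simp
      then obtain f where f: "f \<in> carrier R" "vv 0 n f = Val (p - evec N l)" using less.hyps l(3) by blast
      obtain l' where l': "l = Suc l'" using l by (cases l) auto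
      have "vv 0 n (x l) = Val (evec N l)" "x l \<in> carrier R" using vv_x[of l'] vv_x_finite(3)[of l'] l l' by auto
      then show ?thesis using f V.v_mult[of f "x l"] by (intro bexI[of _ "f \<otimes> x l"]) auto
    qed
  qed
  show ?thesis
  proof (intro valued_ring.intro valued_ring_axioms.intro V.pval_axioms)
    show "a = \<zero>" if "a \<in> carrier R" "vv 0 n a = Infty" for a
      using vv_Infty_iff[of n a] that C_n by simp
  qed (use onto complete_R in blast)+
qed

lemma krull_dim_eq: "krull_dim R = enat n"
  using valued_ring.krull_dim_le[OF valued_ring] krull_dim_ge by (rule antisym)

end

theorem theorem4p4:
  fixes R :: "('a, 'b) ring_scheme" and k :: "'a set" and n :: nat
  assumes "ring R"
    and "subring k R"
    and "division_ring (R\<lparr>carrier := k\<rparr>)"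
    and "n \<ge> 1"
    and "RSPS n k R"
  shows "krull_dim R = enat n"
proof -
  obtain C x \<sigma> \<delta> where C: "C 0 = k" "C n = carrier R" "\<forall>i\<le>n. subring (C i) R"
    "\<forall>i. 1 \<le> i \<and> i \<le> n \<longrightarrow> C (i - 1) \<subset> C i \<and>
       is_skew_ps_ext (R\<lparr>carrier := C (i - 1)\<rparr>) (R\<lparr>carrier := C i\<rparr>) (\<sigma> i) (\<delta> i) (x i)"
    "\<forall>i j. i < j \<and> j \<le> n \<longrightarrow>
       \<sigma> j ` max_ideal (R\<lparr>carrier := C i\<rparr>) \<subseteq> max_ideal (R\<lparr>carrier := C i\<rparr>) \<and>
       \<delta> j ` max_ideal (R\<lparr>carrier := C i\<rparr>) \<subseteq> max_ideal (R\<lparr>carrier := C i\<rparr>)"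
    using assms(5) unfolding RSPS_def by (elim exE conjE)
  have "tower R n C x \<sigma> \<delta>"
  proof (intro tower.intro tower_axioms.intro)
    show "is_skew_ps_ext (R\<lparr>carrier := C i\<rparr>) (R\<lparr>carrier := C (Suc i)\<rparr>) (\<sigma> (Suc i)) (\<delta> (Suc i)) (x (Suc i))"
      if "i < n" for i using C(4)[rule_format, of "Suc i"] that by simp
  qed (use assms C in auto)
  then show ?thesis by (rule tower.krull_dim_eq)
qed

end
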